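(* Let $V$ be an irreducible finite-dimensional $U_q\widehat{\mathfrak g}$-module (of type 1), with highest weight monomial $m_+$. Then its $q$-character has the form $\chi_q(V)=m_+\left(1+\sum_pM_p\right)$, where each $M_p$ is a monomial in $A_{i,c}^{-1}$, $i\in I$, $c\in\mathbb C^\times$ (i.e., it does not contain any factors $A_{i,c}$).
   Context: Root data. $\mathfrak g$ is a simple Lie algebra over $\mathbb C$ of rank $\ell$, $I=\{1,\dots,\ell\}$, with simple roots $\alpha_i$ and fundamental weights $\omega_i$; $r^\vee$ is the maximal number of edges connecting two vertices of the Dynkin diagram. $(\cdot,\cdot)$ is the invariant inner product on the dual of the Cartan subalgebra normalized so that the maximal root has square length $2r^\vee$. Put $r_i=(\alpha_i,\alpha_i)/2$, $C_{ij}=2(\alpha_i,\alpha_j)/(\alpha_i,\alpha_i)$, $B_{ij}=(\alpha_i,\alpha_j)$. Fix $q\in\mathbb C^\times$ with $|q|<1$; $q_i=q^{r_i}$, $[n]_q=\frac{q^n-q^{-n}}{q-q^{-1}}$. Quantum affine algebra. $U_q\widehat{\mathfrak g}$ is the associative $\mathbb C$-algebra with generators $x^\pm_{i,n}$ ($i\in I,n\in\mathbb Z$), $k_i^{\pm1}$ ($i\in I$), $h_{i,n}$ ($i\in I$, $n\in\mathbb Z\setminus\{0\}$) and central elements $c^{\pm1/2}$, with relations $k_ik_j=k_jk_i$, $k_ih_{j,n}=h_{j,n}k_i$, $k_ix^\pm_{j,n}k_i^{-1}=q^{\pm B_{ij}}x^\pm_{j,n}$, $[h_{i,n},x^\pm_{j,m}]=\pm\frac1n[nB_{ij}]_q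 c^{\mp|n|/2}x^\pm_{j,n+m}$, $x^\pm_{i,n+1}x^\pm_{j,m}-q^{\pm B_{ij}}x^\pm_{j,m}x^\pm_{i,n+1}=q^{\pm B_{ij}}x^\pm_{i,n}x^\pm_{j,m+1}-x^\pm_{j,m+1}x^\pm_{i,n}$, $[h_{i,n},h_{j,m}]=\delta_{n,-m}\frac1n[nB_{ij}]_q\frac{c^n-c^{-n}}{q-q^{-1}}$, $[x^+_{i,n},x^-_{j,m}]=\delta_{ij}\frac{c^{(n-m)/2}\phi^+_{i,n+m}-c^{-(n-m)/2}\phi^-_{i,n+m}}{q_i-q_i^{-1}}$, and, for $i\ne j$ and $s=1-C_{ij}$, the $q$-Serre relations $\sum_{\pi\in\Sigma_s}\sum_{k=0}^s(-1)^k\binom{s}{k}_{q_i}x^\pm_{i,n_{\pi(1)}}\cdots x^\pm_{i,n_{\pi(k)}}x^\pm_{j,m}x^\pm_{i,n_{\pi(k+1)}}\cdots x^\pm_{i,n_{\pi(s)}}=0$. Here $\Phi^\pm_i(u)=\sum_{n\ge0}\phi^\pm_{i,\pm n}u^{\pm n}=k_i^{\pm1}\exp\big(\pm(q-q^{-1})\sum_{m\ge1}h_{i,\pm m}u^{\pm m}\big)$, and $\phi^{\pm}_{i,n}=0$ for $\mp n>0$. Representations. All representations are finite-dimensional and of type 1: $c^{1/2}$ acts as the identity and $V$ is the direct sum of the weight spaces $V_\lambda=\{v: k_iv=q^{(\lambda,\alpha_i)}v\ \forall i\in I\}$ over weights $\lambda$ of $\mathfrak g$. Irreducible ones are classified by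 $I$-tuples of polynomials $P_i(u)$ with constant term 1: the one attached to $(P_i)$ is generated by a nonzero vector $v$ with $x^+_{i,n}v=0$ for all $i,n$ and $\Phi_i^\pm(u)v=q_i^{\deg P_i}\frac{P_i(uq_i^{-1})}{P_i(uq_i)}v$ (expanded in $\mathbb C[[u^{\pm1}]]$). $q$-characters. Let $\mathcal Y=\mathbb Z[Y_{i,a}^{\pm1}]_{i\in I,a\in\mathbb C^\times}$; $Y_{i,a}^{\pm1}$ has weight $\pm\omega_i$. On a finite-dimensional $V$ the $\phi^\pm_{i,n}$ commute, and their common generalized eigenvalues have generating series $\Gamma_i^\pm(u)=q_i^{\deg Q_i-\deg R_i}\frac{Q_i(uq_i^{-1})R_i(uq_i)}{Q_i(uq_i)R_i(uq_i^{-1})}$ with $Q_i(u)=\prod_r(1-ua_{ir})$, $R_i(u)=\prod_s(1-ub_{is})$. The $q$-character is $\chi_q(V)=\sum \dim(\text{generalized eigenspace})\cdot\prod_{i\in I}\big(\prod_rY_{i,a_{ir}}\prod_sY_{i,b_{is}}^{-1}\big)\in\mathcal Y$, the sum being over common generalized eigenspaces. If $V$ is irreducible with polynomials $P_i(u)=\prod_{k}(1-ua_k^{(i)})$, its highest weight monomial is $m_+=\prod_{i\in I}\prod_kY_{i,a_k^{(i)}}$. Finally $A_{i,a}=Y_{i,aq_i}Y_{i,aq_i^{-1}}\prod_{C_{ji}=-1}Y_{j,a}^{-1}\prod_{C_{ji}=-2}Y_{j,aq}^{-1}Y_{j,aq^{-1}}^{-1}\prod_{C_{ji}=-3}Y_{j,aq^2}^{-1}Y_{j,a}^{-1}Y_{j,aq^{-2}}^{-1}.$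 *)

theory Defs
  imports
    "HOL-Analysis.Analysis"
    "HOL-Library.Poly_Mapping"
    "HOL-Library.Multiset"
    "HOL-Computational_Algebra.Computational_Algebra"
    "HOL-Combinatorics.Permutations"
begin

section \<open>Root data of a simple Lie algebra\<close>

text \<open>
  The simple Lie algebra enters only through its root data: a reduced irreducible root system
  \<open>\<Phi>\<close> spanning a Euclidean space (the real span of the roots, with the
  invariant inner product as inner product), with simple roots \<open>\<alpha> i\<close> indexed by a
  finite type \<open>'i\<close>; the rank is the cardinality of \<open>'i\<close>.
\<close>

definition root_system :: "'e::euclidean_space set \<Rightarrow> bool" where
  "root_system \<Phi> \<longleftrightarrow>
     finite \<Phi> \<and> 0 \<notin> \<Phi> \<and> span \<Phi> = UNIV \<and>
     (\<forall>a\<in>\<Phi>. \<forall>b\<in>\<Phi>. b - (2 * (a \<bullet> b) / (a \<bullet> a)) *\<^sub>R a \<in> \<Phi>) \<and>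
     (\<forall>a\<in>\<Phi>. \<forall>b\<in>\<Phi>. 2 * (a \<bullet> b) / (a \<bullet> a) \<in> \<int>)"

definition reduced_root_system :: "'e::euclidean_space set \<Rightarrow> bool" where
  "reduced_root_system \<Phi> \<longleftrightarrow>
     root_system \<Phi> \<and> (\<forall>a\<in>\<Phi>. \<forall>c. c *\<^sub>R a \<in> \<Phi> \<longrightarrow> c = 1 \<or> c = -1)"

definition irreducible_root_system :: "'e::euclidean_space set \<Rightarrow> bool" where
  "irreducible_root_system \<Phi> \<longleftrightarrow>
     \<Phi> \<noteq> {} \<and>
     (\<nexists>\<Phi>1 \<Phi>2. \<Phi>1 \<noteq> {} \<and> \<Phi>2 \<noteq> {} \<and> \<Phi> = \<Phi>1 \<union> \<Phi>2 \<and> (\<forall>a\<in>\<Phi>1. \<forall>b\<in>\<Phi>2. a \<bullet> b = 0))"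

definition nonneg_comb :: "('i::finite \<Rightarrow> 'e::euclidean_space) \<Rightarrow> 'e \<Rightarrow> bool" where
  "nonneg_comb \<alpha> b \<longleftrightarrow> (\<exists>n :: 'i \<Rightarrow> nat. b = (\<Sum>i\<in>UNIV. real (n i) *\<^sub>R \<alpha> i))"

definition simple_roots :: "'e::euclidean_space set \<Rightarrow> ('i::finite \<Rightarrow> 'e) \<Rightarrow> bool" where
  "simple_roots \<Phi> \<alpha> \<longleftrightarrow>
     inj \<alpha> \<and> range \<alpha> \<subseteq> \<Phi> \<and> independent (range \<alpha>) \<and>
     (\<forall>b\<in>\<Phi>. nonneg_comb \<alpha> b \<or> nonneg_comb \<alpha> (- b))"

definition maximal_root :: "'e::euclidean_space set \<Rightarrow> ('i::finite \<Rightarrow> 'e) \<Rightarrow> 'e \<Rightarrow> bool" where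
  "maximal_root \<Phi> \<alpha> \<theta> \<longleftrightarrow> \<theta> \<in> \<Phi> \<and> (\<forall>b\<in>\<Phi>. nonneg_comb \<alpha> (\<theta> - b))"

text \<open>The floor only serves to turn integral real numbers into elements of \<^typ>\<open>int\<close>.
  With the normalization below, \<open>sym_cartan\<close> and \<open>half_norm\<close> are integral as well.\<close>

definition cartan :: "('i \<Rightarrow> 'e::euclidean_space) \<Rightarrow> 'i \<Rightarrow> 'i \<Rightarrow> int" where
  "cartan \<alpha> i j = \<lfloor>2 * (\<alpha> i \<bullet> \<alpha> j) / (\<alpha> i \<bullet> \<alpha> i)\<rfloor>"

definition sym_cartan :: "('i \<Rightarrow> 'e::euclidean_space) \<Rightarrow> 'i \<Rightarrow> 'i \<Rightarrow> int" where
  "sym_cartan \<alpha> i j = \<lfloor>\<alpha> i \<bullet> \<alpha> j\<rfloor>"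

definition half_norm :: "('i \<Rightarrow> 'e::euclidean_space) \<Rightarrow> 'i \<Rightarrow> int" where
  "half_norm \<alpha> i = \<lfloor>(\<alpha> i \<bullet> \<alpha> i) / 2\<rfloor>"

definition dynkin_edges :: "('i \<Rightarrow> 'e::euclidean_space) \<Rightarrow> 'i \<Rightarrow> 'i \<Rightarrow> int" where
  "dynkin_edges \<alpha> i j = cartan \<alpha> i j * cartan \<alpha> j i"

text \<open>The 1 is inserted for rank one, where the Dynkin diagram has no edge and
  \<open>r\<^sup>\<or>\<close> is 1 by convention; in higher rank the diagram is connected and it has no effect.\<close>

definition r_check :: "('i::finite \<Rightarrow> 'e::euclidean_space) \<Rightarrow> int" where
  "r_check \<alpha> = Max (insert 1 {dynkin_edges \<alpha> i j | i j. i \<noteq> j})"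

definition simple_root_data :: "'e::euclidean_space set \<Rightarrow> ('i::finite \<Rightarrow> 'e) \<Rightarrow> bool" where
  "simple_root_data \<Phi> \<alpha> \<longleftrightarrow>
     reduced_root_system \<Phi> \<and> irreducible_root_system \<Phi> \<and> simple_roots \<Phi> \<alpha> \<and>
     (\<exists>\<theta>. maximal_root \<Phi> \<alpha> \<theta> \<and> \<theta> \<bullet> \<theta> = 2 * real_of_int (r_check \<alpha>))"

definition weight_lattice :: "('i \<Rightarrow> 'e::euclidean_space) \<Rightarrow> 'e set" where
  "weight_lattice \<alpha> = {\<mu>. \<forall>i. 2 * (\<mu> \<bullet> \<alpha> i) / (\<alpha> i \<bullet> \<alpha> i) \<in> \<int>}"


section \<open>\<open>q\<close>-numbers\<close>

definition qnum :: "complex \<Rightarrow> int \<Rightarrow> complex" where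
  "qnum x n = (x powi n - x powi (- n)) / (x - inverse x)"

definition qfact :: "complex \<Rightarrow> nat \<Rightarrow> complex" where
  "qfact x n = (\<Prod>k=1..n. qnum x (int k))"

definition qbinom :: "complex \<Rightarrow> nat \<Rightarrow> nat \<Rightarrow> complex" where
  "qbinom x n k = qfact x n / (qfact x k * qfact x (n - k))"


section \<open>Free associative algebras\<close>

text \<open>The type \<open>'g free_word \<Rightarrow>\<^sub>0 complex\<close> of finitely supported functions with its
  convolution product is the free associative unital algebra on \<open>'g\<close>.\<close>

datatype 'g free_word = Word (letters: "'g list")

instantiation free_word :: (type) monoid_add
begin
definition zero_free_word :: "'g free_word" where "zero_free_word = Word []"
definition plus_free_word :: "'g free_word \<Rightarrow> 'g free_word \<Rightarrow> 'g free_word" where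
  "plus_free_word u v = Word (letters u @ letters v)"
instance by standard (simp_all add: zero_free_word_def plus_free_word_def)
end

type_synonym 'g free_alg = "'g free_word \<Rightarrow>\<^sub>0 complex"

definition gen :: "'g \<Rightarrow> 'g free_alg" where
  "gen g = Poly_Mapping.single (Word [g]) 1"

definition scal :: "complex \<Rightarrow> 'g free_alg" where
  "scal z = Poly_Mapping.single 0 z"


section \<open>The quantum affine algebra\<close>

datatype pm = pPlus | pMinus

fun sgn_pm :: "pm \<Rightarrow> int" where
  "sgn_pm pPlus = 1"
| "sgn_pm pMinus = -1"

text \<open>\<open>C_half pPlus\<close> and \<open>C_half pMinus\<close> are \<open>c\<close> to the power 1/2 and -1/2. The generator
  \<open>HG i 0\<close>, which is not present in the algebra, is set to 0 by the relations.\<close>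

datatype 'i uq_gen = XG pm 'i int | KG pm 'i | HG 'i int | C_half pm

type_synonym 'i uq_free = "'i uq_gen free_alg"

text \<open>\<open>c_half_pow n\<close> is \<open>c\<close> to the power \<open>n/2\<close>.\<close>

definition c_half_pow :: "int \<Rightarrow> 'i uq_free" where
  "c_half_pow n = (if n \<ge> 0 then gen (C_half pPlus) ^ nat n else gen (C_half pMinus) ^ nat (- n))"

text \<open>Exponential of a formal power series without constant term, over a noncommutative
  coefficient algebra; the terms with \<open>k > n\<close> do not contribute to the \<open>n\<close>-th coefficient.\<close>

definition free_fps_exp :: "'g free_alg fps \<Rightarrow> 'g free_alg fps" where
  "free_fps_exp f = Abs_fps (\<lambda>n. \<Sum>k\<le>n. scal (1 / fact k) * fps_nth (f ^ k) n)"

text \<open>For \<open>s = pMinus\<close> this is a power series in the inverse of \<open>u\<close>.\<close>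

definition phi_series :: "complex \<Rightarrow> pm \<Rightarrow> 'i \<Rightarrow> 'i uq_free fps" where
  "phi_series q s i = fps_const (gen (KG s i)) *
     free_fps_exp (Abs_fps (\<lambda>m. if m = 0 then 0
        else scal (of_int (sgn_pm s) * (q - inverse q)) * gen (HG i (sgn_pm s * int m))))"

definition phi :: "complex \<Rightarrow> pm \<Rightarrow> 'i \<Rightarrow> int \<Rightarrow> 'i uq_free" where
  "phi q s i n = (if sgn_pm s * n < 0 then 0 else fps_nth (phi_series q s i) (nat \<bar>n\<bar>))"

definition q_i :: "('i \<Rightarrow> 'e::euclidean_space) \<Rightarrow> complex \<Rightarrow> 'i \<Rightarrow> complex" where
  "q_i \<alpha> q i = q powi half_norm \<alpha> i"

definition serre_sum ::
  "('i \<Rightarrow> 'e::euclidean_space) \<Rightarrow> complex \<Rightarrow> pm \<Rightarrow> 'i \<Rightarrow> 'i \<Rightarrow> nat \<Rightarrow> (nat \<Rightarrow> int) \<Rightarrow> int \<Rightarrow> 'i uq_free" where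
  "serre_sum \<alpha> q \<epsilon> i j s n m =
     (\<Sum>\<pi> | \<pi> permutes {1..s}. \<Sum>k=0..s.
        scal ((-1) ^ k * qbinom (q_i \<alpha> q i) s k) *
        prod_list (map (\<lambda>l. gen (XG \<epsilon> i (n (\<pi> l)))) [1..<k+1]) *
        gen (XG \<epsilon> j m) *
        prod_list (map (\<lambda>l. gen (XG \<epsilon> i (n (\<pi> l)))) [k+1..<s+1]))"

text \<open>\<open>uq_rel \<alpha> q a b\<close> means that \<open>a = b\<close> is one of the defining relations.\<close>

inductive uq_rel ::
  "('i \<Rightarrow> 'e::euclidean_space) \<Rightarrow> complex \<Rightarrow> 'i uq_free \<Rightarrow> 'i uq_free \<Rightarrow> bool"
  for \<alpha> q where
  c_inv1: "uq_rel \<alpha> q (gen (C_half pPlus) * gen (C_half pMinus)) 1"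
| c_inv2: "uq_rel \<alpha> q (gen (C_half pMinus) * gen (C_half pPlus)) 1"
| c_central: "uq_rel \<alpha> q (gen (C_half s) * gen g) (gen g * gen (C_half s))"
| k_inv1: "uq_rel \<alpha> q (gen (KG pPlus i) * gen (KG pMinus i)) 1"
| k_inv2: "uq_rel \<alpha> q (gen (KG pMinus i) * gen (KG pPlus i)) 1"
| h_zero: "uq_rel \<alpha> q (gen (HG i 0)) 0"
| k_k: "uq_rel \<alpha> q (gen (KG pPlus i) * gen (KG pPlus j)) (gen (KG pPlus j) * gen (KG pPlus i))"
| k_h: "n \<noteq> 0 \<Longrightarrow>
    uq_rel \<alpha> q (gen (KG pPlus i) * gen (HG j n)) (gen (HG j n) * gen (KG pPlus i))"
| k_x: "uq_rel \<alpha> q (gen (KG pPlus i) * gen (XG s j n) * gen (KG pMinus i))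
    (scal (q powi (sgn_pm s * sym_cartan \<alpha> i j)) * gen (XG s j n))"
| h_x: "n \<noteq> 0 \<Longrightarrow>
    uq_rel \<alpha> q (gen (HG i n) * gen (XG s j m) - gen (XG s j m) * gen (HG i n))
      (scal (of_int (sgn_pm s) * (1 / of_int n) * qnum q (n * sym_cartan \<alpha> i j)) *
       c_half_pow (- sgn_pm s * \<bar>n\<bar>) * gen (XG s j (n + m)))"
| x_x: "uq_rel \<alpha> q
    (gen (XG s i (n + 1)) * gen (XG s j m)
       - scal (q powi (sgn_pm s * sym_cartan \<alpha> i j)) * gen (XG s j m) * gen (XG s i (n + 1)))
    (scal (q powi (sgn_pm s * sym_cartan \<alpha> i j)) * gen (XG s i n) * gen (XG s j (m + 1))
       - gen (XG s j (m + 1)) * gen (XG s i n))"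
| h_h: "n \<noteq> 0 \<Longrightarrow> m \<noteq> 0 \<Longrightarrow>
    uq_rel \<alpha> q (gen (HG i n) * gen (HG j m) - gen (HG j m) * gen (HG i n))
      (if n = - m
       then scal ((1 / of_int n) * qnum q (n * sym_cartan \<alpha> i j) / (q - inverse q)) *
            (c_half_pow (2 * n) - c_half_pow (- 2 * n))
       else 0)"
| xp_xm: "uq_rel \<alpha> q (gen (XG pPlus i n) * gen (XG pMinus j m) - gen (XG pMinus j m) * gen (XG pPlus i n))
      (if i = j
       then scal (1 / (q_i \<alpha> q i - inverse (q_i \<alpha> q i))) *
            (c_half_pow (n - m) * phi q pPlus i (n + m)
               - c_half_pow (- (n - m)) * phi q pMinus i (n + m))
       else 0)"
| serre: "i \<noteq> j \<Longrightarrow> uq_rel \<alpha> q (serre_sum \<alpha> q s i j (nat (1 - cartan \<alpha> i j)) ns m) 0"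


section \<open>Representations\<close>

text \<open>A module over the algebra with the above presentation is a module over the free algebra on
  which the relations hold; \<open>scl\<close> is the complex vector space structure on the type \<open>'v\<close>.\<close>

definition uq_module ::
  "('i \<Rightarrow> 'e::euclidean_space) \<Rightarrow> complex \<Rightarrow> (complex \<Rightarrow> 'v::ab_group_add \<Rightarrow> 'v) \<Rightarrow>
   ('i uq_free \<Rightarrow> 'v \<Rightarrow> 'v) \<Rightarrow> bool" where
  "uq_module \<alpha> q scl act \<longleftrightarrow>
     vector_space scl \<and>
     (\<forall>a. Vector_Spaces.linear scl scl (act a)) \<and>
     (\<forall>a b v. act (a + b) v = act a v + act b v) \<and>
     (\<forall>z v. act (scal z) v = scl z v) \<and>
     (\<forall>a b v. act (a * b) v = act a (act b v)) \<and>
     (\<forall>a b. uq_rel \<alpha> q a b \<longrightarrow> act a = act b)"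

definition finite_dim :: "(complex \<Rightarrow> 'v::ab_group_add \<Rightarrow> 'v) \<Rightarrow> bool" where
  "finite_dim scl \<longleftrightarrow> (\<exists>B. finite_dimensional_vector_space scl B)"

definition irreducible_module ::
  "(complex \<Rightarrow> 'v::ab_group_add \<Rightarrow> 'v) \<Rightarrow> ('i uq_free \<Rightarrow> 'v \<Rightarrow> 'v) \<Rightarrow> bool" where
  "irreducible_module scl act \<longleftrightarrow>
     (UNIV :: 'v set) \<noteq> {0} \<and>
     (\<forall>W. module.subspace scl W \<and> (\<forall>a. \<forall>w\<in>W. act a w \<in> W) \<longrightarrow> W = {0} \<or> W = UNIV)"

definition is_direct_sum :: "'l set \<Rightarrow> ('l \<Rightarrow> 'v::ab_group_add set) \<Rightarrow> bool" where
  "is_direct_sum L W \<longleftrightarrow>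
     (\<forall>v. \<exists>!f. (\<forall>l. l \<notin> L \<longrightarrow> f l = 0) \<and> (\<forall>l\<in>L. f l \<in> W l) \<and>
        finite {l. f l \<noteq> 0} \<and> v = (\<Sum>l | f l \<noteq> 0. f l))"

definition weight_space ::
  "('i \<Rightarrow> 'e::euclidean_space) \<Rightarrow> complex \<Rightarrow> (complex \<Rightarrow> 'v::ab_group_add \<Rightarrow> 'v) \<Rightarrow>
   ('i uq_free \<Rightarrow> 'v \<Rightarrow> 'v) \<Rightarrow> 'e \<Rightarrow> 'v set" where
  "weight_space \<alpha> q scl act \<mu> =
     {v. \<forall>i. act (gen (KG pPlus i)) v = scl (q powi \<lfloor>\<mu> \<bullet> \<alpha> i\<rfloor>) v}"

definition type_1 ::
  "('i \<Rightarrow> 'e::euclidean_space) \<Rightarrow> complex \<Rightarrow> (complex \<Rightarrow> 'v::ab_group_add \<Rightarrow> 'v) \<Rightarrow>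
   ('i uq_free \<Rightarrow> 'v \<Rightarrow> 'v) \<Rightarrow> bool" where
  "type_1 \<alpha> q scl act \<longleftrightarrow>
     (\<forall>v. act (gen (C_half pPlus)) v = v) \<and>
     is_direct_sum (weight_lattice \<alpha>) (weight_space \<alpha> q scl act)"


section \<open>Monomials, highest weights and \<open>q\<close>-characters\<close>

text \<open>Monomials are written additively, as elements of the free abelian group on the \<open>Y_var i a\<close>;
  \<open>\<Y>\<close> is the group ring. The type also has variables \<open>Y_var i 0\<close>, which never
  occur in the notions below.\<close>

type_synonym 'i y_monomial = "('i \<times> complex) \<Rightarrow>\<^sub>0 int"
type_synonym 'i y_ring = "'i y_monomial \<Rightarrow>\<^sub>0 int"

definition Y_var :: "'i \<Rightarrow> complex \<Rightarrow> 'i y_monomial" where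
  "Y_var i a = Poly_Mapping.single (i, a) 1"

definition y_elem :: "'i y_monomial \<Rightarrow> 'i y_ring" where
  "y_elem m = Poly_Mapping.single m 1"

definition A_mon ::
  "('i::finite \<Rightarrow> 'e::euclidean_space) \<Rightarrow> complex \<Rightarrow> 'i \<Rightarrow> complex \<Rightarrow> 'i y_monomial" where
  "A_mon \<alpha> q i a =
     Y_var i (a * q_i \<alpha> q i) + Y_var i (a * inverse (q_i \<alpha> q i))
     - (\<Sum>j | cartan \<alpha> j i = -1. Y_var j a)
     - (\<Sum>j | cartan \<alpha> j i = -2. Y_var j (a * q) + Y_var j (a * inverse q))
     - (\<Sum>j | cartan \<alpha> j i = -3. Y_var j (a * q^2) + Y_var j a + Y_var j (a * inverse (q^2)))"

text \<open>Nonempty products of the inverses of the \<open>A_mon \<alpha> q i c\<close> with \<open>c \<noteq> 0\<close>.\<close>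

definition A_inverse_monomial ::
  "('i::finite \<Rightarrow> 'e::euclidean_space) \<Rightarrow> complex \<Rightarrow> 'i y_monomial \<Rightarrow> bool" where
  "A_inverse_monomial \<alpha> q p \<longleftrightarrow>
     (\<exists>S :: ('i \<times> complex) multiset. S \<noteq> {#} \<and> (\<forall>(i, c) \<in># S. c \<noteq> 0) \<and>
        p = (\<Sum>(i, c) \<in># S. - A_mon \<alpha> q i c))"

text \<open>Expansion of \<open>N(u) / D(u)\<close> at \<open>u = 0\<close>, respectively in \<open>w = 1/u\<close> at
  infinity; the latter formula is valid for \<open>N\<close>, \<open>D\<close> of the same degree.\<close>

fun expand :: "pm \<Rightarrow> complex poly \<Rightarrow> complex poly \<Rightarrow> complex fps" where
  "expand pPlus N D = fps_of_poly N / fps_of_poly D"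
| "expand pMinus N D = fps_of_poly (reflect_poly N) / fps_of_poly (reflect_poly D)"

definition rescale :: "complex poly \<Rightarrow> complex \<Rightarrow> complex poly" where
  "rescale P z = pcompose P [:0, z:]"

definition Gamma_series ::
  "('i \<Rightarrow> 'e::euclidean_space) \<Rightarrow> complex \<Rightarrow> ('i \<Rightarrow> complex poly) \<Rightarrow> ('i \<Rightarrow> complex poly) \<Rightarrow>
   pm \<Rightarrow> 'i \<Rightarrow> complex fps" where
  "Gamma_series \<alpha> q Q R s i =
     fps_const (q_i \<alpha> q i powi (int (degree (Q i)) - int (degree (R i)))) *
     expand s
       (rescale (Q i) (inverse (q_i \<alpha> q i)) * rescale (R i) (q_i \<alpha> q i))
       (rescale (Q i) (q_i \<alpha> q i) * rescale (R i) (inverse (q_i \<alpha> q i)))"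

definition poly_of_roots :: "complex multiset \<Rightarrow> complex poly" where
  "poly_of_roots a = (\<Prod>x\<in>#a. [:1, - x:])"

definition Y_product :: "('i::finite \<Rightarrow> complex multiset) \<Rightarrow> 'i y_monomial" where
  "Y_product a = (\<Sum>i\<in>UNIV. \<Sum>x\<in>#a i. Y_var i x)"

definition has_drinfeld_polynomials ::
  "('i \<Rightarrow> 'e::euclidean_space) \<Rightarrow> complex \<Rightarrow> (complex \<Rightarrow> 'v::ab_group_add \<Rightarrow> 'v) \<Rightarrow>
   ('i uq_free \<Rightarrow> 'v \<Rightarrow> 'v) \<Rightarrow> ('i \<Rightarrow> complex poly) \<Rightarrow> bool" where
  "has_drinfeld_polynomials \<alpha> q scl act P \<longleftrightarrow>
     (\<forall>i. coeff (P i) 0 = 1) \<and>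
     (\<exists>v. v \<noteq> 0 \<and> range (\<lambda>a. act a v) = UNIV \<and>
        (\<forall>i n. act (gen (XG pPlus i n)) v = 0) \<and>
        (\<forall>s i n. act (phi q s i (sgn_pm s * int n)) v =
                   scl (fps_nth (Gamma_series \<alpha> q P (\<lambda>_. 1) s i) n) v))"

definition is_highest_monomial ::
  "('i::finite \<Rightarrow> 'e::euclidean_space) \<Rightarrow> complex \<Rightarrow> (complex \<Rightarrow> 'v::ab_group_add \<Rightarrow> 'v) \<Rightarrow>
   ('i uq_free \<Rightarrow> 'v \<Rightarrow> 'v) \<Rightarrow> 'i y_monomial \<Rightarrow> bool" where
  "is_highest_monomial \<alpha> q scl act m \<longleftrightarrow>
     (\<exists>a. (\<forall>i. 0 \<notin># a i) \<and>
        has_drinfeld_polynomials \<alpha> q scl act (\<lambda>i. poly_of_roots (a i)) \<and>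
        m = Y_product a)"

text \<open>An \<open>\<ell>\<close>-weight \<open>\<gamma>\<close> collects the eigenvalues of all
  \<open>phi q s i (\<plusminus>n)\<close>, \<open>n \<ge> 0\<close>, as the coefficients of \<open>\<gamma> s i\<close>.\<close>

definition gen_eigenspace ::
  "complex \<Rightarrow> (complex \<Rightarrow> 'v::ab_group_add \<Rightarrow> 'v) \<Rightarrow> ('i uq_free \<Rightarrow> 'v \<Rightarrow> 'v) \<Rightarrow>
   (pm \<Rightarrow> 'i \<Rightarrow> complex fps) \<Rightarrow> 'v set" where
  "gen_eigenspace q scl act \<gamma> =
     {v. \<forall>s i n. \<exists>N.
        ((\<lambda>w. act (phi q s i (sgn_pm s * int n)) w - scl (fps_nth (\<gamma> s i) n) w) ^^ N) v = 0}"

definition l_weights ::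
  "complex \<Rightarrow> (complex \<Rightarrow> 'v::ab_group_add \<Rightarrow> 'v) \<Rightarrow> ('i uq_free \<Rightarrow> 'v \<Rightarrow> 'v) \<Rightarrow>
   (pm \<Rightarrow> 'i \<Rightarrow> complex fps) set" where
  "l_weights q scl act = {\<gamma>. gen_eigenspace q scl act \<gamma> \<noteq> {0}}"

definition l_weight_monomial ::
  "('i::finite \<Rightarrow> 'e::euclidean_space) \<Rightarrow> complex \<Rightarrow> (pm \<Rightarrow> 'i \<Rightarrow> complex fps) \<Rightarrow> 'i y_monomial \<Rightarrow> bool" where
  "l_weight_monomial \<alpha> q \<gamma> m \<longleftrightarrow>
     (\<exists>a b. (\<forall>i. 0 \<notin># a i \<and> 0 \<notin># b i) \<and>
        \<gamma> = Gamma_series \<alpha> q (\<lambda>i. poly_of_roots (a i)) (\<lambda>i. poly_of_roots (b i)) \<and>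
        m = Y_product a - Y_product b)"

definition q_character ::
  "('i::finite \<Rightarrow> 'e::euclidean_space) \<Rightarrow> complex \<Rightarrow> (complex \<Rightarrow> 'v::ab_group_add \<Rightarrow> 'v) \<Rightarrow>
   ('i uq_free \<Rightarrow> 'v \<Rightarrow> 'v) \<Rightarrow> 'i y_ring" where
  "q_character \<alpha> q scl act =
     (\<Sum>\<gamma>\<in>l_weights q scl act.
        of_nat (vector_space.dim scl (gen_eigenspace q scl act \<gamma>)) *
        y_elem (THE m. l_weight_monomial \<alpha> q \<gamma> m))"

end

theory Submission
  imports Defs "HOL-Library.Function_Algebras"
begin

text \<open>
  Let \<open>v\<close> be a highest weight vector. The l-weights of the module are compared with the l-weight of
  \<open>v\<close> by matrix coefficients of words in the raising operators.

  Since the central element acts trivially, the generators \<open>h\<close> and \<open>k\<close> commute. Hence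
  every generalized eigenspace of the series \<open>phi\<close> contains a joint eigenvector \<open>w\<close> of all
  \<open>h\<close> and \<open>k\<close>, and \<open>phi\<close> acts on it by \<open>\<kappa> exp(\<eta>)\<close> (\<open>phi_eigenvalue\<close>).
  By the triangular decomposition the module is the sum of the line through \<open>v\<close> and of the lower
  weight spaces; let \<open>\<xi>\<close> be the coordinate along \<open>v\<close>. It is a left eigenvector of the
  \<open>h\<close> and \<open>k\<close>, with the eigenvalues of \<open>v\<close>. By irreducibility some word in the
  raising operators satisfies \<open>\<xi>(x\<^sup>+ \<dots> x\<^sup>+ w) \<noteq> 0\<close>
  (\<open>exists_word_to_highest\<close>).

  Let the modes \<open>n\<^sub>1, \<dots>, n\<^sub>k\<close> of the letters of this word vary. The result is a nonzero function
  \<open>f\<close> on a lattice. Inserting \<open>h\<^bsub>j,e\<^esub>\<close> between \<open>\<xi>\<close> and the word and moving it to the right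
  shows that the difference of the \<open>h\<^bsub>j,e\<^esub>\<close>-eigenvalues of \<open>v\<close> and \<open>w\<close> times \<open>f\<close> is
  \<open>\<Sum>\<^sub>t (1/e) [e B\<^bsub>j,i(t)\<^esub>] T\<^sub>t\<^sup>e f\<close>, where \<open>T\<^sub>t\<close> shifts the \<open>t\<close>-th argument by one. Because the endomorphism
  ring is finite-dimensional, \<open>f\<close> is killed by a polynomial in each \<open>T\<^sub>t\<close>, so \<open>f\<close> may be
  replaced by a joint eigenfunction of the shifts, with nonzero eigenvalues
  \<open>a\<^sub>t\<close> (\<open>shift_relation_eigenvalues\<close>). Thus the eigenvalues differ by
  \<open>\<Sum>\<^sub>t (1/e) [e B\<^bsub>j,i(t)\<^esub>] a\<^sub>t\<^sup>e\<close> (\<open>cartan_eigenvalues\<close>), which is precisely the contribution of the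
  monomials \<open>A\<^bsub>i(t),a\<^sub>t\<^esub>\<close> to the logarithm of \<open>phi\<close> (\<open>power_sum_A_mon\<close>). This last point uses the
  normalization of the inner product: the factors of \<open>A\<close> with Cartan integers -2 and -3 are
  the right ones because the shorter root then has square length 2.

  It remains to see that the leading term is \<open>m\<^sub>+\<close> with coefficient 1. The generalized
  eigenspace of the l-weight of \<open>v\<close> meets the span of the lower weight spaces trivially, so it is
  the line through \<open>v\<close> (\<open>dim_gen_eigenspace_highest\<close>); and a monomial is determined by its
  l-weight (\<open>monomial_series_determines_monomial\<close>).
\<close>

section \<open>Root lengths\<close>

definition root_reflection :: "'e::euclidean_space \<Rightarrow> 'e \<Rightarrow> 'e" where
  "root_reflection a b = b - (2 * (a \<bullet> b) / (a \<bullet> a)) *\<^sub>R a"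

lemma root_reflection_norm:
  "root_reflection a b \<bullet> root_reflection a b = b \<bullet> b"
proof (cases "a = 0")
  case False
  then have "a \<bullet> a \<noteq> 0" by simp
  then show ?thesis
    by (simp add: root_reflection_def inner_diff_left inner_diff_right inner_commute field_simps)
qed (simp add: root_reflection_def)

lemma root_reflection_self: "a \<noteq> 0 \<Longrightarrow> root_reflection a a = - a"
  by (simp add: root_reflection_def scaleR_2)

lemma root_reflection_involution: "root_reflection a (root_reflection a b) = b"
proof (cases "a = 0")
  case False
  then have "a \<bullet> a \<noteq> 0" by simp
  then have "2 * (a \<bullet> root_reflection a b) / (a \<bullet> a) = - (2 * (a \<bullet> b) / (a \<bullet> a))"
    by (simp add: root_reflection_def inner_diff_right field_simps)
  then show ?thesis
    by (simp only: root_reflection_def[of a "root_reflection a b"]) (simp add: root_reflection_def)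
qed (simp add: root_reflection_def)

locale root_data =
  fixes \<Phi> :: "'e::euclidean_space set" and \<alpha> :: "'i::finite \<Rightarrow> 'e"
  assumes rd: "simple_root_data \<Phi> \<alpha>"
begin

lemma finite_roots: "finite \<Phi>" and zero_not_root: "0 \<notin> \<Phi>"
  and reflect_root: "a \<in> \<Phi> \<Longrightarrow> b \<in> \<Phi> \<Longrightarrow> root_reflection a b \<in> \<Phi>"
  and root_integral: "a \<in> \<Phi> \<Longrightarrow> b \<in> \<Phi> \<Longrightarrow> 2 * (a \<bullet> b) / (a \<bullet> a) \<in> \<int>"
  and root_multiple: "a \<in> \<Phi> \<Longrightarrow> c *\<^sub>R a \<in> \<Phi> \<Longrightarrow> c = 1 \<or> c = -1"
  and roots_irreducible: "irreducible_root_system \<Phi>"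
  and inj_simple: "inj \<alpha>" and simple_root: "\<alpha> i \<in> \<Phi>"
  and independent_simple: "independent (range \<alpha>)"
  and root_signed: "b \<in> \<Phi> \<Longrightarrow> nonneg_comb \<alpha> b \<or> nonneg_comb \<alpha> (- b)"
  using rd unfolding simple_root_data_def reduced_root_system_def root_system_def simple_roots_def
    root_reflection_def by blast+

lemma root_pos: "a \<in> \<Phi> \<Longrightarrow> a \<bullet> a > 0"
  using zero_not_root by auto

lemma neg_root: "a \<in> \<Phi> \<Longrightarrow> - a \<in> \<Phi>"
  using reflect_root[of a a] root_reflection_self[of a] zero_not_root by force

lemma simple_dual:
  fixes f :: "'i \<Rightarrow> real"
  shows "\<exists>g :: 'e \<Rightarrow> real. linear g \<and> (\<forall>i. g (\<alpha> i) = f i)"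
proof -
  obtain g :: "'e \<Rightarrow> real" where "linear g" "\<forall>x\<in>range \<alpha>. g x = f (inv \<alpha> x)"
    using linear_independent_extend[OF independent_simple, of "\<lambda>x. f (inv \<alpha> x)"] by (elim exE conjE) (rule that)
  then show ?thesis using inj_simple by (intro exI[of _ g]) simp
qed

lemma linear_on_simple_sum:
  "linear (g :: 'e \<Rightarrow> real) \<Longrightarrow> g (\<Sum>i\<in>UNIV. c i *\<^sub>R \<alpha> i) = (\<Sum>i\<in>UNIV. c i * g (\<alpha> i))"
  by (simp add: linear_sum linear_scale)

lemma simple_coeff_unique:
  assumes "(\<Sum>i\<in>UNIV. c i *\<^sub>R \<alpha> i) = (\<Sum>i\<in>UNIV. d i *\<^sub>R \<alpha> i)"
  shows "c i = d i"
proof -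
  obtain g where g: "linear g" "\<And>j. g (\<alpha> j) = (if j = i then 1 else 0 :: real)"
    using simple_dual[of "\<lambda>j. if j = i then 1 else 0"] by (elim exE conjE) simp
  have "g (\<Sum>k\<in>UNIV. c k *\<^sub>R \<alpha> k) = c i" for c
  proof -
    have "(\<Sum>k\<in>UNIV. c k * (if k = i then 1 else 0)) = (\<Sum>k\<in>UNIV. if k = i then c k else 0)"
      by (intro sum.cong) auto
    then show ?thesis unfolding linear_on_simple_sum[OF g(1)] g(2) by simp
  qed
  then show ?thesis using assms by metis
qed

lemma simple_root_as_sum: "c *\<^sub>R \<alpha> i = (\<Sum>j\<in>UNIV. (if j = i then c else 0) *\<^sub>R \<alpha> j)"
proof -
  have "(\<Sum>j\<in>UNIV. (if j = i then c else 0) *\<^sub>R \<alpha> j) = (\<Sum>j\<in>UNIV. if j = i then c *\<^sub>R \<alpha> j else 0)"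
    by (rule sum.cong) auto
  then show ?thesis by simp
qed

text \<open>In the reflection of \<open>\<alpha> i\<close> in \<open>\<alpha> j\<close> the coefficient of \<open>\<alpha> i\<close> is 1, so
  the root is positive and its coefficient of \<open>\<alpha> j\<close> is not negative.\<close>

lemma simple_inner_nonpos:
  assumes "i \<noteq> j" shows "\<alpha> i \<bullet> \<alpha> j \<le> 0"
proof -
  define c where "c = 2 * (\<alpha> j \<bullet> \<alpha> i) / (\<alpha> j \<bullet> \<alpha> j)"
  have eq: "root_reflection (\<alpha> j) (\<alpha> i)
      = (\<Sum>k\<in>UNIV. (if k = i then 1 else if k = j then - c else 0) *\<^sub>R \<alpha> k)"
  proof -
    have "root_reflection (\<alpha> j) (\<alpha> i) = 1 *\<^sub>R \<alpha> i + (-c) *\<^sub>R \<alpha> j"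
      by (simp add: root_reflection_def c_def)
    also have "\<dots> = (\<Sum>k\<in>UNIV. ((if k = i then 1 else 0) + (if k = j then -c else 0)) *\<^sub>R \<alpha> k)"
      by (simp only: simple_root_as_sum[of 1 i] simple_root_as_sum[of "- c" j] scaleR_add_left sum.distrib)
    also have "\<dots> = (\<Sum>k\<in>UNIV. (if k = i then 1 else if k = j then - c else 0) *\<^sub>R \<alpha> k)"
      using assms by (intro sum.cong) auto
    finally show ?thesis .
  qed
  have "nonneg_comb \<alpha> (root_reflection (\<alpha> j) (\<alpha> i)) \<or> nonneg_comb \<alpha> (- root_reflection (\<alpha> j) (\<alpha> i))"
    by (intro root_signed reflect_root simple_root)
  then have "c \<le> 0"
  proof
    assume "nonneg_comb \<alpha> (root_reflection (\<alpha> j) (\<alpha> i))"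
    then obtain n where "root_reflection (\<alpha> j) (\<alpha> i) = (\<Sum>k\<in>UNIV. real (n k) *\<^sub>R \<alpha> k)"
      unfolding nonneg_comb_def by blast
    from simple_coeff_unique[OF this[unfolded eq], of j] assms show ?thesis by auto
  next
    assume "nonneg_comb \<alpha> (- root_reflection (\<alpha> j) (\<alpha> i))"
    then obtain n where "- root_reflection (\<alpha> j) (\<alpha> i) = (\<Sum>k\<in>UNIV. real (n k) *\<^sub>R \<alpha> k)"
      unfolding nonneg_comb_def by blast
    then have "root_reflection (\<alpha> j) (\<alpha> i) = (\<Sum>k\<in>UNIV. (- real (n k)) *\<^sub>R \<alpha> k)"
      by (simp add: sum_negf) (metis minus_minus)
    from simple_coeff_unique[OF this[unfolded eq], of i] assms show ?thesis by auto
  qed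
  then show ?thesis
    using root_pos[OF simple_root[of j]] by (simp add: c_def divide_le_0_iff inner_commute zero_le_mult_iff)
qed

text \<open>A root of maximal height among those of the same length is dominant, because its reflection in a simple
  root is not higher.\<close>

lemma dominant_root_of_same_length:
  assumes b: "b \<in> \<Phi>"
  obtains b' where "b' \<in> \<Phi>" "b' \<bullet> b' = b \<bullet> b" "\<And>i. b' \<bullet> \<alpha> i \<ge> 0"
proof -
  obtain ht where ht: "linear ht" "\<And>i. ht (\<alpha> i) = (1::real)" 
    using simple_dual[of "\<lambda>_. 1"] by (elim exE conjE) simp
  define S where "S = {c \<in> \<Phi>. c \<bullet> c = b \<bullet> b}"
  have S: "finite S" "S \<noteq> {}" using finite_roots b by (auto simp: S_def)
  obtain b' where b': "b' \<in> S" "\<And>c. c \<in> S \<Longrightarrow> ht c \<le> ht b'"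
    using Max_in[of "ht ` S"] Max_ge[of "ht ` S"] S by (metis (no_types, lifting) finite_imageI image_iff image_is_empty)
  have "b' \<bullet> \<alpha> i \<ge> 0" for i
  proof -
    have "root_reflection (\<alpha> i) b' \<in> S"
      using b'(1) reflect_root[OF simple_root] by (auto simp: S_def root_reflection_norm)
    from b'(2)[OF this] have "2 * (\<alpha> i \<bullet> b') / (\<alpha> i \<bullet> \<alpha> i) \<ge> 0"
      by (simp add: root_reflection_def linear_diff[OF ht(1)] linear_scale[OF ht(1)] ht(2))
    then show ?thesis
      using root_pos[OF simple_root[of i]] by (simp add: zero_le_divide_iff inner_commute zero_le_mult_iff)
  qed
  then show ?thesis using that b'(1) by (auto simp: S_def)
qed

lemma nonneg_comb_inner_nonneg:
  assumes "nonneg_comb \<alpha> c" "\<And>i. b \<bullet> \<alpha> i \<ge> 0" shows "c \<bullet> b \<ge> 0"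
proof -
  obtain n where "c = (\<Sum>k\<in>UNIV. real (n k) *\<^sub>R \<alpha> k)"
    using assms(1) unfolding nonneg_comb_def by blast
  then show ?thesis using assms(2) by (auto simp: inner_sum_right inner_commute[of _ b] intro!: sum_nonneg)
qed

text \<open>The maximal root \<open>\<theta>\<close> is dominant, and \<open>b\<close> may be replaced by a dominant root of the same
  length. Then \<open>\<theta> - b\<close>, a nonnegative
  combination of simple roots, has nonnegative inner products with \<open>\<theta>\<close> and with \<open>b\<close>.\<close>

lemma maximal_root_longest:
  assumes max: "maximal_root \<Phi> \<alpha> \<theta>" and b: "b \<in> \<Phi>"
  shows "b \<bullet> b \<le> \<theta> \<bullet> \<theta>"
proof -
  have \<theta>: "\<theta> \<in> \<Phi>" "\<And>b. b \<in> \<Phi> \<Longrightarrow> nonneg_comb \<alpha> (\<theta> - b)"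
    using max by (auto simp: maximal_root_def)
  have dom: "\<theta> \<bullet> \<alpha> i \<ge> 0" for i
  proof -
    define c where "c = 2 * (\<alpha> i \<bullet> \<theta>) / (\<alpha> i \<bullet> \<alpha> i)"
    have "nonneg_comb \<alpha> (\<theta> - root_reflection (\<alpha> i) \<theta>)"
      by (intro \<theta> reflect_root simple_root)
    then obtain n where "c *\<^sub>R \<alpha> i = (\<Sum>k\<in>UNIV. real (n k) *\<^sub>R \<alpha> k)"
      unfolding nonneg_comb_def root_reflection_def c_def by auto
    from simple_coeff_unique[OF trans[OF simple_root_as_sum[symmetric] this], of i] have "c \<ge> 0" by auto
    then show ?thesis
      using root_pos[OF simple_root[of i]] by (simp add: c_def zero_le_divide_iff inner_commute zero_le_mult_iff)
  qed
  obtain b' where b': "b' \<in> \<Phi>" "b' \<bullet> b' = b \<bullet> b" "\<And>i. b' \<bullet> \<alpha> i \<ge> 0"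
    using dominant_root_of_same_length[OF b] by metis
  have "(\<theta> - b') \<bullet> \<theta> \<ge> 0" "(\<theta> - b') \<bullet> b' \<ge> 0"
    using nonneg_comb_inner_nonneg[OF \<theta>(2)[OF b'(1)]] dom b'(3) by auto
  then show ?thesis using b'(2) by (simp add: inner_diff_left inner_commute[of b' \<theta>])
qed

text \<open>Every root arises from simple roots by simple reflections and negation: a positive root that is not simple has
  positive inner product with some simple root occurring in it, and the reflection in that simple
  root is a positive root of smaller height.\<close>

lemma roots_induct [consumes 1, case_names simple reflect neg]:
  assumes "b \<in> \<Phi>"
    and simple: "\<And>i. P (\<alpha> i)"
    and reflect: "\<And>b i. b \<in> \<Phi> \<Longrightarrow> P b \<Longrightarrow> P (root_reflection (\<alpha> i) b)"
    and neg: "\<And>b. b \<in> \<Phi> \<Longrightarrow> P b \<Longrightarrow> P (- b)"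
  shows "P b"
proof -
  have pos: "P b" if "b \<in> \<Phi>" "b = (\<Sum>k\<in>UNIV. real (n k) *\<^sub>R \<alpha> k)" for b n
    using that
  proof (induction "\<Sum>k\<in>UNIV. n k" arbitrary: b n rule: less_induct)
    case (less n b)
    have "(\<Sum>k\<in>UNIV. real (n k) * (\<alpha> k \<bullet> b)) = b \<bullet> b"
      by (subst (2) less.prems(2)) (simp add: inner_sum_left)
    with root_pos[OF less.prems(1)] obtain i where i: "real (n i) * (\<alpha> i \<bullet> b) > 0"
      by (metis (mono_tags, lifting) not_le sum_nonpos)
    define c where "c = 2 * (\<alpha> i \<bullet> b) / (\<alpha> i \<bullet> \<alpha> i)"
    have ni: "n i > 0" "\<alpha> i \<bullet> b > 0" using i by (auto simp: zero_less_mult_iff)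
    have "c > 0" using ni root_pos[OF simple_root[of i]] by (simp add: c_def)
    moreover have "c \<in> \<int>" unfolding c_def by (intro root_integral simple_root less.prems)
    ultimately obtain z where z: "c = of_int z" "z > 0" by (auto elim!: Ints_cases)
    define b' where "b' = root_reflection (\<alpha> i) b"
    have b': "b' \<in> \<Phi>" unfolding b'_def by (intro reflect_root simple_root less.prems)
    have b'_sum: "b' = (\<Sum>k\<in>UNIV. (real (n k) - (if k = i then c else 0)) *\<^sub>R \<alpha> k)"
      unfolding b'_def root_reflection_def c_def[symmetric] scaleR_diff_left sum_subtractf
        simple_root_as_sum[symmetric] by (simp add: less.prems(2))
    show ?case
    proof (cases "nonneg_comb \<alpha> b'")
      case True
      then obtain n' where n': "b' = (\<Sum>k\<in>UNIV. real (n' k) *\<^sub>R \<alpha> k)"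
        unfolding nonneg_comb_def by blast
      have nn: "real (n' k) = real (n k) - (if k = i then c else 0)" for k
        using simple_coeff_unique[of "\<lambda>k. real (n' k)"] n' b'_sum by metis
      have "(\<Sum>k\<in>UNIV. n' k) < (\<Sum>k\<in>UNIV. n k)"
      proof (rule sum_strict_mono_ex1)
        show "\<forall>k\<in>UNIV. n' k \<le> n k"
        proof
          fix k show "n' k \<le> n k" using nn[of k] \<open>c > 0\<close> by (auto split: if_splits)
        qed
        show "\<exists>k\<in>UNIV. n' k < n k"
          using nn[of i] \<open>c > 0\<close> by (intro bexI[of _ i]) auto
      qed simp
      from less.hyps[OF this b' n'] have "P (root_reflection (\<alpha> i) b')" by (rule reflect[OF b'])
      then show ?thesis by (simp add: b'_def root_reflection_involution)
    next
      case False
      then have "nonneg_comb \<alpha> (- b')" using root_signed[OF b'] by blast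
      then obtain n' where "- b' = (\<Sum>k\<in>UNIV. real (n' k) *\<^sub>R \<alpha> k)"
        unfolding nonneg_comb_def by blast
      then have n': "b' = (\<Sum>k\<in>UNIV. (- real (n' k)) *\<^sub>R \<alpha> k)"
        by (simp add: sum_negf) (metis minus_minus)
      have nn: "- real (n' k) = real (n k) - (if k = i then c else 0)" for k
        using simple_coeff_unique[of "\<lambda>k. - real (n' k)"] n' b'_sum by metis
      have n0: "real (n k) = (if k = i then real (n i) else 0)" for k
        using nn[of k] by (auto split: if_splits)
      have "b = real (n i) *\<^sub>R \<alpha> i"
        by (subst simple_root_as_sum, subst less.prems(2)) (use n0 in \<open>auto intro!: sum.cong\<close>)
      with root_multiple[OF simple_root, of "real (n i)" i] less.prems(1) have "b = \<alpha> i" by auto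
      then show ?thesis using simple by simp
    qed
  qed
  from root_signed[OF assms(1)] show ?thesis
  proof
    assume "nonneg_comb \<alpha> b" then show ?thesis using pos assms(1) unfolding nonneg_comb_def by blast
  next
    assume "nonneg_comb \<alpha> (- b)"
    then have "P (- b)" using pos neg_root[OF assms(1)] unfolding nonneg_comb_def by blast
    then show ?thesis using neg[OF neg_root[OF assms(1)]] by simp
  qed
qed

lemma simple_root_of_same_length:
  assumes "b \<in> \<Phi>" obtains i where "\<alpha> i \<bullet> \<alpha> i = b \<bullet> b"
proof -
  have "\<exists>i. \<alpha> i \<bullet> \<alpha> i = b \<bullet> b"
    using assms by (induction rule: roots_induct) (auto simp: root_reflection_norm)
  then show ?thesis using that by blast
qed

lemma roots_not_split:
  assumes "\<And>b. b \<in> \<Phi> \<Longrightarrow> b \<in> \<Phi>1 \<or> b \<in> \<Phi>2" "\<And>a b. a \<in> \<Phi>1 \<Longrightarrow> b \<in> \<Phi>2 \<Longrightarrow> a \<bullet> b = 0"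
  shows "\<Phi> \<inter> \<Phi>1 = {} \<or> \<Phi> \<inter> \<Phi>2 = {}"
proof (rule ccontr)
  assume H: "\<not> ?thesis"
  have "\<exists>\<Phi>1 \<Phi>2. \<Phi>1 \<noteq> {} \<and> \<Phi>2 \<noteq> {} \<and> \<Phi> = \<Phi>1 \<union> \<Phi>2 \<and> (\<forall>a\<in>\<Phi>1. \<forall>b\<in>\<Phi>2. a \<bullet> b = 0)"
    using H assms by (intro exI[of _ "\<Phi> \<inter> \<Phi>1"] exI[of _ "\<Phi> \<inter> \<Phi>2"]) auto
  then show False using roots_irreducible unfolding irreducible_root_system_def by simp
qed

lemma orthogonal_spans:
  assumes "\<And>x y. x \<in> S \<Longrightarrow> y \<in> T \<Longrightarrow> x \<bullet> y = (0::real)" "a \<in> span S" "b \<in> span (T :: 'e set)"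
  shows "a \<bullet> b = 0"
proof -
  have "orthogonal a y" if "y \<in> T" for y
    using orthogonal_to_span[OF assms(2), of y] assms(1) that
    by (auto simp: orthogonal_def inner_commute)
  then have "orthogonal a b" by (rule orthogonal_to_span[OF assms(3)])
  then show ?thesis by (simp add: orthogonal_def)
qed

text \<open>Otherwise the simple roots in \<open>J\<close> and the others span orthogonal subspaces. A simple reflection
  leaves a root in whichever of the two subspaces it lies, so all roots lie in their union, against irreducibility.\<close>

lemma dynkin_connected:
  assumes "i \<in> J" "j \<notin> J" shows "\<exists>a b. a \<in> J \<and> b \<notin> J \<and> \<alpha> a \<bullet> \<alpha> b \<noteq> 0"
proof (rule ccontr)
  assume "\<not> ?thesis"
  then have orth: "\<alpha> a \<bullet> \<alpha> b = 0" if "a \<in> J" "b \<notin> J" for a b using that by blast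
  define U1 where "U1 = span (\<alpha> ` J)"
  define U2 where "U2 = span (\<alpha> ` (- J))"
  have o12: "x \<bullet> y = 0" if "x \<in> U1" "y \<in> U2" for x y
    by (rule orthogonal_spans[OF _ that[unfolded U1_def U2_def]]) (use orth in auto)
  have a12: "\<alpha> i \<in> U1 \<or> \<alpha> i \<in> U2" for i unfolding U1_def U2_def by (auto intro: span_base)
  have "b \<in> U1 \<or> b \<in> U2" if "b \<in> \<Phi>" for b
    using that
  proof (induction rule: roots_induct)
    case (reflect b i)
    show ?case
    proof (cases "\<alpha> i \<bullet> b = 0")
      case True then show ?thesis using reflect by (simp add: root_reflection_def)
    next
      case False
      then have "(\<alpha> i \<in> U1 \<and> b \<in> U1) \<or> (\<alpha> i \<in> U2 \<and> b \<in> U2)"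
        using a12[of i] reflect o12[of "\<alpha> i" b] o12[of b "\<alpha> i"] by (auto simp: inner_commute)
      then show ?thesis unfolding root_reflection_def U1_def U2_def
        by (auto intro: span_diff span_scale)
    qed
  next
    case (neg b) then show ?case by (auto simp: U1_def U2_def intro: span_neg)
  qed (use a12 in auto)
  from roots_not_split[OF this o12] have "\<Phi> \<inter> U1 = {} \<or> \<Phi> \<inter> U2 = {}" by blast
  moreover have "\<alpha> i \<in> U1" "\<alpha> j \<in> U2" using assms by (auto simp: U1_def U2_def intro: span_base)
  ultimately have "\<alpha> i \<notin> \<Phi> \<or> \<alpha> j \<notin> \<Phi>" by blast
  then show False by (simp add: simple_root)
qed

text \<open>The roots of the length of \<open>b\<close> span a subspace containing every root that is not orthogonal to
  all of them, because it contains the difference of a root and its reflection. By irreducibility no root is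
  orthogonal to this subspace.\<close>

lemma nonorthogonal_root_of_same_length:
  assumes a: "a \<in> \<Phi>" and b: "b \<in> \<Phi>"
  shows "\<exists>b'\<in>\<Phi>. b' \<bullet> b' = b \<bullet> b \<and> a \<bullet> b' \<noteq> 0"
proof (rule ccontr)
  assume H: "\<not> ?thesis"
  define S where "S = {c \<in> \<Phi>. c \<bullet> c = b \<bullet> b}"
  have aS: "a \<bullet> c = 0" if "c \<in> S" for c using that H by (auto simp: S_def)
  define O' where "O' = {x. \<forall>c\<in>S. x \<bullet> c = 0}"
  have "x \<in> span S \<or> x \<in> O'" if x: "x \<in> \<Phi>" for x
  proof (rule disjCI)
    assume "x \<notin> O'"
    then obtain c where c: "c \<in> S" "x \<bullet> c \<noteq> 0" by (auto simp: O'_def)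
    let ?t = "2 * (x \<bullet> c) / (x \<bullet> x)"
    have "root_reflection x c \<in> S" using c(1) x reflect_root by (auto simp: S_def root_reflection_norm)
    then have "c - root_reflection x c \<in> span S" using c(1) by (intro span_diff span_base)
    then have "?t *\<^sub>R x \<in> span S" by (simp add: root_reflection_def)
    moreover have "?t \<noteq> 0" using c(2) root_pos[OF x] by simp
    ultimately show "x \<in> span S" using span_scale[of "?t *\<^sub>R x" S "1 / ?t"] by simp
  qed
  moreover have "x \<bullet> y = 0" if "x \<in> span S" "y \<in> O'" for x y
    using orthogonal_spans[of S "{y}" x y] that by (auto simp: O'_def inner_commute intro: span_base)
  ultimately have "\<Phi> \<inter> span S = {} \<or> \<Phi> \<inter> O' = {}" by (rule roots_not_split)
  moreover have "b \<in> span S" using b by (auto simp: S_def intro: span_base)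
  moreover have "a \<in> O'" using aS unfolding O'_def by simp
  ultimately have "b \<notin> \<Phi> \<or> a \<notin> \<Phi>" by blast
  then show False by (simp add: a b)
qed

text \<open>The two Cartan integers have the ratio of the square lengths as their ratio, and by the strict Cauchy-Schwarz
  inequality their product is less than 4.\<close>

lemma root_pair:
  assumes a: "a \<in> \<Phi>" and b: "b \<in> \<Phi>" and ab: "a \<bullet> b \<noteq> 0" and len: "b \<bullet> b \<le> a \<bullet> a"
    and neq: "a \<noteq> b" "a \<noteq> - b"
  obtains s k :: int where "s = 1 \<or> s = -1" "k \<in> {1, 2, 3}"
    "2 * (a \<bullet> b) / (a \<bullet> a) = of_int s" "2 * (b \<bullet> a) / (b \<bullet> b) = of_int (s * k)"
    "a \<bullet> a = of_int k * (b \<bullet> b)"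
proof -
  have pos: "a \<bullet> a > 0" "b \<bullet> b > 0" by (rule root_pos[OF a], rule root_pos[OF b])
  obtain m where m: "2 * (a \<bullet> b) / (a \<bullet> a) = of_int m"
    using root_integral[OF a b] by (auto elim: Ints_cases)
  obtain n where n: "2 * (b \<bullet> a) / (b \<bullet> b) = of_int n"
    using root_integral[OF b a] by (auto elim: Ints_cases)
  have m': "2 * (a \<bullet> b) = m * (a \<bullet> a)" using m pos by (simp add: field_simps)
  have n': "2 * (a \<bullet> b) = n * (b \<bullet> b)" using n pos by (simp add: field_simps inner_commute)
  have ratio: "m * (a \<bullet> a) = n * (b \<bullet> b)" using m' n' by simp
  have mn: "real_of_int (m * n) * (a \<bullet> a) * (b \<bullet> b) = 4 * (a \<bullet> b)^2"
  proof -
    have "real_of_int (m * n) * (a \<bullet> a) * (b \<bullet> b) = (m * (a \<bullet> a)) * (n * (b \<bullet> b))" by simp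
    also have "\<dots> = 4 * (a \<bullet> b)^2" unfolding m'[symmetric] n'[symmetric] by (simp add: power2_eq_square)
    finally show ?thesis .
  qed
  have "\<not> (a \<bullet> b)^2 = (a \<bullet> a) * (b \<bullet> b)"
  proof
    assume "(a \<bullet> b)^2 = (a \<bullet> a) * (b \<bullet> b)"
    then have "(a - ((a \<bullet> b) / (b \<bullet> b)) *\<^sub>R b) \<bullet> (a - ((a \<bullet> b) / (b \<bullet> b)) *\<^sub>R b) = 0"
      using pos by (simp add: inner_diff_left inner_diff_right inner_commute field_simps power2_eq_square)
    then have eq: "a = ((a \<bullet> b) / (b \<bullet> b)) *\<^sub>R b" by simp
    from root_multiple[OF b, of "(a \<bullet> b) / (b \<bullet> b)"] a eq have "(a \<bullet> b) / (b \<bullet> b) = 1 \<or> (a \<bullet> b) / (b \<bullet> b) = -1"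
      by simp
    then show False
    proof
      assume "(a \<bullet> b) / (b \<bullet> b) = 1" with eq neq(1) show False by simp
    next
      assume "(a \<bullet> b) / (b \<bullet> b) = -1" with eq neq(2) show False by simp
    qed
  qed
  with Cauchy_Schwarz_ineq[of a b] have "(a \<bullet> b)^2 < (a \<bullet> a) * (b \<bullet> b)" by linarith
  then have "real_of_int (m * n) * (a \<bullet> a) * (b \<bullet> b) < 4 * ((a \<bullet> a) * (b \<bullet> b))" using mn by simp
  then have "real_of_int (m * n) * ((a \<bullet> a) * (b \<bullet> b)) < 4 * ((a \<bullet> a) * (b \<bullet> b))" by (simp add: mult.assoc)
  then have "real_of_int (m * n) < 4" using pos by (simp only: mult_less_cancel_right_pos mult_pos_pos)
  then have mn4: "m * n < 4" by linarith
  have "m \<noteq> 0" "n \<noteq> 0" using m' n' ab by auto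
  have abs: "\<bar>m\<bar> * (a \<bullet> a) = \<bar>n\<bar> * (b \<bullet> b)"
    using arg_cong[OF ratio, of abs] pos by (simp add: abs_mult)
  have "0 < real_of_int (m * n) * ((a \<bullet> a) * (b \<bullet> b))"
    using mn ab by (simp add: mult.assoc)
  then have "0 < real_of_int (m * n)" by (rule zero_less_mult_pos2) (intro mult_pos_pos pos)
  then have mnpos: "m * n > 0" by (simp only: of_int_0_less_iff)
  have "\<bar>m\<bar> \<le> \<bar>n\<bar>"
  proof (rule ccontr)
    assume "\<not> ?thesis"
    then have "real_of_int \<bar>n\<bar> * (b \<bullet> b) < real_of_int \<bar>m\<bar> * (b \<bullet> b)" using pos by simp
    also have "\<dots> \<le> real_of_int \<bar>m\<bar> * (a \<bullet> a)" using len by (intro mult_left_mono) auto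
    finally show False using abs by simp
  qed
  have "\<bar>m\<bar> * \<bar>n\<bar> < 4" using mn4 mnpos by (simp add: abs_mult[symmetric])
  have "\<bar>m\<bar> = 1"
  proof (rule ccontr)
    assume "\<bar>m\<bar> \<noteq> 1"
    then have "\<bar>m\<bar> \<ge> 2" using \<open>m \<noteq> 0\<close> by linarith
    then have "2 * 2 \<le> \<bar>m\<bar> * \<bar>n\<bar>" using \<open>\<bar>m\<bar> \<le> \<bar>n\<bar>\<close> by (intro mult_mono) auto
    with \<open>\<bar>m\<bar> * \<bar>n\<bar> < 4\<close> show False by simp
  qed
  then have ms: "m = 1 \<or> m = -1" by linarith
  have nk: "n = m * \<bar>n\<bar>" using ms mnpos by auto
  have "\<bar>n\<bar> \<in> {1,2,3}" using \<open>\<bar>m\<bar> = 1\<close> \<open>\<bar>m\<bar> * \<bar>n\<bar> < 4\<close> \<open>n \<noteq> 0\<close> by auto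
  then show ?thesis
    using that[of m "\<bar>n\<bar>"] ms m n nk abs \<open>\<bar>m\<bar> = 1\<close> by auto
qed


text \<open>Some root of the length of \<open>b\<close> is not orthogonal to the maximal root, which is at least as long.\<close>

lemma length_times_long:
  assumes max: "maximal_root \<Phi> \<alpha> \<theta>" and b: "b \<in> \<Phi>"
  shows "\<exists>k\<in>{1,2,3::int}. of_int k * (b \<bullet> b) = \<theta> \<bullet> \<theta>"
proof -
  have th: "\<theta> \<in> \<Phi>" using max by (simp add: maximal_root_def)
  obtain b' where b': "b' \<in> \<Phi>" "b' \<bullet> b' = b \<bullet> b" "\<theta> \<bullet> b' \<noteq> 0"
    using nonorthogonal_root_of_same_length[OF th b] by (elim bexE conjE) (rule that)
  show ?thesis
  proof (cases "\<theta> = b' \<or> \<theta> = - b'")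
    case True
    then have "\<theta> \<bullet> \<theta> = b \<bullet> b" using b'(2) by auto
    then show ?thesis by (intro bexI[of _ 1]) auto
  next
    case False
    obtain s k :: int where "k \<in> {1,2,3}" "\<theta> \<bullet> \<theta> = of_int k * (b' \<bullet> b')"
      using root_pair[OF th b'(1) b'(3)] maximal_root_longest[OF max b'(1)] False by blast
    then show ?thesis using b'(2) by (intro bexI[of _ k]) auto
  qed
qed

text \<open>There are at most two root lengths: if both ratios 2 and 3 to the long roots occurred, there would be two
  nonorthogonal roots whose square lengths have the ratio 3/2.\<close>

lemma length_multiplier_unique:
  assumes max: "maximal_root \<Phi> \<alpha> \<theta>" and a: "a \<in> \<Phi>" and b: "b \<in> \<Phi>"
    and k: "of_int k * (a \<bullet> a) = \<theta> \<bullet> \<theta>" "k \<noteq> 1" and l: "of_int l * (b \<bullet> b) = \<theta> \<bullet> \<theta>" "l \<noteq> 1"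
  shows "k = l"
proof (rule ccontr)
  assume "k \<noteq> l"
  have th: "\<theta> \<in> \<Phi>" using max by (simp add: maximal_root_def)
  have *: "x \<in> {1,2,3}" if xc: "of_int x * (c \<bullet> c) = \<theta> \<bullet> \<theta>" and c: "c \<in> \<Phi>" for x c
  proof -
    obtain y :: int where y: "y \<in> {1,2,3}" "of_int y * (c \<bullet> c) = \<theta> \<bullet> \<theta>"
      using length_times_long[OF max c] by blast
    have "real_of_int x * (c \<bullet> c) = real_of_int y * (c \<bullet> c)" using xc y(2) by simp
    then have "x = y" using root_pos[OF c] by simp
    then show ?thesis using y(1) by simp
  qed
  have False if k3: "real_of_int 3 * (a \<bullet> a) = \<theta> \<bullet> \<theta>" and l2: "real_of_int 2 * (b \<bullet> b) = \<theta> \<bullet> \<theta>"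
    and a: "a \<in> \<Phi>" and b: "b \<in> \<Phi>" for a b
  proof -
    obtain a' where a': "a' \<in> \<Phi>" "a' \<bullet> a' = a \<bullet> a" "b \<bullet> a' \<noteq> 0"
      using nonorthogonal_root_of_same_length[OF b a] by (elim bexE conjE) (rule that)
    have "0 < b \<bullet> b" by (rule root_pos[OF b])
    then have lt: "a' \<bullet> a' < b \<bullet> b" using k3 l2 a'(2) by linarith
    then have "b \<noteq> a'" "b \<noteq> - a'" by auto
    then obtain m :: int where "b \<bullet> b = of_int m * (a' \<bullet> a')"
      using root_pair[OF b a'(1) a'(3)] lt by (metis less_imp_le)
    then have "(3::real) * (a \<bullet> a) = of_int (2 * m) * (a \<bullet> a)" using k3 l2 a'(2) by simp
    then have "(3::real) = of_int (2 * m)" using root_pos[OF a] by simp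
    then have "3 = 2 * m" by linarith
    then show False by presburger
  qed
  from this[of a b] this[of b a] *[OF k(1) a] *[OF l(1) b] k l a b \<open>k \<noteq> l\<close> show False
    by auto
qed

lemma simple_pair:
  assumes "i \<noteq> j" "\<alpha> i \<bullet> \<alpha> j \<noteq> 0" "\<alpha> j \<bullet> \<alpha> j \<le> \<alpha> i \<bullet> \<alpha> i"
  obtains k where "k \<in> {1,2,3}" "cartan \<alpha> i j = -1" "cartan \<alpha> j i = - k"
    "\<alpha> i \<bullet> \<alpha> i = of_int k * (\<alpha> j \<bullet> \<alpha> j)"
proof -
  have "\<alpha> i \<noteq> \<alpha> j" using inj_simple assms(1) by (simp add: inj_eq)
  moreover have "\<alpha> i \<noteq> - \<alpha> j"
  proof
    assume "\<alpha> i = - \<alpha> j"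
    then have "1 *\<^sub>R \<alpha> i = (-1) *\<^sub>R \<alpha> j" by simp
    from simple_coeff_unique[OF this[unfolded simple_root_as_sum[of 1 i] simple_root_as_sum[of "-1" j]], of i]
    show False using assms(1) by simp
  qed
  ultimately obtain s k :: int where sk: "s = 1 \<or> s = -1" "k \<in> {1, 2, 3}"
    "2 * (\<alpha> i \<bullet> \<alpha> j) / (\<alpha> i \<bullet> \<alpha> i) = of_int s" "2 * (\<alpha> j \<bullet> \<alpha> i) / (\<alpha> j \<bullet> \<alpha> j) = of_int (s * k)"
    "\<alpha> i \<bullet> \<alpha> i = of_int k * (\<alpha> j \<bullet> \<alpha> j)"
    using root_pair[OF simple_root simple_root assms(2,3)] by blast
  have "2 * (\<alpha> i \<bullet> \<alpha> j) / (\<alpha> i \<bullet> \<alpha> i) \<le> 0"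
    using simple_inner_nonpos[OF assms(1)] root_pos[OF simple_root[of i]] by (simp add: divide_le_0_iff)
  then have "s = -1" using sk(1,3) by auto
  show ?thesis
  proof (rule that[of k])
    show "cartan \<alpha> i j = -1" unfolding cartan_def sk(3) using \<open>s = -1\<close> by (simp only: floor_of_int)
    show "cartan \<alpha> j i = - k" unfolding cartan_def sk(4) using \<open>s = -1\<close> by (simp only: floor_of_int)
  qed (use sk in auto)
qed

lemma cartan_diag: "cartan \<alpha> i i = 2"
  using root_pos[OF simple_root[of i]] by (simp add: cartan_def)

lemma finite_dynkin_edges: "finite {dynkin_edges \<alpha> i j | i j. i \<noteq> j}"
  by (rule finite_subset[of _ "(\<lambda>(i, j). dynkin_edges \<alpha> i j) ` UNIV"]) auto

text \<open>The normalization makes the short roots of square length 2 as soon as there are two root lengths: some edge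
  of the Dynkin diagram joins simple roots of different lengths, its multiplicity is the ratio of the square lengths,
  and no other multiplicity except 1 occurs. So this ratio is \<open>r_check\<close>, half the square length
  of the maximal root.\<close>

lemma half_norm_values:
  shows half_norm_eq: "real_of_int (half_norm \<alpha> i) = (\<alpha> i \<bullet> \<alpha> i) / 2"
    and half_norm_ge_1: "half_norm \<alpha> i \<ge> 1"
    and half_norm_short: "\<alpha> i \<bullet> \<alpha> i < b \<bullet> b \<Longrightarrow> b \<in> \<Phi> \<Longrightarrow> half_norm \<alpha> i = 1"
proof -
  obtain \<theta> where max: "maximal_root \<Phi> \<alpha> \<theta>" and norm: "\<theta> \<bullet> \<theta> = 2 * of_int (r_check \<alpha>)"
    using rd unfolding simple_root_data_def by blast
  have th: "\<theta> \<in> \<Phi>" using max by (simp add: maximal_root_def)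
  have r_ge: "r_check \<alpha> \<ge> 1" unfolding r_check_def using finite_dynkin_edges by simp
  have r_edge: "dynkin_edges \<alpha> a b \<le> r_check \<alpha>" if "a \<noteq> b" for a b
    unfolding r_check_def using finite_dynkin_edges that by (intro Max_ge) auto
  have r_att: "\<exists>a b. a \<noteq> b \<and> dynkin_edges \<alpha> a b = r_check \<alpha>" if "r_check \<alpha> \<noteq> 1"
  proof -
    have "r_check \<alpha> \<in> insert 1 {dynkin_edges \<alpha> i j | i j. i \<noteq> j}"
      unfolding r_check_def using finite_dynkin_edges by (intro Max_in) auto
    then have "\<exists>i j. r_check \<alpha> = dynkin_edges \<alpha> i j \<and> i \<noteq> j" using that by simp
    then show ?thesis by metis
  qed
  obtain k :: int where k: "k \<in> {1,2,3}" "of_int k * (\<alpha> i \<bullet> \<alpha> i) = \<theta> \<bullet> \<theta>"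
    using length_times_long[OF max simple_root] by blast
  have kr: "k = r_check \<alpha>" if "k \<noteq> 1"
  proof -
    define J where "J = {j. \<alpha> j \<bullet> \<alpha> j = \<theta> \<bullet> \<theta>}"
    obtain j where "j \<in> J" using simple_root_of_same_length[OF th] by (auto simp: J_def)
    moreover have "i \<notin> J" using k that root_pos[OF simple_root[of i]] by (auto simp: J_def)
    ultimately obtain a b where ab: "a \<in> J" "b \<notin> J" "\<alpha> a \<bullet> \<alpha> b \<noteq> 0"
      using dynkin_connected[of j J i] by blast
    have len: "\<alpha> b \<bullet> \<alpha> b \<le> \<alpha> a \<bullet> \<alpha> a"
      using ab(1) maximal_root_longest[OF max simple_root] by (simp add: J_def)
    have "a \<noteq> b" using ab by blast
    then obtain l where l: "cartan \<alpha> a b = -1" "cartan \<alpha> b a = - l"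
      "\<alpha> a \<bullet> \<alpha> a = of_int l * (\<alpha> b \<bullet> \<alpha> b)"
      using simple_pair[OF _ ab(3) len] by metis
    have "of_int l * (\<alpha> b \<bullet> \<alpha> b) = \<theta> \<bullet> \<theta>" "l \<noteq> 1" using l ab by (auto simp: J_def)
    then have "l = k" using length_multiplier_unique[OF max simple_root simple_root _ _ k(2) that] by blast
    then have "k \<le> r_check \<alpha>" using r_edge[OF \<open>a \<noteq> b\<close>] l by (simp add: dynkin_edges_def)
    then have "r_check \<alpha> \<noteq> 1" using k(1) that by auto
    then obtain c d where cd: "c \<noteq> d" "dynkin_edges \<alpha> c d = r_check \<alpha>" using r_att by blast
    have "\<exists>c d. c \<noteq> d \<and> dynkin_edges \<alpha> c d = r_check \<alpha> \<and> \<alpha> d \<bullet> \<alpha> d \<le> \<alpha> c \<bullet> \<alpha> c"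
    proof (cases "\<alpha> d \<bullet> \<alpha> d \<le> \<alpha> c \<bullet> \<alpha> c")
      case True then show ?thesis using cd by blast
    next
      case False
      moreover have "dynkin_edges \<alpha> d c = r_check \<alpha>" using cd(2) by (simp add: dynkin_edges_def mult.commute)
      ultimately show ?thesis using cd(1) by (intro exI[of _ d] exI[of _ c]) auto
    qed
    then obtain c d where cd: "c \<noteq> d" "dynkin_edges \<alpha> c d = r_check \<alpha>" "\<alpha> d \<bullet> \<alpha> d \<le> \<alpha> c \<bullet> \<alpha> c" by blast
    have "\<alpha> c \<bullet> \<alpha> d \<noteq> 0"
    proof
      assume "\<alpha> c \<bullet> \<alpha> d = 0"
      then have "dynkin_edges \<alpha> c d = 0" by (simp add: dynkin_edges_def cartan_def)
      then show False using cd(2) r_ge by simp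
    qed
    then obtain m where m: "cartan \<alpha> c d = -1" "cartan \<alpha> d c = - m"
      "\<alpha> c \<bullet> \<alpha> c = of_int m * (\<alpha> d \<bullet> \<alpha> d)"
      using simple_pair[OF cd(1) _ cd(3)] by metis
    have mr: "m = r_check \<alpha>" using m cd(2) by (simp add: dynkin_edges_def)
  \<comment> \<open>  The pair \<open>c, d\<close> has the largest multiplicity. Its longer root is a long root, as the ratio 4 or more does not occur.\<close>
    obtain kc :: int where kc: "kc \<in> {1,2,3}" "of_int kc * (\<alpha> c \<bullet> \<alpha> c) = \<theta> \<bullet> \<theta>"
      using length_times_long[OF max simple_root] by blast
    have prod: "of_int (kc * m) * (\<alpha> d \<bullet> \<alpha> d) = \<theta> \<bullet> \<theta>" using kc m(3) by simp
    have m2: "m \<ge> 2" using mr r_ge \<open>r_check \<alpha> \<noteq> 1\<close> by linarith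
    have "kc * m \<noteq> 1" using m2 kc(1) by auto
    then have km: "kc * m = k" using length_multiplier_unique[OF max simple_root simple_root prod _ k(2) that] by blast
    have "kc = 1"
    proof (rule ccontr)
      assume "kc \<noteq> 1"
      then have "2 * 2 \<le> kc * m" using m2 kc(1) by (intro mult_mono) auto
      then show False using km k(1) by auto
    qed
    then show ?thesis using km mr by simp
  qed
  have rp: "real_of_int (r_check \<alpha>) > 0" using r_ge by linarith
  have cases: "(k = 1 \<and> \<alpha> i \<bullet> \<alpha> i = 2 * of_int (r_check \<alpha>)) \<or> (k \<noteq> 1 \<and> \<alpha> i \<bullet> \<alpha> i = 2)"
  proof (cases "k = 1")
    case True then show ?thesis using k(2) norm by simp
  next
    case False
    then have "of_int (r_check \<alpha>) * (\<alpha> i \<bullet> \<alpha> i) = of_int (r_check \<alpha>) * 2"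
      using k(2) norm kr by (simp add: mult.commute)
    then show ?thesis using rp False by simp
  qed
  then show "real_of_int (half_norm \<alpha> i) = (\<alpha> i \<bullet> \<alpha> i) / 2" "half_norm \<alpha> i \<ge> 1"
    using r_ge by (auto simp: half_norm_def)
  show "half_norm \<alpha> i = 1" if "\<alpha> i \<bullet> \<alpha> i < b \<bullet> b" "b \<in> \<Phi>"
  proof -
    have "k \<noteq> 1" using k that maximal_root_longest[OF max that(2)] by auto
    then show ?thesis using cases by (auto simp: half_norm_def)
  qed
qed

lemma cartan_offdiag_cases:
  assumes "i \<noteq> j"
  obtains "cartan \<alpha> j i = 0" "\<alpha> j \<bullet> \<alpha> i = 0" | "cartan \<alpha> j i = -1" "2 * (\<alpha> j \<bullet> \<alpha> i) = - (\<alpha> j \<bullet> \<alpha> j)"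
    | "cartan \<alpha> j i = -2" "half_norm \<alpha> j = 1" | "cartan \<alpha> j i = -3" "half_norm \<alpha> j = 1"
proof (cases "\<alpha> i \<bullet> \<alpha> j = 0")
  case True
  then show ?thesis using that(1) by (simp add: cartan_def inner_commute)
next
  case False
  have pos: "\<alpha> j \<bullet> \<alpha> j > 0" by (rule root_pos[OF simple_root])
  have minus1: "2 * (\<alpha> j \<bullet> \<alpha> i) = - (\<alpha> j \<bullet> \<alpha> j)" if "cartan \<alpha> j i = -1"
  proof -
    have "2 * (\<alpha> j \<bullet> \<alpha> i) / (\<alpha> j \<bullet> \<alpha> j) = of_int (cartan \<alpha> j i)"
      using root_integral[OF simple_root[of j] simple_root[of i]] unfolding cartan_def by (auto elim!: Ints_cases)
    then show ?thesis using that pos by (simp add: field_simps)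
  qed
  show ?thesis
  proof (cases "\<alpha> j \<bullet> \<alpha> j \<le> \<alpha> i \<bullet> \<alpha> i")
    case True
    from simple_pair[OF assms False True] obtain k where k: "k \<in> {1,2,3}" "cartan \<alpha> j i = - k"
      "\<alpha> i \<bullet> \<alpha> i = of_int k * (\<alpha> j \<bullet> \<alpha> j)" by metis
    show ?thesis
    proof (cases "k = 1")
      case True then show ?thesis using that(2) minus1 k(2) by simp
    next
      case False
      then have "\<alpha> j \<bullet> \<alpha> j < \<alpha> i \<bullet> \<alpha> i" using k pos by auto
      then have "half_norm \<alpha> j = 1" by (rule half_norm_short[OF _ simple_root])
      then show ?thesis using that(3,4) k False by auto
    qed
  next
    case len: False
    have "cartan \<alpha> j i = -1"
      by (rule simple_pair[OF not_sym[OF assms]]) (use False len in \<open>auto simp: inner_commute\<close>)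
    then show ?thesis using that(2) minus1 by blast
  qed
qed

lemma sym_cartan_eq_half_norm_cartan: "sym_cartan \<alpha> j i = half_norm \<alpha> j * cartan \<alpha> j i"
  and sym_cartan_eq_inner: "real_of_int (sym_cartan \<alpha> j i) = \<alpha> j \<bullet> \<alpha> i"
proof -
  have "2 * (\<alpha> j \<bullet> \<alpha> i) / (\<alpha> j \<bullet> \<alpha> j) = of_int (cartan \<alpha> j i)"
    using root_integral[OF simple_root[of j] simple_root[of i]] unfolding cartan_def by (auto elim!: Ints_cases)
  then have *: "\<alpha> j \<bullet> \<alpha> i = of_int (half_norm \<alpha> j * cartan \<alpha> j i)"
    using root_pos[OF simple_root[of j]] by (simp add: half_norm_eq field_simps)
  then show "sym_cartan \<alpha> j i = half_norm \<alpha> j * cartan \<alpha> j i"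
    unfolding sym_cartan_def by (simp only: floor_of_int)
  then show "real_of_int (sym_cartan \<alpha> j i) = \<alpha> j \<bullet> \<alpha> i" using * by simp
qed

text \<open>The inner product is positive definite, so a combination of simple roots orthogonal to all simple roots vanishes.
  This is what separates a lower weight from the highest one.\<close>

lemma positive_combination_detected:
  assumes "\<And>j. (\<Sum>i\<in>UNIV. int (n i) * sym_cartan \<alpha> j i) = 0"
  shows "n i = 0"
proof -
  define v where "v = (\<Sum>i\<in>UNIV. real (n i) *\<^sub>R \<alpha> i)"
  have "\<alpha> j \<bullet> v = real_of_int (\<Sum>i\<in>UNIV. int (n i) * sym_cartan \<alpha> j i)" for j
    by (simp add: v_def inner_sum_right sym_cartan_eq_inner)
  then have "\<alpha> j \<bullet> v = 0" for j using assms by simp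
  then have "v \<bullet> v = 0" by (subst (1) v_def) (simp add: inner_sum_left)
  then have "(\<Sum>i\<in>UNIV. real (n i) *\<^sub>R \<alpha> i) = (\<Sum>i\<in>UNIV. 0 *\<^sub>R \<alpha> i)" by (simp add: v_def)
  from simple_coeff_unique[OF this] show ?thesis by simp
qed

end

section \<open>Joint eigenvectors of commuting operators\<close>

locale complex_vector_space = vector_space scl
  for scl :: "complex \<Rightarrow> 'v::ab_group_add \<Rightarrow> 'v" (infixr "\<star>" 75)
begin

definition lin :: "('v \<Rightarrow> 'v) \<Rightarrow> bool" where
  "lin T \<longleftrightarrow> (\<forall>x y. T (x + y) = T x + T y) \<and> (\<forall>c x. T (c \<star> x) = c \<star> T x)"

lemma lin_add: "lin T \<Longrightarrow> T (x + y) = T x + T y" and lin_scale: "lin T \<Longrightarrow> T (c \<star> x) = c \<star> T x"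
  by (auto simp: lin_def)

lemma lin_zero: "lin T \<Longrightarrow> T 0 = 0"
  using lin_add[of T 0 0] by simp

lemma lin_neg: "lin T \<Longrightarrow> T (- x) = - T x"
  using lin_scale[of T "-1" x] by simp

lemma lin_diff: "lin T \<Longrightarrow> T (x - y) = T x - T y"
  using lin_add[of T x "- y"] by (simp add: lin_neg)

lemma lin_sum: "lin T \<Longrightarrow> T (\<Sum>i\<in>A. f i) = (\<Sum>i\<in>A. T (f i))"
  by (induction A rule: infinite_finite_induct) (simp_all add: lin_zero lin_add)

lemma lin_shifted: "lin T \<Longrightarrow> lin (\<lambda>x. T x - c \<star> x)"
  by (simp add: lin_def scale_right_distrib scale_right_diff_distrib mult.commute)

lemma lin_funpow: "lin T \<Longrightarrow> lin (T ^^ n)"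
  by (induction n) (simp_all add: lin_def)

lemma lin_comp: "lin S \<Longrightarrow> lin T \<Longrightarrow> lin (\<lambda>x. S (T x))"
  by (simp add: lin_def)

lemma funpow_in: "(\<And>x. x \<in> S \<Longrightarrow> T x \<in> S) \<Longrightarrow> x \<in> S \<Longrightarrow> (T ^^ n) x \<in> S"
  by (induction n) auto

text \<open>A linear relation among the iterates of a vector under an operator amounts to a polynomial
  that annihilates the vector; splitting off one linear factor after the other, the last nonzero
  vector is an eigenvector.\<close>

lemma eigenvector_of_polynomial_relation:
  assumes T: "lin T" and S: "subspace S" "\<And>x. x \<in> S \<Longrightarrow> T x \<in> S"
    and u: "u \<in> S" "u \<noteq> 0"
    and p: "p \<noteq> 0" "degree p \<le> N" "(\<Sum>l\<le>N. coeff p l \<star> (T ^^ l) u) = 0"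
  shows "\<exists>a. \<exists>w\<in>S. w \<noteq> 0 \<and> T w = a \<star> w"
  using p
proof (induction N arbitrary: p)
  case 0
  then have "coeff p 0 \<noteq> 0" by (metis coeff_0 leading_coeff_0_iff le_zero_eq)
  with 0 u(2) show ?case by simp
next
  case (Suc N)
  show ?case
  proof (cases "degree p = 0")
    case True
    then have c0: "coeff p 0 \<noteq> 0" using Suc.prems(1) by (metis leading_coeff_0_iff)
    have cl: "coeff p l = 0" if "l > 0" for l using True that by (simp add: coeff_eq_0)
    have "(\<Sum>l\<le>Suc N. coeff p l \<star> (T ^^ l) u) = (\<Sum>l\<le>Suc N. if l = 0 then coeff p 0 \<star> u else 0)"
      by (rule sum.cong) (auto simp: cl)
    then show ?thesis using Suc.prems(3) c0 u(2) by simp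
  next
    case False
    then obtain a where "poly p a = 0"
      using fundamental_theorem_of_algebra[of p] by (auto simp: constant_degree)
    then obtain r where r: "p = [:- a, 1:] * r" using poly_eq_0_iff_dvd by (metis dvdE)
    have r0: "r \<noteq> 0" using r Suc.prems(1) by auto
    have deg: "degree r \<le> N"
      using Suc.prems(2) r0 unfolding r by (subst (asm) degree_mult_eq) auto
    define w where "w = (\<Sum>l\<le>N. coeff r l \<star> (T ^^ l) u)"
    have wS: "w \<in> S"
      unfolding w_def using S u(1) by (intro subspace_sum subspace_scale funpow_in) auto
    have cr: "coeff r (Suc N) = 0" using deg by (simp add: coeff_eq_0)
    have "0 = (\<Sum>l\<le>Suc N. coeff p l \<star> (T ^^ l) u)" using Suc.prems(3) by simp
    also have "\<dots> = (\<Sum>l\<le>Suc N. coeff (pCons 0 r) l \<star> (T ^^ l) u) - (\<Sum>l\<le>Suc N. (a * coeff r l) \<star> (T ^^ l) u)"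
      by (simp only: r sum_subtractf[symmetric] scale_left_diff_distrib[symmetric]) (simp add: algebra_simps)
    also have "(\<Sum>l\<le>Suc N. coeff (pCons 0 r) l \<star> (T ^^ l) u) = T w"
      by (simp only: sum.atMost_Suc_shift) (simp add: w_def lin_sum[OF T] lin_scale[OF T])
    also have "(\<Sum>l\<le>Suc N. (a * coeff r l) \<star> (T ^^ l) u) = a \<star> w"
      by (simp add: w_def scale_sum_right cr)
    finally have "T w = a \<star> w" by simp
    then show ?thesis using wS Suc.IH[OF r0 deg] unfolding w_def by blast
  qed
qed

definition iterates_dependent :: "('v \<Rightarrow> 'v) \<Rightarrow> 'v \<Rightarrow> bool" where
  "iterates_dependent T u \<longleftrightarrow> (\<exists>N c. (\<exists>l\<le>N. c l \<noteq> 0) \<and> (\<Sum>l\<le>N. c l \<star> (T ^^ l) u) = 0)"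

lemma eigenvector_of_dependent_iterates:
  assumes T: "lin T" and S: "subspace S" "\<And>x. x \<in> S \<Longrightarrow> T x \<in> S"
    and u: "u \<in> S" "u \<noteq> 0" and dep: "iterates_dependent T u"
  shows "\<exists>a. \<exists>w\<in>S. w \<noteq> 0 \<and> T w = a \<star> w"
proof -
  obtain N and c :: "nat \<Rightarrow> complex" where c: "\<exists>l\<le>N. c l \<noteq> 0" "(\<Sum>l\<le>N. c l \<star> (T ^^ l) u) = 0"
    using dep unfolding iterates_dependent_def by blast
  define p where "p = (\<Sum>l\<le>N. monom (c l) l)"
  have cp: "coeff p l = (if l \<le> N then c l else 0)" for l
    by (auto simp: p_def coeff_sum)
  have "p \<noteq> 0" using c(1) cp by (metis coeff_0)
  moreover have "degree p \<le> N" by (rule degree_le) (simp add: cp)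
  moreover have "(\<Sum>l\<le>N. coeff p l \<star> (T ^^ l) u) = 0" using c(2) by (simp add: cp)
  ultimately show ?thesis using eigenvector_of_polynomial_relation[OF T S u, of p N] by simp
qed

lemma dependent_family:
  assumes "finite B" "\<And>l. l \<le> N \<Longrightarrow> x l \<in> span B" "card B \<le> N"
  obtains c where "\<exists>l\<le>N. c l \<noteq> 0" "(\<Sum>l\<le>N. c l \<star> x l) = 0"
proof (cases "inj_on x {..N}")
  case True
  have "dependent (x ` {..N})"
  proof (rule ccontr)
    assume "\<not> dependent (x ` {..N})"
    moreover have "x ` {..N} \<subseteq> span B" using assms(2) by auto
    ultimately have "card (x ` {..N}) \<le> card B" using independent_span_bound[OF assms(1)] by blast
    then show False using assms(3) card_image[OF True] by simp
  qed
  then obtain u v where u: "v \<in> x ` {..N}" "u v \<noteq> 0" "(\<Sum>v\<in>x ` {..N}. u v \<star> v) = 0"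
    by (subst (asm) dependent_finite) auto
  show ?thesis
  proof (rule that[of "\<lambda>l. u (x l)"])
    show "\<exists>l\<le>N. u (x l) \<noteq> 0" using u by auto
    show "(\<Sum>l\<le>N. u (x l) \<star> x l) = 0" using u(3) by (simp add: sum.reindex[OF True])
  qed
next
  case False
  then obtain i j where ij: "i \<le> N" "j \<le> N" "i \<noteq> j" "x i = x j" by (auto simp: inj_on_def)
  let ?c = "\<lambda>l. (if l = i then 1 else 0) - (if l = j then 1 else 0 :: complex)"
  have if_s: "(if P then 1 else 0) \<star> z = (if P then z else 0)" for P z by simp
  show ?thesis
  proof (rule that[of ?c])
    show "\<exists>l\<le>N. ?c l \<noteq> 0" using ij by (intro exI[of _ i]) simp
    show "(\<Sum>l\<le>N. ?c l \<star> x l) = 0"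
      using ij by (simp add: scale_left_diff_distrib sum_subtractf if_s)
  qed
qed

text \<open>Finitely many commuting operators, each with dependent iterates, have a common eigenvector:
  pass to the eigenspaces one after the other.\<close>

lemma joint_eigenvector_finitely_many:
  fixes T :: "nat \<Rightarrow> 'v \<Rightarrow> 'v"
  assumes lin: "\<And>t. t < k \<Longrightarrow> lin (T t)"
    and comm: "\<And>s t x. s < k \<Longrightarrow> t < k \<Longrightarrow> T s (T t x) = T t (T s x)"
    and S: "subspace S" "\<And>t x. t < k \<Longrightarrow> x \<in> S \<Longrightarrow> T t x \<in> S"
    and dep: "\<And>t x. t < k \<Longrightarrow> x \<in> S \<Longrightarrow> iterates_dependent (T t) x"
    and u: "u \<in> S" "u \<noteq> 0"
  shows "\<exists>w\<in>S. w \<noteq> 0 \<and> (\<forall>t<k. \<exists>a. T t w = a \<star> w)"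
proof -
  have "\<exists>a. \<exists>w\<in>S. w \<noteq> 0 \<and> (\<forall>t<m. T t w = a t \<star> w)" if "m \<le> k" for m
    using that
  proof (induction m)
    case 0 then show ?case using u by auto
  next
    case (Suc m)
    then obtain a w where w: "w \<in> S" "w \<noteq> 0" "\<forall>t<m. T t w = a t \<star> w" by auto
    define S' where "S' = {x \<in> S. \<forall>t<m. T t x = a t \<star> x}"
    have m: "m < k" using Suc.prems by simp
    have tk: "t < k" if "t < m" for t using that m by simp
    have "subspace S'"
      using S(1) unfolding S'_def
      by (intro subspaceI) (auto simp: subspace_0 subspace_add subspace_scale lin_zero[OF lin[OF tk]]
          lin_add[OF lin[OF tk]] lin_scale[OF lin[OF tk]] scale_right_distrib mult.commute)
    moreover have "T m x \<in> S'" if "x \<in> S'" for x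
      using that S(2)[OF m] lin_scale[OF lin[OF m]] comm[OF tk m] by (auto simp: S'_def)
    moreover have "w \<in> S'" using w by (simp add: S'_def)
    ultimately obtain b w' where w': "w' \<in> S'" "w' \<noteq> 0" "T m w' = b \<star> w'"
      using eigenvector_of_dependent_iterates[OF lin[OF m], of S' w] w(1,2) dep[OF m] by blast
    show ?case
      by (rule exI[of _ "a(m := b)"], rule bexI[of _ w']) (use w' in \<open>auto simp: S'_def less_Suc_eq\<close>)
  qed
  from this[of k] show ?thesis by blast
qed

definition factor_product :: "('x \<Rightarrow> 'v \<Rightarrow> 'v) \<Rightarrow> ('x \<times> complex) list \<Rightarrow> 'v \<Rightarrow> 'v" where
  "factor_product T cs y = foldr (\<lambda>(x, c) w. T x w - c \<star> w) cs y"

lemma factor_product_simps [simp]: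
  "factor_product T [] y = y"
  "factor_product T (xc # cs) y = T (fst xc) (factor_product T cs y) - snd xc \<star> factor_product T cs y"
  by (simp_all add: factor_product_def split_beta)

lemma factor_product_append: "factor_product T (as @ bs) y = factor_product T as (factor_product T bs y)"
  by (induction as) simp_all

text \<open>A joint generalized eigenvector cannot be a combination of joint eigenvectors each of which has
  some different eigenvalue: a product of operators kills the combination but acts
  injectively on the generalized eigenspace.\<close>

lemma joint_gen_eigenvector_not_in_span:
  assumes lin: "\<And>x. lin (T x)" and comm: "\<And>x y v. T x (T y v) = T y (T x v)"
    and E: "\<And>e. e \<in> E \<Longrightarrow> \<exists>x c. c \<noteq> \<kappa> x \<and> T x e = c \<star> e"
    and y: "y \<in> span E" and gen: "\<And>x. \<exists>N. ((\<lambda>w. T x w - \<kappa> x \<star> w) ^^ N) y = 0"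
  shows "y = 0"
proof -
  define G where "G = {y. \<forall>x. \<exists>N. ((\<lambda>w. T x w - \<kappa> x \<star> w) ^^ N) y = 0}"
  define ok where "ok = (\<lambda>cs. \<forall>(x, c)\<in>set cs. c \<noteq> \<kappa> x)"
  let ?P = "factor_product T"
  have lP: "lin (?P cs)" for cs
  proof (induction cs)
    case Nil then show ?case by (simp add: lin_def)
  next
    case (Cons xc cs)
    from lin_comp[OF lin_shifted[OF lin[of "fst xc"], of "snd xc"] this] show ?case by simp
  qed
  have T_P: "T x (?P cs v) = ?P cs (T x v)" for x cs v
  proof (induction cs)
    case (Cons a cs)
    have "T x (T (fst a) (?P cs v)) = T (fst a) (?P cs (T x v))" by (subst comm) (simp add: Cons)
    then show ?case by (simp add: lin_diff[OF lin] lin_scale[OF lin] Cons)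
  qed simp
  have PP: "?P as (?P bs v) = ?P bs (?P as v)" for as bs v
    by (induction as) (simp_all add: lin_diff[OF lP] lin_scale[OF lP] T_P)
  \<comment> \<open>Products of factors \<open>T x - c\<close> with \<open>c\<close> different from \<open>\<kappa> x\<close> kill the span of \<open>E\<close>.\<close>
  have kill: "\<exists>cs. ok cs \<and> ?P cs z = 0" if "z \<in> span E" for z
    using that
  proof (induction rule: span_induct_alt)
    case base then show ?case by (intro exI[of _ "[]"]) (simp add: ok_def)
  next
    case (step a e z)
    obtain x c where xc: "c \<noteq> \<kappa> x" "T x e = c \<star> e" using E[OF step(1)] by blast
    obtain cs where cs: "ok cs" "?P cs z = 0" using step by blast
    have "?P (cs @ [(x, c)]) e = 0" by (simp add: factor_product_append xc lin_zero[OF lP])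
    moreover have "?P (cs @ [(x, c)]) z = 0"
      by (simp add: factor_product_append lin_diff[OF lP] lin_scale[OF lP] T_P[symmetric] cs lin_zero[OF lin])
    ultimately have "?P (cs @ [(x, c)]) (a \<star> e + z) = 0" by (simp add: lin_add[OF lP] lin_scale[OF lP])
    then show ?case using cs(1) xc(1) by (intro exI[of _ "cs @ [(x, c)]"]) (auto simp: ok_def)
  qed
  have G_P: "?P cs v \<in> G" if v: "v \<in> G" for cs v
  proof -
    have pow: "((\<lambda>w. T x w - \<kappa> x \<star> w) ^^ N) (?P cs v) = ?P cs (((\<lambda>w. T x w - \<kappa> x \<star> w) ^^ N) v)" for x N
      by (induction N) (simp_all add: T_P lin_diff[OF lP] lin_scale[OF lP])
    have "\<exists>N. ((\<lambda>w. T x w - \<kappa> x \<star> w) ^^ N) (?P cs v) = 0" for x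
    proof -
      obtain N where "((\<lambda>w. T x w - \<kappa> x \<star> w) ^^ N) v = 0" using v by (auto simp: G_def)
      then show ?thesis by (intro exI[of _ N]) (simp add: pow lin_zero[OF lP])
    qed
    then show ?thesis by (simp add: G_def)
  qed
  \<comment> \<open>Each such factor is injective on the joint generalized eigenspace \<open>G\<close>.\<close>
  have inj: "v = 0" if v: "v \<in> G" and xc: "c \<noteq> \<kappa> x" "T x v - c \<star> v = 0" for v x c
  proof -
    have pow: "((\<lambda>w. T x w - \<kappa> x \<star> w) ^^ N) v = (c - \<kappa> x) ^ N \<star> v" for N
    proof (induction N)
      case (Suc N)
      have "((\<lambda>w. T x w - \<kappa> x \<star> w) ^^ Suc N) v = (c - \<kappa> x) ^ N \<star> (T x v) - (\<kappa> x * (c - \<kappa> x) ^ N) \<star> v"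
        using Suc by (simp add: lin_scale[OF lin])
      also have "T x v = c \<star> v" using xc(2) by simp
      finally have "((\<lambda>w. T x w - \<kappa> x \<star> w) ^^ Suc N) v = ((c - \<kappa> x) ^ N * c - \<kappa> x * (c - \<kappa> x) ^ N) \<star> v"
        by (simp only: scale_scale scale_left_diff_distrib)
      also have "(c - \<kappa> x) ^ N * c - \<kappa> x * (c - \<kappa> x) ^ N = (c - \<kappa> x) ^ Suc N"
        by (simp add: left_diff_distrib mult.commute)
      finally show ?case .
    qed simp
    obtain N where "((\<lambda>w. T x w - \<kappa> x \<star> w) ^^ N) v = 0" using v by (auto simp: G_def)
    then show ?thesis using pow[of N] xc(1) by simp
  qed
  have injP: "v = 0" if "ok cs" "?P cs v = 0" "v \<in> G" for cs v
    using that
  proof (induction cs)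
    case (Cons a cs)
    then have "?P cs v = 0"
      by (intro inj[OF G_P[OF Cons.prems(3)], of "snd a" "fst a"]) (auto simp: ok_def split: prod.splits)
    then show ?case using Cons by (auto simp: ok_def)
  qed simp
  have "y \<in> G" using gen by (simp add: G_def)
  with kill[OF y] injP show ?thesis by blast
qed

inductive_set generated :: "('v \<Rightarrow> 'v) set \<Rightarrow> 'v set \<Rightarrow> 'v set" for F B where
  gen_zero: "0 \<in> generated F B"
| gen_base: "b \<in> B \<Longrightarrow> b \<in> generated F B"
| gen_add: "x \<in> generated F B \<Longrightarrow> y \<in> generated F B \<Longrightarrow> x + y \<in> generated F B"
| gen_scale: "x \<in> generated F B \<Longrightarrow> c \<star> x \<in> generated F B"
| gen_app: "f \<in> F \<Longrightarrow> x \<in> generated F B \<Longrightarrow> f x \<in> generated F B"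

lemma subspace_generated: "subspace (generated F B)"
  by (intro subspaceI gen_zero gen_add gen_scale)

lemma generated_stable:
  assumes "lin T" and "\<And>b. b \<in> B \<Longrightarrow> T b \<in> generated F B"
    and "\<And>f x. f \<in> F \<Longrightarrow> x \<in> generated F B \<Longrightarrow> T x \<in> generated F B \<Longrightarrow> T (f x) \<in> generated F B"
    and "x \<in> generated F B"
  shows "T x \<in> generated F B"
  using assms(4)
  by (induction rule: generated.induct)
    (auto simp: lin_zero[OF assms(1)] lin_add[OF assms(1)] lin_scale[OF assms(1)] intro: generated.intros assms(2,3))

end

locale fd_complex_vector_space = complex_vector_space scl + finite_dimensional_vector_space scl Basis
  for scl :: "complex \<Rightarrow> 'v::ab_group_add \<Rightarrow> 'v" (infixr "\<star>" 75) and Basis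
begin

lemma iterates_dependent_finite_dim: "iterates_dependent T u"
proof -
  obtain c where "\<exists>l\<le>card Basis. c l \<noteq> 0" "(\<Sum>l\<le>card Basis. c l \<star> (T ^^ l) u) = 0"
    by (rule dependent_family[OF finite_Basis, of "card Basis" "\<lambda>l. (T ^^ l) u"]) (auto simp: span_Basis)
  then show ?thesis unfolding iterates_dependent_def by blast
qed

text \<open>In a nonzero invariant subspace of minimal dimension every operator of a commuting family
  is a scalar, because its eigenspaces there are invariant.\<close>

lemma joint_eigenvector:
  assumes lin: "\<And>T. T \<in> \<T> \<Longrightarrow> lin T" and comm: "\<And>S T x. S \<in> \<T> \<Longrightarrow> T \<in> \<T> \<Longrightarrow> S (T x) = T (S x)"
    and U: "subspace U" "\<And>T x. T \<in> \<T> \<Longrightarrow> x \<in> U \<Longrightarrow> T x \<in> U" "U \<noteq> {0}"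
  shows "\<exists>w\<in>U. w \<noteq> 0 \<and> (\<forall>T\<in>\<T>. \<exists>a. T w = a \<star> w)"
proof -
  define good where "good = (\<lambda>W. subspace W \<and> W \<subseteq> U \<and> (\<forall>T\<in>\<T>. \<forall>x\<in>W. T x \<in> W) \<and> W \<noteq> {0})"
  have "good U" using U by (auto simp: good_def)
  then obtain W where W: "good W" "\<And>W'. good W' \<Longrightarrow> dim W \<le> dim W'"
    using ex_has_least_nat[of good U dim] by blast
  have sW: "subspace W" "W \<subseteq> U" "W \<noteq> {0}" and inv: "\<And>T x. T \<in> \<T> \<Longrightarrow> x \<in> W \<Longrightarrow> T x \<in> W"
    using W(1) by (auto simp: good_def)
  have "\<exists>u\<in>W. u \<noteq> 0" using sW subspace_0 by blast
  then obtain u where u: "u \<in> W" "u \<noteq> 0" by blast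
  have "\<exists>a. \<forall>w\<in>W. T w = a \<star> w" if T: "T \<in> \<T>" for T
  proof -
    obtain a w where w: "w \<in> W" "w \<noteq> 0" "T w = a \<star> w"
      using eigenvector_of_dependent_iterates[OF lin[OF T] sW(1) inv[OF T] u iterates_dependent_finite_dim] by blast
    define W' where "W' = {x \<in> W. T x = a \<star> x}"
    have "subspace W'" unfolding W'_def using sW(1)
      by (intro subspaceI) (auto simp: subspace_0 subspace_add subspace_scale lin_zero[OF lin[OF T]]
          lin_add[OF lin[OF T]] lin_scale[OF lin[OF T]] scale_right_distrib mult.commute)
    moreover have "W' \<subseteq> U" using sW(2) by (auto simp: W'_def)
    moreover have "S x \<in> W'" if "S \<in> \<T>" "x \<in> W'" for S x
      using that inv comm[OF T] lin_scale[OF lin] by (auto simp: W'_def)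
    moreover have "W' \<noteq> {0}" using w by (auto simp: W'_def)
    ultimately have "good W'" unfolding good_def by blast
    then have "dim W \<le> dim W'" by (rule W(2))
    moreover have "W' \<subseteq> W" by (auto simp: W'_def)
    ultimately have "W' = W" using subspace_dim_equal[OF \<open>subspace W'\<close> sW(1)] by blast
    then show ?thesis by (auto simp: W'_def)
  qed
  then show ?thesis using u sW(2) by blast
qed

end

section \<open>Functions on a lattice and their shifts\<close>

interpretation fun_space: complex_vector_space "\<lambda>c (f :: 'x \<Rightarrow> complex) x. c * f x"
  by unfold_locales (auto simp: fun_eq_iff algebra_simps)

lemma fun_sum_apply: "(\<Sum>i\<in>A. f i) x = (\<Sum>i\<in>A. f i x :: 'a::comm_monoid_add)"
  by (induction A rule: infinite_finite_induct) auto

definition shift :: "nat \<Rightarrow> ((nat \<Rightarrow> int) \<Rightarrow> complex) \<Rightarrow> (nat \<Rightarrow> int) \<Rightarrow> complex" where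
  "shift t f n = f (n(t := n t + 1))"

lemma shift_funpow: "(shift t ^^ l) f n = f (n(t := n t + int l))"
  by (induction l arbitrary: n) (simp_all add: shift_def algebra_simps)

lemma shift_eigenfunction_power:
  assumes "shift t g = (\<lambda>n. a * g n)"
  shows "g (n(t := n t + int l)) = a ^ l * g n"
proof -
  have "(shift t ^^ l) g = (\<lambda>n. a ^ l * g n)"
  proof (induction l)
    case (Suc l)
    have "shift t (\<lambda>n. a ^ l * g n) = (\<lambda>n. a ^ l * shift t g n)"
      by (rule ext) (simp add: shift_def)
    then show ?case using Suc by (simp add: assms)
  qed simp
  then show ?thesis using shift_funpow[of l t g n] by simp
qed

lemma shift_eigenfunction_powi:
  assumes "shift t g = (\<lambda>n. a * g n)" "a \<noteq> 0"
  shows "g (n(t := n t + m)) = a powi m * g n"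
proof (cases "m \<ge> 0")
  case True
  then show ?thesis using shift_eigenfunction_power[OF assms(1), of n "nat m"] by (simp add: power_int_def)
next
  case False
  from False shift_eigenfunction_power[OF assms(1), of "n(t := n t + m)" "nat (- m)"]
  have "g n = a ^ nat (- m) * g (n(t := n t + m))" by simp
  then show ?thesis using False assms(2) by (simp add: power_int_def field_simps)
qed

text \<open>The space of functions satisfying all the relations of \<open>f\<close> is stable under the shifts. It contains a
  joint eigenfunction of the first \<open>k\<close> shifts, and on an eigenfunction the relations become relations between the
  eigenvalues. The eigenvalues are not zero because the shifts are injective.\<close>

lemma shift_relation_eigenvalues:
  fixes f :: "(nat \<Rightarrow> int) \<Rightarrow> complex" and C :: "'r \<Rightarrow> nat \<Rightarrow> complex" and e :: "'r \<Rightarrow> int"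
  assumes f: "f n0 \<noteq> 0"
    and rel: "\<And>r n. (\<Sum>t<k. C r t * f (n(t := n t + e r))) = d r * f n"
    and dep: "\<And>t. t < k \<Longrightarrow> \<exists>N c. (\<exists>l\<le>N. c l \<noteq> 0) \<and> (\<forall>n. (\<Sum>l\<le>N. c l * f (n(t := n t + int l))) = 0)"
  shows "\<exists>a. (\<forall>t<k. a t \<noteq> 0) \<and> (\<forall>r. (\<Sum>t<k. C r t * a t powi e r) = d r)"
proof -
  obtain N and c :: "nat \<Rightarrow> nat \<Rightarrow> complex" where
    c: "\<And>t. t < k \<Longrightarrow> \<exists>l\<le>N t. c t l \<noteq> 0"
       "\<And>t n. t < k \<Longrightarrow> (\<Sum>l\<le>N t. c t l * f (n(t := n t + int l))) = 0"
    using dep by metis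
  define S where "S = {g. (\<forall>r n. (\<Sum>t<k. C r t * g (n(t := n t + e r))) = d r * g n) \<and>
     (\<forall>t n. t < k \<longrightarrow> (\<Sum>l\<le>N t. c t l * g (n(t := n t + int l))) = 0)}"
  have subS: "fun_space.subspace S"
    unfolding S_def
    by (intro fun_space.subspaceI) (auto simp: algebra_simps sum.distrib sum_distrib_left[symmetric])
  have lin: "fun_space.lin (shift t)" for t
    by (auto simp: fun_space.lin_def shift_def fun_eq_iff)
  have comm: "shift s (shift t g) = shift t (shift s g)" for s t g
    by (cases "s = t") (auto simp: shift_def fun_eq_iff fun_upd_twist)
  have shS: "shift t g \<in> S" if "g \<in> S" for t g
  proof -
    have eq: "shift t g (n(s := n s + m)) = g ((n(t := n t + 1))(s := (n(t := n t + 1)) s + m))" for n s m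
      by (cases "s = t") (auto simp: shift_def fun_upd_twist algebra_simps)
    have eq0: "shift t g n = g (n(t := n t + 1))" for n by (simp add: shift_def)
    show ?thesis using that unfolding S_def mem_Collect_eq eq by (simp only: eq0) blast
  qed
  have depS: "fun_space.iterates_dependent (shift t) g" if "t < k" "g \<in> S" for t g
    unfolding fun_space.iterates_dependent_def
    by (rule exI[of _ "N t"], rule exI[of _ "c t"])
      (use that c(1)[OF that(1)] in \<open>auto simp: S_def fun_eq_iff fun_sum_apply shift_funpow\<close>)
  have "f \<in> S" using rel c(2) by (simp add: S_def)
  moreover have "f \<noteq> 0" using f by auto
  ultimately obtain g where g: "g \<in> S" "g \<noteq> 0" "\<And>t. t < k \<Longrightarrow> \<exists>a. shift t g = (\<lambda>n. a * g n)"
    using fun_space.joint_eigenvector_finitely_many[of k shift S f] lin comm subS shS depS by blast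
  obtain a where a: "\<And>t. t < k \<Longrightarrow> shift t g = (\<lambda>n. a t * g n)" using g(3) by metis
  obtain n where n: "g n \<noteq> 0" using g(2) by (auto simp: fun_eq_iff)
  have a0: "a t \<noteq> 0" if "t < k" for t
  proof
    assume "a t = 0"
    then have "shift t g (n(t := n t - 1)) = 0" using a[OF that] by simp
    then show False using n by (simp add: shift_def)
  qed
  have "(\<Sum>t<k. C r t * a t powi e r) = d r" for r
  proof -
    have "d r * g n = (\<Sum>t<k. C r t * g (n(t := n t + e r)))" using g(1) by (simp add: S_def)
    also have "\<dots> = (\<Sum>t<k. C r t * (a t powi e r * g n))"
      by (intro sum.cong refl arg_cong2[where f = "(*)"] shift_eigenfunction_powi) (use a a0 in auto)
    also have "\<dots> = (\<Sum>t<k. C r t * a t powi e r) * g n" by (simp add: sum_distrib_right mult.assoc)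
    finally show ?thesis using n by simp
  qed
  then show ?thesis using a0 by blast
qed

section \<open>Logarithmic derivatives of power series, and power sums of monomials\<close>

text \<open>With a nonzero constant term required, \<open>f\<close> determines \<open>g\<close>, and \<open>g\<close> determines
  \<open>f\<close> up to a constant. The passage to \<open>g\<close> turns the products in the definition of the
  l-weights into sums.\<close>

definition log_derivative :: "complex fps \<Rightarrow> complex fps \<Rightarrow> bool" where
  "log_derivative f g \<longleftrightarrow> fps_nth f 0 \<noteq> 0 \<and> fps_deriv f = g * f"

lemma log_derivative_mult:
  "log_derivative f g \<Longrightarrow> log_derivative f' g' \<Longrightarrow> log_derivative (f * f') (g + g')"
  by (simp add: log_derivative_def algebra_simps)

lemma log_derivative_const: "c \<noteq> 0 \<Longrightarrow> log_derivative (fps_const c) 0"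
  by (simp add: log_derivative_def)

lemma log_derivative_1: "log_derivative 1 0"
  by (simp add: log_derivative_def)

lemma log_derivative_divide:
  assumes "log_derivative f g" "log_derivative f' g'"
  shows "log_derivative (f / f') (g - g')"
proof -
  have f': "fps_nth f' 0 \<noteq> 0" using assms(2) by (simp add: log_derivative_def)
  have inv: "inverse f' * f' = 1" using f' by (rule inverse_mult_eq_1)
  have "fps_deriv (inverse f') = - (g' * inverse f')"
    using assms(2) inv unfolding log_derivative_def
    by (simp add: fps_inverse_deriv f' power2_eq_square) (metis mult.assoc mult.commute mult.right_neutral)
  then have "log_derivative (inverse f') (- g')" using f' by (simp add: log_derivative_def)
  from log_derivative_mult[OF assms(1) this] show ?thesis by (simp add: fps_divide_unit f')
qed

lemma log_derivative_prod_mset: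
  "(\<And>x. x \<in># A \<Longrightarrow> log_derivative (f x) (g x)) \<Longrightarrow> log_derivative (\<Prod>x\<in>#A. f x) (\<Sum>x\<in>#A. g x)"
  by (induction A) (auto intro: log_derivative_mult log_derivative_1)

lemma log_derivative_determines:
  assumes "log_derivative f g" "log_derivative f' g" "fps_nth f 0 = fps_nth f' 0"
  shows "f = f'"
proof -
  have f': "fps_nth f' 0 \<noteq> 0" using assms(2) by (simp add: log_derivative_def)
  from log_derivative_divide[OF assms(1,2)] have "fps_deriv (f / f') = 0"
    by (simp add: log_derivative_def)
  then have "f / f' = fps_const (fps_nth (f / f') 0)" by (simp add: fps_deriv_eq_0_iff)
  also have "fps_nth (f / f') 0 = 1" using assms(3) f' by (simp add: fps_divide_unit)
  finally have "f * inverse f' = 1" by (simp add: fps_divide_unit f')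
  then have "f * (inverse f' * f') = f'" by (simp add: mult.assoc[symmetric])
  then show ?thesis using inverse_mult_eq_1[OF f'] by simp
qed

lemma log_derivative_unique:
  assumes "log_derivative f g" "log_derivative f g'" shows "g = g'"
proof -
  have "g * f = g' * f" "f \<noteq> 0" using assms by (auto simp: log_derivative_def)
  then show ?thesis by simp
qed

lemma log_derivative_exp:
  assumes "fps_nth F 0 = 0"
  shows "log_derivative (Abs_fps (\<lambda>n. \<Sum>k\<le>n. 1 / fact k * fps_nth (F ^ k) n)) (fps_deriv F)"
proof -
  have eq: "Abs_fps (\<lambda>n. \<Sum>k\<le>n. 1 / fact k * fps_nth (F ^ k) n) = fps_exp 1 oo F"
    by (simp add: fps_compose_def atLeast0AtMost)
  have "fps_deriv (fps_exp 1 oo F) = fps_deriv F * (fps_exp 1 oo F)"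
    using fps_compose_deriv[OF assms, of "fps_exp 1"] by (simp add: mult.commute)
  then show ?thesis unfolding eq by (simp add: log_derivative_def)
qed

text \<open>The expansions at zero and at infinity of a quotient both come from a multiplicative map on polynomials.\<close>

fun poly_at :: "pm \<Rightarrow> complex poly \<Rightarrow> complex fps" where
  "poly_at pPlus P = fps_of_poly P"
| "poly_at pMinus P = fps_of_poly (reflect_poly P)"

lemma expand_poly_at: "expand s N D = poly_at s N / poly_at s D"
  by (cases s) simp_all

lemma poly_at_mult: "poly_at s (P * Q) = poly_at s P * poly_at s Q"
  by (cases s) (simp_all add: fps_of_poly_mult reflect_poly_mult)

lemma poly_at_1: "poly_at s 1 = 1"
  by (cases s) simp_all

lemma poly_at_prod_mset: "poly_at s (\<Prod>x\<in>#A. P x) = (\<Prod>x\<in>#A. poly_at s (P x))"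
  by (induction A) (simp_all add: poly_at_1 poly_at_mult)

lemma poly_at_linear_nth_0:
  "c \<noteq> 0 \<Longrightarrow> fps_nth (poly_at s [:1, - c:]) 0 = (case s of pPlus \<Rightarrow> 1 | pMinus \<Rightarrow> - c)"
  by (cases s) (simp_all)

text \<open>The geometric series \<open>- c / (1 - c u)\<close>, expanded at zero or, for \<open>pMinus\<close>, in the inverse variable. In
  both cases the coefficients are powers of \<open>c\<close> with exponents of sign \<open>s\<close>, which is why the two
  signs can be treated together below.\<close>

lemma log_derivative_linear:
  assumes c: "c \<noteq> 0"
  shows "log_derivative (poly_at s [:1, - c:]) (Abs_fps (\<lambda>n. - (c powi (sgn_pm s * int (Suc n)))))"
proof (cases s)
  case pPlus
  have "fps_deriv (fps_of_poly [:1, - c:]) = Abs_fps (\<lambda>n. - (c ^ Suc n)) * (1 + fps_const (- c) * fps_X)"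
  proof (rule fps_ext)
    fix n
    show "fps_nth (fps_deriv (fps_of_poly [:1, - c:])) n
        = fps_nth (Abs_fps (\<lambda>n. - (c ^ Suc n)) * (1 + fps_const (- c) * fps_X)) n"
    proof (cases n)
      case 0
      then show ?thesis by (simp add: fps_mult_nth)
    next
      case (Suc m)
      have "fps_nth (Abs_fps (\<lambda>n. - (c ^ Suc n)) * (1 + fps_const (- c) * fps_X)) n = - (c ^ Suc n) - c * (- (c ^ Suc m))"
        unfolding Suc distrib_left
        by (simp only: mult.left_commute[of _ "fps_const (- c)"] fps_add_nth) simp
      then show ?thesis by (simp add: Suc coeff_pCons)
    qed
  qed
  moreover have "fps_of_poly [:1, - c:] = 1 + fps_const (- c) * fps_X" by (rule fps_of_poly_linear')
  ultimately have "log_derivative (fps_of_poly [:1, - c:]) (Abs_fps (\<lambda>n. - (c ^ Suc n)))"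
    unfolding log_derivative_def by (simp only: fps_of_poly_nth) simp
  moreover have "c powi (1 + int n) = c ^ Suc n" for n
    using power_int_of_nat[of c "Suc n"] by simp
  ultimately show ?thesis using pPlus by simp
next
  case pMinus
  have refl: "reflect_poly [:1, - c:] = [:- c, 1:]" using c by (simp add: reflect_poly_pCons cCons_def)
  have "fps_deriv (fps_of_poly [:- c, 1:]) = Abs_fps (\<lambda>n. - (inverse c ^ Suc n)) * (fps_X + fps_const (- c))"
  proof (rule fps_ext)
    fix n
    show "fps_nth (fps_deriv (fps_of_poly [:- c, 1:])) n
        = fps_nth (Abs_fps (\<lambda>n. - (inverse c ^ Suc n)) * (fps_X + fps_const (- c))) n"
      using c by (cases n) (simp_all add: distrib_left coeff_pCons)
  qed
  moreover have "fps_of_poly [:- c, 1:] = fps_X + fps_const (- c)" by (rule fps_of_poly_linear)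
  ultimately have "log_derivative (fps_of_poly [:- c, 1:]) (Abs_fps (\<lambda>n. - (inverse c ^ Suc n)))"
    unfolding log_derivative_def using c by (simp only: fps_of_poly_nth) simp
  moreover have "c powi (- 1 - int n) = inverse c ^ Suc n" for n
  proof -
    have "c powi (- 1 - int n) = c powi (- int (Suc n))" by simp
    then show ?thesis by (simp only: power_int_minus power_int_of_nat power_inverse)
  qed
  ultimately show ?thesis using pMinus refl by simp
qed

lemma poly_of_roots_add_mset: "poly_of_roots (add_mset x a) = [:1, - x:] * poly_of_roots a"
  by (simp only: poly_of_roots_def image_mset_add_mset prod_mset.add_mset)

lemma poly_of_roots_empty: "poly_of_roots {#} = 1"
  by (simp add: poly_of_roots_def)

lemma rescale_poly_of_roots: "rescale (poly_of_roots a) z = (\<Prod>x\<in>#a. [:1, - (x * z):])"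
proof (induction a)
  case empty
  then show ?case by (simp add: poly_of_roots_empty rescale_def pcompose_1)
next
  case (add x a)
  have "rescale (poly_of_roots (add_mset x a)) z = [:1, - (x * z):] * rescale (poly_of_roots a) z"
    unfolding poly_of_roots_add_mset rescale_def pcompose_mult by (simp add: pcompose_pCons)
  then show ?case by (simp only: add image_mset_add_mset prod_mset.add_mset)
qed

lemma poly_of_roots_nonzero: "poly_of_roots a \<noteq> 0"
  by (induction a) (simp_all add: poly_of_roots_empty poly_of_roots_add_mset del: mult_pCons_left)

lemma degree_poly_of_roots: "0 \<notin># a \<Longrightarrow> degree (poly_of_roots a) = size a"
proof (induction a)
  case (add x a)
  then show ?case
    by (simp add: poly_of_roots_add_mset degree_mult_eq poly_of_roots_nonzero del: mult_pCons_left)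
qed (simp add: poly_of_roots_empty)

text \<open>Every additive invariant of monomials used below is of this form; power sums and degrees are
  special cases.\<close>

definition weighted_sum :: "('i \<times> complex \<Rightarrow> 'a::comm_ring_1) \<Rightarrow> 'i y_monomial \<Rightarrow> 'a" where
  "weighted_sum w m = (\<Sum>k\<in>Poly_Mapping.keys m. of_int (Poly_Mapping.lookup m k) * w k)"

lemma weighted_sum_superset:
  "finite K \<Longrightarrow> Poly_Mapping.keys m \<subseteq> K \<Longrightarrow> weighted_sum w m = (\<Sum>k\<in>K. of_int (Poly_Mapping.lookup m k) * w k)"
  unfolding weighted_sum_def by (rule sum.mono_neutral_left) (auto simp: in_keys_iff)

lemma weighted_sum_diff: "weighted_sum w (m - m') = weighted_sum w m - weighted_sum w m'"
proof -
  let ?K = "Poly_Mapping.keys m \<union> Poly_Mapping.keys m' \<union> Poly_Mapping.keys (m - m')"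
  have K: "finite ?K" "Poly_Mapping.keys m \<subseteq> ?K" "Poly_Mapping.keys m' \<subseteq> ?K" "Poly_Mapping.keys (m - m') \<subseteq> ?K"
    by auto
  show ?thesis
    unfolding weighted_sum_superset[OF K(1,2)] weighted_sum_superset[OF K(1,3)] weighted_sum_superset[OF K(1,4)]
    by (simp add: lookup_minus left_diff_distrib sum_subtractf)
qed

lemma weighted_sum_0 [simp]: "weighted_sum w 0 = 0"
  by (simp add: weighted_sum_def)

lemma weighted_sum_minus: "weighted_sum w (- m) = - weighted_sum w m"
  using weighted_sum_diff[of w 0 m] by simp

lemma weighted_sum_add: "weighted_sum w (m + m') = weighted_sum w m + weighted_sum w m'"
  using weighted_sum_diff[of w m "- m'"] by (simp add: weighted_sum_minus)

lemma weighted_sum_sum: "weighted_sum w (\<Sum>x\<in>A. f x) = (\<Sum>x\<in>A. weighted_sum w (f x))"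
  by (induction A rule: infinite_finite_induct) (simp_all add: weighted_sum_add)

lemma weighted_sum_sum_mset: "weighted_sum w (\<Sum>x\<in>#A. f x) = (\<Sum>x\<in>#A. weighted_sum w (f x))"
  by (induction A) (simp_all add: weighted_sum_add)

lemma weighted_sum_Y_var [simp]: "weighted_sum w (Y_var i a) = w (i, a)"
  by (simp add: weighted_sum_def Y_var_def)

definition power_sum :: "'i \<Rightarrow> int \<Rightarrow> 'i y_monomial \<Rightarrow> complex" where
  "power_sum j n = weighted_sum (\<lambda>(i, x). if i = j then x powi n else 0)"

definition y_degree :: "'i \<Rightarrow> 'i y_monomial \<Rightarrow> int" where
  "y_degree j = weighted_sum (\<lambda>(i, x). if i = j then 1 else 0)"

lemma power_sum_Y_product: "power_sum j n (Y_product a) = (\<Sum>x\<in>#a j. x powi n)"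
proof -
  have "power_sum j n (Y_product a) = (\<Sum>i\<in>UNIV. if i = j then (\<Sum>x\<in>#a i. x powi n) else 0)"
    unfolding power_sum_def Y_product_def weighted_sum_sum weighted_sum_sum_mset
    by (rule sum.cong) auto
  then show ?thesis by simp
qed

lemma y_degree_Y_product: "y_degree j (Y_product a) = int (size (a j))"
proof -
  have "y_degree j (Y_product a) = (\<Sum>i\<in>UNIV. if i = j then int (size (a i)) else 0)"
    unfolding y_degree_def Y_product_def weighted_sum_sum weighted_sum_sum_mset
    by (rule sum.cong) auto
  then show ?thesis by simp
qed

text \<open>The type of monomials also has the variables \<open>Y_var i 0\<close>; they are excluded here. The difference
  form is the one in which \<open>l_weight_monomial\<close> presents a monomial.\<close>

definition proper_monomial :: "'i::finite y_monomial \<Rightarrow> bool" where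
  "proper_monomial m \<longleftrightarrow> (\<exists>a b. (\<forall>i. 0 \<notin># a i \<and> 0 \<notin># b i) \<and> m = Y_product a - Y_product b)"

lemma Y_product_add: "Y_product (\<lambda>i. a i + b i) = Y_product a + Y_product b"
  by (simp add: Y_product_def sum.distrib)

lemma proper_monomial_0: "proper_monomial 0"
  unfolding proper_monomial_def
  by (intro exI[of _ "\<lambda>_. {#}"]) (simp add: Y_product_def)

lemma proper_monomial_diff:
  assumes "proper_monomial m" "proper_monomial m'" shows "proper_monomial (m - m')"
proof -
  obtain a b a' b' where *: "\<forall>i. 0 \<notin># a i \<and> 0 \<notin># b i" "m = Y_product a - Y_product b"
     "\<forall>i. 0 \<notin># a' i \<and> 0 \<notin># b' i" "m' = Y_product a' - Y_product b'"
    using assms unfolding proper_monomial_def by blast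
  show ?thesis unfolding proper_monomial_def
    by (intro exI[of _ "\<lambda>i. a i + b' i"] exI[of _ "\<lambda>i. b i + a' i"])
      (use * in \<open>auto simp: Y_product_add algebra_simps\<close>)
qed

lemma proper_monomial_add: "proper_monomial m \<Longrightarrow> proper_monomial m' \<Longrightarrow> proper_monomial (m + m')"
  using proper_monomial_diff[of m "0 - m'"] proper_monomial_diff[OF proper_monomial_0, of m'] by simp

lemma proper_monomial_sum: "(\<And>x. x \<in> A \<Longrightarrow> proper_monomial (f x)) \<Longrightarrow> proper_monomial (\<Sum>x\<in>A. f x)"
  by (induction A rule: infinite_finite_induct) (auto intro: proper_monomial_0 proper_monomial_add)

lemma proper_monomial_Y_product: "(\<And>i. 0 \<notin># a i) \<Longrightarrow> proper_monomial (Y_product a)"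
  unfolding proper_monomial_def
  by (intro exI[of _ a] exI[of _ "\<lambda>_. {#}"]) (simp add: Y_product_def)

lemma proper_monomial_Y_var: "x \<noteq> 0 \<Longrightarrow> proper_monomial (Y_var i x)"
proof -
  assume "x \<noteq> 0"
  moreover have "Y_product (\<lambda>j. if j = i then {#x#} else {#}) = Y_var i x"
  proof -
    have "Y_product (\<lambda>j. if j = i then {#x#} else {#}) = (\<Sum>j\<in>UNIV. if j = i then Y_var i x else 0)"
      unfolding Y_product_def by (rule sum.cong) auto
    then show ?thesis by simp
  qed
  ultimately show ?thesis using proper_monomial_Y_product[of "\<lambda>j. if j = i then {#x#} else {#}"] by auto
qed

lemma proper_monomial_keys:
  assumes "proper_monomial m" "Poly_Mapping.lookup m (j, x) \<noteq> 0" shows "x \<noteq> 0"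
proof
  assume x: "x = 0"
  have Y0: "Poly_Mapping.lookup (Y_product a) (j, 0) = 0" if "\<forall>i. 0 \<notin># a i" for a :: "'a \<Rightarrow> complex multiset"
  proof -
    have "Poly_Mapping.lookup (\<Sum>y\<in>#b. Y_var i y) (j, 0) = 0" if "0 \<notin># b" for b and i :: 'a
      using that by (induction b) (auto simp: lookup_add Y_var_def lookup_single)
    then have "Poly_Mapping.lookup (\<Sum>i\<in>A. \<Sum>y\<in>#a i. Y_var i y) (j, 0) = 0" for A
      by (induction A rule: infinite_finite_induct) (auto simp: lookup_add that)
    then show ?thesis by (simp add: Y_product_def)
  qed
  obtain a b where "\<forall>i. 0 \<notin># a i \<and> 0 \<notin># b i" "m = Y_product a - Y_product b"
    using assms(1) unfolding proper_monomial_def by blast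
  then have "Poly_Mapping.lookup m (j, x) = 0" using Y0[of a] Y0[of b] x by (simp add: lookup_minus)
  then show False using assms(2) by simp
qed

text \<open>A finitely supported function on the nonzero numbers is determined by its power sums of positive
  order: test it on polynomials without constant term.\<close>

lemma monomial_eqI_power_sums:
  assumes m: "proper_monomial m" and m': "proper_monomial m'"
    and eq: "\<And>j n. power_sum j (int (Suc n)) m = power_sum j (int (Suc n)) m'"
  shows "m = m'"
proof (rule poly_mapping_eqI)
  fix k :: "'a \<times> complex"
  define d where "d = m - m'"
  obtain j x where k: "k = (j, x)" by (cases k)
  have d: "proper_monomial d" unfolding d_def by (intro proper_monomial_diff m m')
  have ps: "power_sum j (int (Suc n)) d = 0" for n
    using eq[of j n] unfolding d_def power_sum_def weighted_sum_diff by simp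
  have "Poly_Mapping.lookup d (j, x) = 0"
  proof (rule ccontr)
    assume nz: "Poly_Mapping.lookup d (j, x) \<noteq> 0"
    have x: "x \<noteq> 0" by (rule proper_monomial_keys[OF d nz])
    define K where "K = {y. Poly_Mapping.lookup d (j, y) \<noteq> 0}"
    have "finite (snd ` Poly_Mapping.keys d)" by simp
    moreover have "K \<subseteq> snd ` Poly_Mapping.keys d" by (force simp: K_def in_keys_iff)
    ultimately have fK: "finite K" by (rule finite_subset[rotated])
    have psK: "power_sum j n d = (\<Sum>y\<in>K. of_int (Poly_Mapping.lookup d (j, y)) * y powi n)" for n
    proof -
      have "power_sum j n d = (\<Sum>k\<in>Pair j ` K. of_int (Poly_Mapping.lookup d k) * snd k powi n)"
        unfolding power_sum_def weighted_sum_def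
        by (rule sum.mono_neutral_cong) (auto simp: K_def in_keys_iff fK[unfolded K_def] split: prod.splits)
      also have "\<dots> = (\<Sum>y\<in>K. of_int (Poly_Mapping.lookup d (j, y)) * y powi n)"
        by (subst sum.reindex) (auto simp: inj_on_def)
      finally show ?thesis .
    qed
    have test: "(\<Sum>y\<in>K. of_int (Poly_Mapping.lookup d (j, y)) * (y * poly p y)) = 0" for p
    proof -
      have "(\<Sum>y\<in>K. of_int (Poly_Mapping.lookup d (j, y)) * (y * poly p y))
          = (\<Sum>y\<in>K. \<Sum>i\<le>degree p. coeff p i * (of_int (Poly_Mapping.lookup d (j, y)) * y ^ Suc i))"
        by (rule sum.cong) (auto simp: poly_altdef sum_distrib_left algebra_simps)
      also have "\<dots> = (\<Sum>i\<le>degree p. coeff p i * power_sum j (int (Suc i)) d)"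
        by (subst sum.swap) (simp only: psK power_int_of_nat sum_distrib_left)
      also have "\<dots> = 0" by (simp only: ps) simp
      finally show ?thesis .
    qed
  \<comment> \<open>  The polynomial \<open>u p(u)\<close> has no constant term and vanishes on \<open>K\<close> except at \<open>x\<close>.\<close>
    define p where "p = (\<Prod>y\<in>K - {x}. [:- y, 1:])"
    have "poly p y = 0" if "y \<in> K - {x}" for y
      unfolding p_def poly_prod using fK that by (auto simp: prod_zero_iff)
    then have "(\<Sum>y\<in>K. of_int (Poly_Mapping.lookup d (j, y)) * (y * poly p y))
        = (\<Sum>y\<in>K. if y = x then of_int (Poly_Mapping.lookup d (j, x)) * (x * poly p x) else 0)"
      by (intro sum.cong) auto
    also have "\<dots> = of_int (Poly_Mapping.lookup d (j, x)) * (x * poly p x)"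
      using fK nz by (simp add: K_def)
    finally have "of_int (Poly_Mapping.lookup d (j, x)) * (x * poly p x) = 0" using test[of p] by simp
    moreover have "poly p x \<noteq> 0" unfolding p_def poly_prod using fK by (auto simp: prod_zero_iff)
    ultimately show False using nz x by simp
  qed
  then show "Poly_Mapping.lookup m k = Poly_Mapping.lookup m' k" by (simp add: d_def k lookup_minus)
qed

section \<open>The series attached to a monomial\<close>

lemma fps_nth_sum_mset: "fps_nth (\<Sum>x\<in>#A. f x) n = (\<Sum>x\<in>#A. fps_nth (f x) n)"
  by (induction A) simp_all

lemma sum_mset_negf: "(\<Sum>x\<in>#A. - f x) = - (\<Sum>x\<in>#A. f x :: 'a::ab_group_add)"
  by (induction A) simp_all

lemma fps_nth_prod_mset_0: "fps_nth (\<Prod>x\<in>#A. f x) 0 = (\<Prod>x\<in>#A. fps_nth (f x :: complex fps) 0)"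
  by (induction A) simp_all

lemma log_derivative_rescaled_roots:
  assumes a: "0 \<notin># a" and w: "w \<noteq> 0"
  shows "log_derivative (poly_at s (rescale (poly_of_roots a) w))
    (Abs_fps (\<lambda>n. - (w powi (sgn_pm s * int (Suc n)) * (\<Sum>x\<in>#a. x powi (sgn_pm s * int (Suc n))))))"
proof -
  have "log_derivative (poly_at s (rescale (poly_of_roots a) w))
    (\<Sum>x\<in>#a. Abs_fps (\<lambda>n. - ((x * w) powi (sgn_pm s * int (Suc n)))))"
    unfolding rescale_poly_of_roots poly_at_prod_mset
    by (intro log_derivative_prod_mset log_derivative_linear) (use a w in auto)
  also have "(\<Sum>x\<in>#a. Abs_fps (\<lambda>n. - ((x * w) powi (sgn_pm s * int (Suc n)))))
    = Abs_fps (\<lambda>n. - (w powi (sgn_pm s * int (Suc n)) * (\<Sum>x\<in>#a. x powi (sgn_pm s * int (Suc n)))))"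
    by (rule fps_ext) (simp add: fps_nth_sum_mset power_int_mult_distrib sum_mset_distrib_left sum_mset_negf mult.commute)
  finally show ?thesis .
qed

lemma rescaled_roots_nth_0:
  assumes a: "0 \<notin># a" and w: "w \<noteq> 0"
  shows "fps_nth (poly_at s (rescale (poly_of_roots a) w)) 0
    = (case s of pPlus \<Rightarrow> 1 | pMinus \<Rightarrow> w ^ size a * (\<Prod>x\<in>#a. - x))"
proof -
  have "fps_nth (poly_at s (rescale (poly_of_roots a) w)) 0
      = (\<Prod>x\<in>#a. case s of pPlus \<Rightarrow> 1 | pMinus \<Rightarrow> - (x * w))"
    unfolding rescale_poly_of_roots poly_at_prod_mset fps_nth_prod_mset_0
    by (intro arg_cong[where f = prod_mset] image_mset_cong poly_at_linear_nth_0) (use a w in auto)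
  also have "\<dots> = (case s of pPlus \<Rightarrow> 1 | pMinus \<Rightarrow> w ^ size a * (\<Prod>x\<in>#a. - x))"
    by (cases s; induction a) (auto simp: mult_ac)
  finally show ?thesis .
qed

locale quantum_root_data = root_data \<Phi> \<alpha>
  for \<Phi> :: "'e::euclidean_space set" and \<alpha> :: "'i::finite \<Rightarrow> 'e" +
  fixes q :: complex
  assumes q_nonzero: "q \<noteq> 0" and norm_q: "norm q < 1"
begin

abbreviation d :: "'i \<Rightarrow> int" where "d j \<equiv> half_norm \<alpha> j"
abbreviation B :: "'i \<Rightarrow> 'i \<Rightarrow> int" where "B j i \<equiv> sym_cartan \<alpha> j i"

text \<open>As \<open>0 < |q| < 1\<close>, \<open>q\<close> is not a root of unity.\<close>

lemma q_powi_eq_iff: "q powi m = q powi n \<longleftrightarrow> m = n"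
proof
  have less: "q powi m \<noteq> q powi n" if "m < n" for m n
  proof
    assume "q powi m = q powi n"
    then have "norm q powi m = norm q powi n" by (metis norm_power_int)
    moreover have "norm q powi n = norm q powi m * norm q ^ nat (n - m)"
      using q_nonzero that by (simp add: power_int_add[symmetric] flip: power_int_of_nat)
    ultimately have "norm q ^ nat (n - m) = 1" using q_nonzero by simp
    moreover have "norm q ^ nat (n - m) < 1" using norm_q that by (intro power_less_one_iff[THEN iffD2]) auto
    ultimately show False by simp
  qed
  assume "q powi m = q powi n"
  then show "m = n" using less[of m n] less[of n m] by (metis linorder_neqE)
qed simp

lemma q_i_powi: "q_i \<alpha> q j powi n = q powi (d j * n)"
  by (simp add: q_i_def power_int_mult)

lemma q_i_nonzero: "q_i \<alpha> q j \<noteq> 0"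
  using q_nonzero by (simp add: q_i_def)

lemma q_i_diff_nonzero: "n \<noteq> 0 \<Longrightarrow> q powi (d j * n) - q powi (- (d j * n)) \<noteq> 0"
  using half_norm_ge_1[of j] by (simp add: q_powi_eq_iff)

text \<open>The l-weight of a monomial, described by data that are additive in the monomial.\<close>

definition monomial_series :: "(pm \<Rightarrow> 'i \<Rightarrow> complex fps) \<Rightarrow> 'i y_monomial \<Rightarrow> bool" where
  "monomial_series \<gamma> m \<longleftrightarrow> (\<forall>s j. fps_nth (\<gamma> s j) 0 = q powi (sgn_pm s * (d j * y_degree j m)) \<and>
     log_derivative (\<gamma> s j) (Abs_fps (\<lambda>n.
       (q powi (d j * (sgn_pm s * int (Suc n))) - q powi (- (d j * (sgn_pm s * int (Suc n)))))
       * power_sum j (sgn_pm s * int (Suc n)) m)))"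

text \<open>For \<open>pMinus\<close> the constant term comes from the leading coefficients: each variable contributes
  the ratio of the leading coefficients of numerator and denominator, which inverts the
  power of \<open>q\<close> in front.\<close>

lemma Gamma_monomial_series:
  assumes a: "\<And>i. 0 \<notin># a i" and b: "\<And>i. 0 \<notin># b i"
  shows "monomial_series (Gamma_series \<alpha> q (\<lambda>i. poly_of_roots (a i)) (\<lambda>i. poly_of_roots (b i)))
    (Y_product a - Y_product b)"
  unfolding monomial_series_def
proof (intro allI conjI)
  fix s j
  define z where "z = q_i \<alpha> q j"
  have z: "z \<noteq> 0" using q_i_nonzero by (simp add: z_def)
  let ?R = "\<lambda>a w. poly_at s (rescale (poly_of_roots (a j)) w)"
  let ?G = "Gamma_series \<alpha> q (\<lambda>i. poly_of_roots (a i)) (\<lambda>i. poly_of_roots (b i)) s j"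
  have G: "?G = fps_const (z powi (int (size (a j)) - int (size (b j)))) *
      ((?R a (inverse z) * ?R b z) / (?R a z * ?R b (inverse z)))"
    unfolding Gamma_series_def z_def[symmetric] expand_poly_at poly_at_mult
      degree_poly_of_roots[OF a] degree_poly_of_roots[OF b] ..
  let ?e = "\<lambda>n. sgn_pm s * int (Suc n)"
  let ?S = "\<lambda>a w. Abs_fps (\<lambda>n. - (w powi ?e n * (\<Sum>x\<in>#a j. x powi ?e n)))"
  have ld: "log_derivative ?G (0 + ((?S a (inverse z) + ?S b z) - (?S a z + ?S b (inverse z))))"
    unfolding G using z a b
    by (intro log_derivative_mult log_derivative_divide log_derivative_rescaled_roots log_derivative_const) auto
  have zi: "inverse z powi n = q powi (- (d j * n))" "z powi n = q powi (d j * n)" for n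
    by (simp_all add: z_def power_int_inverse q_i_powi power_int_minus)
  have "0 + ((?S a (inverse z) + ?S b z) - (?S a z + ?S b (inverse z)))
      = Abs_fps (\<lambda>n. (q powi (d j * ?e n) - q powi (- (d j * ?e n))) * power_sum j (?e n) (Y_product a - Y_product b))"
  proof (rule fps_ext)
    fix n
    have "power_sum j (?e n) (Y_product a - Y_product b) = (\<Sum>x\<in>#a j. x powi ?e n) - (\<Sum>x\<in>#b j. x powi ?e n)"
      unfolding power_sum_Y_product[symmetric] by (simp only: power_sum_def weighted_sum_diff)
    then show "fps_nth (0 + ((?S a (inverse z) + ?S b z) - (?S a z + ?S b (inverse z)))) n
      = fps_nth (Abs_fps (\<lambda>n. (q powi (d j * ?e n) - q powi (- (d j * ?e n))) * power_sum j (?e n) (Y_product a - Y_product b))) n"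
      by (simp only: fps_add_nth fps_sub_nth fps_nth_Abs_fps fps_zero_nth zi) (simp add: algebra_simps)
  qed
  with ld show "log_derivative ?G (Abs_fps (\<lambda>n. (q powi (d j * ?e n) - q powi (- (d j * ?e n)))
      * power_sum j (?e n) (Y_product a - Y_product b)))" by simp
  have deg: "y_degree j (Y_product a - Y_product b) = int (size (a j)) - int (size (b j))"
    unfolding y_degree_Y_product[symmetric] by (simp only: y_degree_def weighted_sum_diff)
  have prods: "(\<Prod>x\<in>#a j. - x) \<noteq> 0" "(\<Prod>x\<in>#b j. - x) \<noteq> 0"
    using a[of j] b[of j] by auto
  have nz: "fps_nth (?R a z * ?R b (inverse z)) 0 \<noteq> 0"
    using z unfolding fps_mult_nth_0
    by (subst (1 2) rescaled_roots_nth_0) (use a b prods in \<open>auto split: pm.splits\<close>)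
  have "fps_nth ?G 0 = z powi (int (size (a j)) - int (size (b j))) *
      (fps_nth (?R a (inverse z)) 0 * fps_nth (?R b z) 0 / (fps_nth (?R a z) 0 * fps_nth (?R b (inverse z)) 0))"
    unfolding G fps_divide_unit[OF nz] using z by (simp add: divide_inverse)
  also have "\<dots> = z powi (sgn_pm s * (int (size (a j)) - int (size (b j))))"
    unfolding rescaled_roots_nth_0[OF a z] rescaled_roots_nth_0[OF b z]
      rescaled_roots_nth_0[OF a nonzero_imp_inverse_nonzero[OF z]] rescaled_roots_nth_0[OF b nonzero_imp_inverse_nonzero[OF z]]
    using z prods by (cases s) (simp_all add: field_simps power_int_diff power_int_minus)
  finally show "fps_nth ?G 0 = q powi (sgn_pm s * (d j * y_degree j (Y_product a - Y_product b)))"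
    unfolding deg z_def q_i_powi by (simp only: mult.left_commute)
qed

lemma monomial_series_determines_series:
  assumes "monomial_series \<gamma> m" "monomial_series \<gamma>' m" shows "\<gamma> = \<gamma>'"
proof (intro ext)
  fix s j
  show "\<gamma> s j = \<gamma>' s j"
    using assms unfolding monomial_series_def by (intro log_derivative_determines) auto
qed

text \<open>The logarithmic derivative gives all power sums of positive order, because their factors do not vanish.\<close>

lemma monomial_series_determines_monomial:
  assumes "monomial_series \<gamma> m" "monomial_series \<gamma> m'" "proper_monomial m" "proper_monomial m'"
  shows "m = m'"
proof (rule monomial_eqI_power_sums[OF assms(3,4)])
  fix j n
  have "Abs_fps (\<lambda>n. (q powi (d j * (1 * int (Suc n))) - q powi (- (d j * (1 * int (Suc n))))) * power_sum j (1 * int (Suc n)) m)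
      = Abs_fps (\<lambda>n. (q powi (d j * (1 * int (Suc n))) - q powi (- (d j * (1 * int (Suc n))))) * power_sum j (1 * int (Suc n)) m')"
    using assms(1,2)[unfolded monomial_series_def, rule_format, of pPlus j]
    by (intro log_derivative_unique[of "\<gamma> pPlus j"]) simp_all
  then have "(q powi (d j * int (Suc n)) - q powi (- (d j * int (Suc n)))) * power_sum j (int (Suc n)) m
     = (q powi (d j * int (Suc n)) - q powi (- (d j * int (Suc n)))) * power_sum j (int (Suc n)) m'"
    by (simp only: mult_1 fps_eq_iff fps_nth_Abs_fps)
  then show "power_sum j (int (Suc n)) m = power_sum j (int (Suc n)) m'"
    by (rule mult_left_cancel[OF q_i_diff_nonzero, THEN iffD1, rotated]) simp
qed

lemma l_weight_monomial_iff: "l_weight_monomial \<alpha> q \<gamma> m \<longleftrightarrow> proper_monomial m \<and> monomial_series \<gamma> m"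
proof
  assume "l_weight_monomial \<alpha> q \<gamma> m"
  then show "proper_monomial m \<and> monomial_series \<gamma> m"
    unfolding l_weight_monomial_def proper_monomial_def using Gamma_monomial_series by blast
next
  assume m: "proper_monomial m \<and> monomial_series \<gamma> m"
  then obtain a b where ab: "\<forall>i. 0 \<notin># a i \<and> 0 \<notin># b i" "m = Y_product a - Y_product b"
    unfolding proper_monomial_def by blast
  then have "\<gamma> = Gamma_series \<alpha> q (\<lambda>i. poly_of_roots (a i)) (\<lambda>i. poly_of_roots (b i))"
    using m Gamma_monomial_series[of a b] by (intro monomial_series_determines_series[of _ m]) auto
  then show "l_weight_monomial \<alpha> q \<gamma> m" unfolding l_weight_monomial_def using ab by blast
qed

lemma proper_A_mon: "c \<noteq> 0 \<Longrightarrow> proper_monomial (A_mon \<alpha> q i c)"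
  unfolding A_mon_def using q_nonzero q_i_nonzero[of i]
  by (intro proper_monomial_diff proper_monomial_add proper_monomial_sum proper_monomial_Y_var) auto

lemma weighted_sum_A_mon:
  "weighted_sum (\<lambda>(k, x). if k = j then h x else 0) (A_mon \<alpha> q i c) =
     (if i = j then h (c * q_i \<alpha> q i) + h (c * inverse (q_i \<alpha> q i)) else 0)
     - (if cartan \<alpha> j i = -1 then h c else 0)
     - (if cartan \<alpha> j i = -2 then h (c * q) + h (c * inverse q) else 0)
     - (if cartan \<alpha> j i = -3 then h (c * q^2) + h c + h (c * inverse (q^2)) else 0)"
proof -
  have s: "(\<Sum>k | P k. if k = j then x else 0) = (if P j then x else 0)" for P x
    by simp
  have s2: "(\<Sum>k | P k. (if k = j then x else 0) + (if k = j then y else 0)) = (if P j then x + y else 0)" for P x y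
    by (simp add: sum.distrib)
  have s3: "(\<Sum>k | P k. (if k = j then x else 0) + (if k = j then y else 0) + (if k = j then z else 0))
      = (if P j then x + y + z else 0)" for P x y z
    by (simp add: sum.distrib)
  show ?thesis
    unfolding A_mon_def weighted_sum_diff weighted_sum_add weighted_sum_sum weighted_sum_Y_var prod.case s s2 s3
    by simp
qed

text \<open>The monomial \<open>A_mon \<alpha> q i c\<close> has the weight of the simple root \<open>\<alpha> i\<close>.\<close>

lemma y_degree_A_mon: "d j * y_degree j (A_mon \<alpha> q i c) = B j i"
proof (cases "i = j")
  case True
  then show ?thesis
    unfolding y_degree_def weighted_sum_A_mon by (simp add: cartan_diag sym_cartan_eq_half_norm_cartan)
next
  case False
  show ?thesis
    by (rule cartan_offdiag_cases[OF False])
      (use False in \<open>simp_all add: y_degree_def weighted_sum_A_mon sym_cartan_eq_half_norm_cartan\<close>)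
qed

text \<open>Up to the factor \<open>1/e\<close> and normalization, the right-hand side is the coefficient of the relation
  between \<open>h\<close> and \<open>x\<close>. If the Cartan integer is -2 or -3, then \<open>d j = 1\<close>, and the
  variables \<open>Y_var j\<close> in \<open>A_mon\<close> form a string that makes the sum telescope.\<close>

lemma power_sum_A_mon:
  assumes c: "c \<noteq> 0"
  shows "(q powi (d j * e) - q powi (- (d j * e))) * power_sum j e (A_mon \<alpha> q i c)
    = c powi e * (q powi (e * B j i) - q powi (- (e * B j i)))"
proof -
  have qe: "(c * q powi k) powi e = c powi e * q powi (k * e)" for k
    by (simp add: power_int_mult_distrib power_int_mult)
  have neg: "inverse (q powi k) = q powi (- k)" for k by (simp add: power_int_minus)
  have q1: "q = q powi 1" "q ^ 2 = q powi 2" by simp_all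
  have ps: "power_sum j e (A_mon \<alpha> q i c) =
     (if i = j then c powi e * (q powi (d i * e) + q powi (- (d i * e))) else 0)
     - (if cartan \<alpha> j i = -1 then c powi e else 0)
     - (if cartan \<alpha> j i = -2 then c powi e * (q powi e + q powi (- e)) else 0)
     - (if cartan \<alpha> j i = -3 then c powi e * (q powi (2 * e) + 1 + q powi (- (2 * e))) else 0)"
  proof -
    have "(c * q) powi e = c powi e * q powi e" "(c * inverse q) powi e = c powi e * q powi (- e)"
      "(c * q^2) powi e = c powi e * q powi (2 * e)" "(c * inverse (q^2)) powi e = c powi e * q powi (- (2 * e))"
      using qe[of 1] qe[of "-1"] qe[of 2] qe[of "-2"] by (simp_all add: power_int_minus)
    moreover have "(c * q_i \<alpha> q i) powi e = c powi e * q powi (d i * e)"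
      "(c * inverse (q_i \<alpha> q i)) powi e = c powi e * q powi (- (d i * e))"
      using qe[of "d i"] qe[of "- d i"] by (simp_all add: q_i_def power_int_minus)
    ultimately show ?thesis
      unfolding power_sum_def weighted_sum_A_mon by (simp only: distrib_left mult_1_right)
  qed
  have X: "q powi (m + n) = q powi m * q powi n" for m n using q_nonzero by (simp add: power_int_add)
  show ?thesis
  proof (cases "i = j")
    case True
    have "(q powi (d j * e) - q powi (- (d j * e))) * (q powi (d j * e) + q powi (- (d j * e)))
       = q powi (d j * e + d j * e) - q powi (- (d j * e) + - (d j * e))"
      unfolding X by (simp add: algebra_simps)
    moreover have "B j i = 2 * d j" unfolding True by (simp add: cartan_diag sym_cartan_eq_half_norm_cartan)
    then have "e * B j i = d j * e + d j * e" "- (e * B j i) = - (d j * e) + - (d j * e)" by simp_all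
    moreover have "power_sum j e (A_mon \<alpha> q i c) = c powi e * (q powi (d j * e) + q powi (- (d j * e)))"
      unfolding ps using True by (simp add: cartan_diag)
    ultimately show ?thesis by (simp only: mult.left_commute[of _ "c powi e"])
  next
    case False
    show ?thesis
    proof (rule cartan_offdiag_cases[OF False])
      assume "cartan \<alpha> j i = -1"
      then show ?thesis using False unfolding ps by (simp add: sym_cartan_eq_half_norm_cartan algebra_simps)
    next
      assume *: "cartan \<alpha> j i = -2" "d j = 1"
      have "(q powi e - q powi (- e)) * (q powi e + q powi (- e)) = q powi (e + e) - q powi (- e + - e)"
        unfolding X by (simp add: algebra_simps)
      moreover have "power_sum j e (A_mon \<alpha> q i c) = c powi e * - (q powi e + q powi (- e))"
        unfolding ps using False * by (simp add: algebra_simps)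
      moreover have "e * B j i = - e + - e" "- (e * B j i) = e + e" "d j * e = e"
        using * by (simp_all add: sym_cartan_eq_half_norm_cartan)
      ultimately show ?thesis
        by (simp only: mult.left_commute[of _ "c powi e"] mult_minus_right minus_diff_eq) (simp only: right_diff_distrib minus_diff_eq)
    next
      assume *: "cartan \<alpha> j i = -3" "d j = 1"
      have "(q powi e - q powi (- e)) * (q powi (2 * e) + 1 + q powi (- (2 * e)))
         = (q powi e - q powi (- e)) * (q powi (e + e) + q powi (e + - e) + q powi (- e + - e))" by simp
      also have "\<dots> = q powi (e + e + e) - q powi (- e + - e + - e)"
        unfolding X by (simp add: algebra_simps)
      finally have "(q powi e - q powi (- e)) * (q powi (2 * e) + 1 + q powi (- (2 * e))) = q powi (e + e + e) - q powi (- e + - e + - e)" .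
      moreover have "power_sum j e (A_mon \<alpha> q i c) = c powi e * - (q powi (2 * e) + 1 + q powi (- (2 * e)))"
        unfolding ps using False * by (simp add: algebra_simps)
      moreover have "e * B j i = - e + - e + - e" "- (e * B j i) = e + e + e" "d j * e = e"
        using * by (simp_all add: sym_cartan_eq_half_norm_cartan)
      ultimately show ?thesis
        by (simp only: mult.left_commute[of _ "c powi e"] mult_minus_right minus_diff_eq) (simp only: right_diff_distrib minus_diff_eq)
    qed (use False in \<open>simp add: ps sym_cartan_eq_half_norm_cartan\<close>)
  qed
qed

end

section \<open>Modules over the quantum affine algebra\<close>

lemma free_alg_induct [case_names zero add scal gen]:
  assumes zero: "P (0 :: 'g free_alg)" and add: "\<And>a b. P a \<Longrightarrow> P b \<Longrightarrow> P (a + b)"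
    and scal: "\<And>z. P (scal z)" and gen: "\<And>g a. P a \<Longrightarrow> P (gen g * a)"
  shows "P a"
proof -
  have "P (Poly_Mapping.single w z)" for w z
  proof -
    have "P (Poly_Mapping.single (Word gs) z)" for gs
    proof (induction gs)
      case Nil
      show ?case using scal[of z] by (simp add: scal_def zero_free_word_def)
    next
      case (Cons g gs)
      have "Poly_Mapping.single (Word (g # gs)) z = gen g * Poly_Mapping.single (Word gs) z"
        by (simp add: gen_def mult_single plus_free_word_def)
      then show ?case using gen[OF Cons] by simp
    qed
    then show ?thesis by (cases w) simp
  qed
  then have "P (\<Sum>w\<in>A. Poly_Mapping.single w (Poly_Mapping.lookup a w))" for A
    by (induction A rule: infinite_finite_induct) (auto intro: zero add)
  moreover have "(\<Sum>w\<in>Poly_Mapping.keys a. Poly_Mapping.single w (Poly_Mapping.lookup a w)) = a"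
    by (rule poly_mapping_eqI) (simp add: lookup_sum lookup_single when_def in_keys_iff)
  ultimately show ?thesis by metis
qed

lemma scal_1: "scal 1 = 1" and scal_0: "scal 0 = 0"
  by (simp_all add: scal_def)

text \<open>The elements \<open>phi\<close> are polynomial expressions in the \<open>KG\<close> and \<open>HG\<close>; this is
  all that is needed to transfer commutation and stability from these generators to \<open>phi\<close>.\<close>

lemma phi_closed:
  assumes add: "\<And>a b. P a \<Longrightarrow> P b \<Longrightarrow> P (a + b)" and mult: "\<And>a b. P a \<Longrightarrow> P b \<Longrightarrow> P (a * b)"
    and scal: "\<And>z. P (scal z)" and K: "\<And>s i. P (gen (KG s i))" and H: "\<And>i n. P (gen (HG i n))"
  shows "P (phi q s i n)"
proof -
  have zero: "P 0" and one: "P 1" using scal[of 0] scal[of 1] by (simp_all add: scal_0 scal_1)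
  have sum: "P (\<Sum>x\<in>A. f x)" if "\<And>x. P (f x)" for A and f :: "nat \<Rightarrow> _"
    by (induction A rule: infinite_finite_induct) (auto intro: zero add that)
  define f where "f = Abs_fps (\<lambda>m. if m = 0 then 0
        else scal (of_int (sgn_pm s) * (q - inverse q)) * gen (HG i (sgn_pm s * int m)))"
  have f: "P (fps_nth f m)" for m by (simp add: f_def zero mult scal H)
  have pow: "P (fps_nth (f ^ k) m)" for k m
  proof (induction k arbitrary: m)
    case 0 then show ?case by (simp add: zero one)
  next
    case (Suc k)
    show ?case unfolding power_Suc fps_mult_nth by (intro sum mult f Suc)
  qed
  have e: "P (fps_nth (free_fps_exp f) m)" for m
    by (simp add: free_fps_exp_def) (intro sum mult scal pow)
  have "P (fps_nth (phi_series q s i) m)" for m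
    unfolding phi_series_def f_def[symmetric] by (simp add: mult K e)
  then show ?thesis by (simp add: phi_def zero)
qed

locale quantum_module = quantum_root_data \<Phi> \<alpha> q + fd_complex_vector_space scl Basis
  for \<Phi> :: "'e::euclidean_space set" and \<alpha> :: "'i::finite \<Rightarrow> 'e" and q
    and scl :: "complex \<Rightarrow> 'v::ab_group_add \<Rightarrow> 'v" (infixr "\<star>" 75) and Basis +
  fixes act :: "'i uq_free \<Rightarrow> 'v \<Rightarrow> 'v"
  assumes uq: "uq_module \<alpha> q scl act" and c_trivial: "\<And>v. act (gen (C_half pPlus)) v = v"
begin

abbreviation X :: "pm \<Rightarrow> 'i \<Rightarrow> int \<Rightarrow> 'v \<Rightarrow> 'v" where "X s i n \<equiv> act (gen (XG s i n))"
abbreviation H :: "'i \<Rightarrow> int \<Rightarrow> 'v \<Rightarrow> 'v" where "H i n \<equiv> act (gen (HG i n))"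
abbreviation K :: "pm \<Rightarrow> 'i \<Rightarrow> 'v \<Rightarrow> 'v" where "K s i \<equiv> act (gen (KG s i))"
abbreviation \<phi> :: "pm \<Rightarrow> 'i \<Rightarrow> nat \<Rightarrow> 'v \<Rightarrow> 'v" where "\<phi> s i n \<equiv> act (phi q s i (sgn_pm s * int n))"

lemma act_lin: "lin (act a)"
proof -
  have "Vector_Spaces.linear scl scl (act a)" using uq by (simp add: uq_module_def)
  then show ?thesis by (simp add: Vector_Spaces.linear_iff lin_def)
qed

lemma act_add: "act (a + b) v = act a v + act b v"
  and act_scal: "act (scal z) v = z \<star> v"
  and act_mult: "act (a * b) v = act a (act b v)"
  using uq by (simp_all add: uq_module_def)

lemma act_rel: "uq_rel \<alpha> q a b \<Longrightarrow> act a v = act b v"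
  using uq by (simp add: uq_module_def)

lemma act_0: "act 0 v = 0"
  using act_scal[of 0 v] by (simp add: scal_0)

lemma act_1: "act 1 v = v"
  using act_scal[of 1 v] by (simp add: scal_1)

lemma act_diff: "act (a - b) v = act a v - act b v"
  using act_add[of "a - b" b v] by (simp add: algebra_simps)

lemma act_sum: "act (\<Sum>x\<in>A. f x) v = (\<Sum>x\<in>A. act (f x) v)"
  by (induction A rule: infinite_finite_induct) (simp_all add: act_0 act_add)

lemmas act_vec_simps = lin_add[OF act_lin] lin_scale[OF act_lin] lin_zero[OF act_lin]
  lin_diff[OF act_lin] lin_sum[OF act_lin] lin_neg[OF act_lin]

lemma c_half_trivial: "act (gen (C_half s)) v = v"
proof (cases s)
  case pMinus
  have "act (gen (C_half pPlus)) (act (gen (C_half pMinus)) v) = v"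
    using act_rel[OF uq_rel.c_inv1] by (simp add: act_mult act_1)
  then show ?thesis using pMinus c_trivial by simp
qed (simp add: c_trivial)

lemma c_half_pow_trivial: "act (c_half_pow n) v = v"
proof -
  have "act (gen (C_half s) ^ k) v = v" for s k
    by (induction k) (simp_all add: act_1 act_mult c_half_trivial)
  then show ?thesis by (simp add: c_half_pow_def)
qed

lemma H_0: "H i 0 v = 0"
  using act_rel[OF uq_rel.h_zero] by (simp add: act_0)

lemma H_H: "H i n (H j m v) = H j m (H i n v)"
proof (cases "n = 0 \<or> m = 0")
  case True
  then show ?thesis by (auto simp: H_0 act_vec_simps)
next
  case False
  from act_rel[OF uq_rel.h_h[of n m \<alpha> q i j], of v] False
  have "H i n (H j m v) - H j m (H i n v) = 0"
    by (simp add: act_diff act_mult act_0 act_scal c_half_pow_trivial act_vec_simps split: if_splits)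
  then show ?thesis by simp
qed

lemma K_inverse: "K pPlus i (K pMinus i v) = v" "K pMinus i (K pPlus i v) = v"
  using act_rel[OF uq_rel.k_inv1] act_rel[OF uq_rel.k_inv2] by (simp_all add: act_mult act_1)

lemma commutes_with_K:
  assumes "\<And>v. T (K pPlus i v) = K pPlus i (T v)" shows "T (K s i v) = K s i (T v)"
proof (cases s)
  case pMinus
  have "T v = K pPlus i (T (K pMinus i v))" using assms[of "K pMinus i v"] by (simp add: K_inverse)
  then have "K pMinus i (T v) = T (K pMinus i v)" by (simp add: K_inverse)
  then show ?thesis using pMinus by simp
qed (simp add: assms)

lemma H_K: "H j n (K s i v) = K s i (H j n v)"
proof (rule commutes_with_K)
  fix v
  show "H j n (K pPlus i v) = K pPlus i (H j n v)"
    using act_rel[OF uq_rel.k_h, of n i j v] by (cases "n = 0") (simp_all add: H_0 act_vec_simps act_mult)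
qed

lemma K_K: "K s i (K s' j v) = K s' j (K s i v)"
proof (rule commutes_with_K)
  fix v
  have "K pPlus j (K s i v) = K s i (K pPlus j v)" for v
    by (rule commutes_with_K) (use act_rel[OF uq_rel.k_k] in \<open>simp add: act_mult\<close>)
  then show "K s i (K pPlus j v) = K pPlus j (K s i v)" by simp
qed

text \<open>The structure constant of the relation between \<open>h\<close> and \<open>x\<close>. For \<open>e = 0\<close> division by zero makes
  it 0, in accordance with \<open>HG j 0\<close> acting as 0, so that \<open>H_X\<close> holds without restriction.\<close>

definition h_coeff :: "'i \<Rightarrow> int \<Rightarrow> 'i \<Rightarrow> complex" where
  "h_coeff j e i = 1 / of_int e * qnum q (e * B j i)"

lemma H_X: "H i n (X s j m v) = X s j m (H i n v) + (of_int (sgn_pm s) * h_coeff i n j) \<star> X s j (n + m) v"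
proof (cases "n = 0")
  case True
  then show ?thesis by (simp add: H_0 act_vec_simps h_coeff_def)
next
  case False
  from act_rel[OF uq_rel.h_x[OF False, of \<alpha> q i s j m], of v] show ?thesis
    by (simp add: act_diff act_mult act_scal c_half_pow_trivial h_coeff_def algebra_simps)
qed

lemma K_X: "K p i (X s j n v) = q powi (sgn_pm p * (sgn_pm s * B i j)) \<star> X s j n (K p i v)"
proof -
  have *: "K pPlus i (X s j n (K pMinus i v)) = q powi (sgn_pm s * B i j) \<star> X s j n v" for v
    using act_rel[OF uq_rel.k_x[of \<alpha> q i s j n], of v] by (simp add: act_mult act_scal)
  show ?thesis
  proof (cases p)
    case pPlus
    then show ?thesis using *[of "K pPlus i v"] by (simp add: K_inverse)
  next
    case pMinus
    have "X s j n (K pMinus i v) = q powi (sgn_pm s * B i j) \<star> K pMinus i (X s j n v)"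
      using arg_cong[OF *[of v], of "K pMinus i"] by (simp add: K_inverse act_vec_simps)
    then show ?thesis using pMinus q_nonzero by (simp add: power_int_minus)
  qed
qed

definition HK_stable :: "'v set \<Rightarrow> bool" where
  "HK_stable S \<longleftrightarrow> subspace S \<and> (\<forall>x\<in>S. (\<forall>i n. H i n x \<in> S) \<and> (\<forall>s i. K s i x \<in> S))"

lemma HK_stable_phi: "HK_stable S \<Longrightarrow> x \<in> S \<Longrightarrow> act (phi q s i n) x \<in> S"
proof -
  assume S: "HK_stable S" and x: "x \<in> S"
  have "\<forall>x\<in>S. act (phi q s i n) x \<in> S"
    by (rule phi_closed) (use S in \<open>auto simp: HK_stable_def act_add act_mult act_scal subspace_add subspace_scale\<close>)
  then show ?thesis using x by blast
qed

text \<open>The only form in which the relation between raising and lowering operators is used: the commutator is a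
  combination of elements \<open>phi\<close>.\<close>

lemma Xp_Xm:
  assumes "HK_stable S" "v \<in> S"
  shows "X pPlus i n (X pMinus j m v) - X pMinus j m (X pPlus i n v) \<in> S"
proof -
  have S: "subspace S" using assms(1) by (simp add: HK_stable_def)
  have "X pPlus i n (X pMinus j m v) - X pMinus j m (X pPlus i n v) =
    (if i = j then (1 / (q_i \<alpha> q i - inverse (q_i \<alpha> q i))) \<star> (act (phi q pPlus i (n + m)) v - act (phi q pMinus i (n + m)) v) else 0)"
    using act_rel[OF uq_rel.xp_xm[of \<alpha> q i n j m], of v]
    by (auto simp: act_diff act_mult act_scal c_half_pow_trivial act_0 act_vec_simps scale_right_diff_distrib)
  also have "\<dots> \<in> S"
    by (auto intro!: subspace_scale[OF S] subspace_diff[OF S] subspace_0[OF S] HK_stable_phi[OF assms])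
  finally show ?thesis .
qed

lemma commutes_with_phi:
  assumes "lin T" "\<And>i n v. T (H i n v) = H i n (T v)" "\<And>s i v. T (K s i v) = K s i (T v)"
  shows "T (act (phi q s i n) v) = act (phi q s i n) (T v)"
proof -
  have "\<forall>v. T (act (phi q s i n) v) = act (phi q s i n) (T v)"
    by (rule phi_closed) (simp_all add: act_add act_mult act_scal lin_add[OF assms(1)] lin_scale[OF assms(1)] assms(2,3))
  then show ?thesis by blast
qed

lemma H_phi: "H j m (act (phi q s i n) v) = act (phi q s i n) (H j m v)"
  by (rule commutes_with_phi[OF act_lin H_H H_K])

lemma K_phi: "K p j (act (phi q s i n) v) = act (phi q s i n) (K p j v)"
  by (rule commutes_with_phi[OF act_lin H_K[symmetric] K_K])

lemma phi_phi: "act (phi q s' j m) (act (phi q s i n) v) = act (phi q s i n) (act (phi q s' j m) v)"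
  by (rule commutes_with_phi[OF act_lin H_phi[symmetric] K_phi[symmetric]])

lemma phi_0: "\<phi> s i 0 v = K s i v"
  by (simp add: phi_def phi_series_def free_fps_exp_def act_mult act_1 scal_1)

text \<open>On a joint eigenvector of the Cartan generators the series \<open>phi\<close> acts by the exponential
  of the series of eigenvalues.\<close>

definition exp_series :: "(pm \<Rightarrow> 'i \<Rightarrow> complex) \<Rightarrow> ('i \<Rightarrow> int \<Rightarrow> complex) \<Rightarrow> pm \<Rightarrow> 'i \<Rightarrow> complex fps" where
  "exp_series \<kappa> \<eta> s i = fps_const (\<kappa> s i) * Abs_fps (\<lambda>n. \<Sum>k\<le>n. 1 / fact k * fps_nth
     (Abs_fps (\<lambda>m. if m = 0 then 0 else of_int (sgn_pm s) * (q - inverse q) * \<eta> i (sgn_pm s * int m)) ^ k) n)"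

lemma phi_eigenvalue:
  assumes H: "\<And>i n. H i n w = \<eta> i n \<star> w" and K: "\<And>s i. K s i w = \<kappa> s i \<star> w"
  shows "\<phi> s i n w = fps_nth (exp_series \<kappa> \<eta> s i) n \<star> w"
proof -
  define ev where "ev = (\<lambda>f F. \<forall>n. act (fps_nth f n) w = fps_nth F n \<star> w)"
  define f where "f = Abs_fps (\<lambda>m. if m = 0 then 0
        else scal (of_int (sgn_pm s) * (q - inverse q)) * gen (HG i (sgn_pm s * int m)))"
  define F where "F = Abs_fps (\<lambda>m. if m = 0 then 0 else of_int (sgn_pm s) * (q - inverse q) * \<eta> i (sgn_pm s * int m))"
  have mult: "ev (a * b) (A * C)" if "ev a A" "ev b C" for a b A C
    using that by (simp add: ev_def fps_mult_nth act_sum act_mult act_vec_simps scale_sum_left mult.commute)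
  have "ev f F" by (simp add: ev_def f_def F_def act_mult act_scal act_0 H)
  have pow: "ev (f ^ k) (F ^ k)" for k
  proof (induction k)
    case 0 then show ?case by (simp add: ev_def act_1 act_0)
  qed (simp add: mult \<open>ev f F\<close>)
  have "ev (free_fps_exp f) (Abs_fps (\<lambda>n. \<Sum>k\<le>n. 1 / fact k * fps_nth (F ^ k) n))"
    using pow by (simp add: ev_def free_fps_exp_def act_sum act_mult act_scal scale_sum_left)
  moreover have "ev (fps_const (gen (KG s i))) (fps_const (\<kappa> s i))" by (simp add: ev_def K act_0)
  ultimately have "ev (phi_series q s i) (exp_series \<kappa> \<eta> s i)"
    unfolding phi_series_def exp_series_def f_def[symmetric] F_def[symmetric] by (intro mult)
  moreover have "phi q s i (sgn_pm s * int n) = fps_nth (phi_series q s i) n"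
    by (cases s) (simp_all add: phi_def)
  ultimately show ?thesis by (simp add: ev_def)
qed

lemma exp_series_log_derivative:
  assumes "\<kappa> s i \<noteq> 0"
  shows "log_derivative (exp_series \<kappa> \<eta> s i) (Abs_fps (\<lambda>n. of_int (sgn_pm s * int (Suc n)) * (q - inverse q) * \<eta> i (sgn_pm s * int (Suc n))))"
    and "fps_nth (exp_series \<kappa> \<eta> s i) 0 = \<kappa> s i"
proof -
  define F where "F = Abs_fps (\<lambda>m. if m = 0 then 0 else of_int (sgn_pm s) * (q - inverse q) * \<eta> i (sgn_pm s * int m))"
  have "log_derivative (exp_series \<kappa> \<eta> s i) (0 + fps_deriv F)"
    unfolding exp_series_def F_def[symmetric]
    by (intro log_derivative_mult log_derivative_const log_derivative_exp assms) (simp add: F_def)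
  also have "0 + fps_deriv F = Abs_fps (\<lambda>n. of_int (sgn_pm s * int (Suc n)) * (q - inverse q) * \<eta> i (sgn_pm s * int (Suc n)))"
    by (rule fps_ext) (simp add: F_def)
  finally show "log_derivative (exp_series \<kappa> \<eta> s i) (Abs_fps (\<lambda>n. of_int (sgn_pm s * int (Suc n)) * (q - inverse q) * \<eta> i (sgn_pm s * int (Suc n))))" .
  show "fps_nth (exp_series \<kappa> \<eta> s i) 0 = \<kappa> s i" by (simp add: exp_series_def)
qed

lemma act_stable:
  assumes "HK_stable S" "\<And>s i n x. x \<in> S \<Longrightarrow> X s i n x \<in> S" "x \<in> S"
  shows "act a x \<in> S"
proof -
  have S: "subspace S" using assms(1) by (simp add: HK_stable_def)
  have g: "act (gen g) x \<in> S" if "x \<in> S" for g x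
    using that assms(1,2) by (cases g) (auto simp: HK_stable_def c_half_trivial)
  show ?thesis
    using assms(3)
    by (induction a rule: free_alg_induct)
      (auto simp: act_0 act_add act_scal act_mult intro: subspace_0 subspace_add subspace_scale S g)
qed

lemma joint_HK_eigenvector:
  assumes "HK_stable U" "U \<noteq> {0}"
  obtains w \<eta> \<kappa> where "w \<in> U" "w \<noteq> 0" "\<And>i n. H i n w = \<eta> i n \<star> w" "\<And>s i. K s i w = \<kappa> s i \<star> w"
proof -
  define \<T> where "\<T> = {H i n | i n. True} \<union> {K s i | s i. True}"
  have "\<exists>w\<in>U. w \<noteq> 0 \<and> (\<forall>T\<in>\<T>. \<exists>a. T w = a \<star> w)"
    by (rule joint_eigenvector)
      (use assms in \<open>auto simp: \<T>_def HK_stable_def act_lin H_H H_K K_K\<close>)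
  then obtain w where w: "w \<in> U" "w \<noteq> 0" "\<And>T. T \<in> \<T> \<Longrightarrow> \<exists>a. T w = a \<star> w" by blast
  have "\<exists>a. H i n w = a \<star> w" "\<exists>a. K s i w = a \<star> w" for s i n
    by (rule w(3), unfold \<T>_def, blast)+
  then obtain \<eta> \<kappa> where "\<And>i n. H i n w = \<eta> i n \<star> w" "\<And>s i. K s i w = \<kappa> s i \<star> w" by metis
  then show ?thesis using that w by blast
qed

end

section \<open>Generalized eigenspaces of the Cartan series and words in the raising operators\<close>

context quantum_module
begin

lemma funpow_shifted_eigen:
  assumes "lin T" "T w = a \<star> w"
  shows "((\<lambda>w. T w - c \<star> w) ^^ N) w = (a - c) ^ N \<star> w"
proof (induction N)
  case (Suc N)
  have "T ((a - c) ^ N \<star> w) - c \<star> ((a - c) ^ N \<star> w) = ((a - c) ^ N * a - c * (a - c) ^ N) \<star> w"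
    by (simp only: lin_scale[OF assms(1)] assms(2) scale_scale scale_left_diff_distrib)
  also have "(a - c) ^ N * a - c * (a - c) ^ N = (a - c) ^ Suc N" by (simp add: left_diff_distrib mult.commute)
  finally show ?case using Suc by simp
qed simp

lemma subspace_gen_eigenspace: "subspace (gen_eigenspace q scl act \<gamma>)"
proof -
  have zero: "((\<lambda>w. \<phi> s i n w - fps_nth (\<gamma> s i) n \<star> w) ^^ N) x = 0"
    if M: "((\<lambda>w. \<phi> s i n w - fps_nth (\<gamma> s i) n \<star> w) ^^ M) x = 0" and MN: "M \<le> N" for s i n N M x
  proof -
    have l: "lin ((\<lambda>w. \<phi> s i n w - fps_nth (\<gamma> s i) n \<star> w) ^^ k)" for k
      by (intro lin_funpow lin_shifted act_lin)
    obtain k where k: "N = k + M" using MN by (metis add.commute le_Suc_ex)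
    show ?thesis unfolding k funpow_add o_def M by (rule lin_zero[OF l])
  qed
  have l: "lin ((\<lambda>w. \<phi> s i n w - fps_nth (\<gamma> s i) n \<star> w) ^^ k)" for s i n k
    by (intro lin_funpow lin_shifted act_lin)
  show ?thesis
  proof (rule subspaceI)
    show "0 \<in> gen_eigenspace q scl act \<gamma>" by (auto simp: gen_eigenspace_def lin_zero[OF l])
  next
    fix x y assume x: "x \<in> gen_eigenspace q scl act \<gamma>" and y: "y \<in> gen_eigenspace q scl act \<gamma>"
    have "\<exists>N. ((\<lambda>w. \<phi> s i n w - fps_nth (\<gamma> s i) n \<star> w) ^^ N) (x + y) = 0" for s i n
    proof -
      obtain N where N: "((\<lambda>w. \<phi> s i n w - fps_nth (\<gamma> s i) n \<star> w) ^^ N) x = 0"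
        using x unfolding gen_eigenspace_def by blast
      obtain M where M: "((\<lambda>w. \<phi> s i n w - fps_nth (\<gamma> s i) n \<star> w) ^^ M) y = 0"
        using y unfolding gen_eigenspace_def by blast
      have "((\<lambda>w. \<phi> s i n w - fps_nth (\<gamma> s i) n \<star> w) ^^ max N M) (x + y) = 0"
        using zero[OF N, of "max N M"] zero[OF M, of "max N M"] by (simp add: lin_add[OF l])
      then show ?thesis by blast
    qed
    then show "x + y \<in> gen_eigenspace q scl act \<gamma>" unfolding gen_eigenspace_def by blast
  next
    fix c x assume "x \<in> gen_eigenspace q scl act \<gamma>"
    then show "c \<star> x \<in> gen_eigenspace q scl act \<gamma>"
      unfolding gen_eigenspace_def by (simp add: lin_scale[OF l])
  qed
qed

lemma gen_eigenspace_stable: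
  assumes "lin T" "\<And>s i n v. T (\<phi> s i n v) = \<phi> s i n (T v)" "x \<in> gen_eigenspace q scl act \<gamma>"
  shows "T x \<in> gen_eigenspace q scl act \<gamma>"
proof -
  have pow: "((\<lambda>w. \<phi> s i n w - fps_nth (\<gamma> s i) n \<star> w) ^^ N) (T x) = T (((\<lambda>w. \<phi> s i n w - fps_nth (\<gamma> s i) n \<star> w) ^^ N) x)" for s i n N
    by (induction N) (simp_all add: assms(2) lin_diff[OF assms(1)] lin_scale[OF assms(1)])
  show ?thesis using assms(3) lin_zero[OF assms(1)] unfolding gen_eigenspace_def mem_Collect_eq pow by metis
qed

lemma HK_stable_gen_eigenspace: "HK_stable (gen_eigenspace q scl act \<gamma>)"
  unfolding HK_stable_def
  using subspace_gen_eigenspace gen_eigenspace_stable[OF act_lin H_phi] gen_eigenspace_stable[OF act_lin K_phi]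
  by blast

lemma gen_eigenspace_eigenvector:
  assumes "w \<in> gen_eigenspace q scl act \<gamma>" "w \<noteq> 0" "\<phi> s i n w = a \<star> w"
  shows "a = fps_nth (\<gamma> s i) n"
proof -
  obtain N where "((\<lambda>w. \<phi> s i n w - fps_nth (\<gamma> s i) n \<star> w) ^^ N) w = 0"
    using assms(1) unfolding gen_eigenspace_def by blast
  then show ?thesis using assms(2) by (simp add: funpow_shifted_eigen[OF act_lin assms(3)])
qed

lemma gen_eigenspace_not_in_span:
  assumes E: "\<And>e. e \<in> E \<Longrightarrow> \<exists>s i n c. c \<noteq> fps_nth (\<gamma> s i) n \<and> \<phi> s i n e = c \<star> e"
    and y: "y \<in> gen_eigenspace q scl act \<gamma>" "y \<in> span E"
  shows "y = 0"
proof (rule joint_gen_eigenvector_not_in_span[where T = "\<lambda>(s, i, n). \<phi> s i n" and \<kappa> = "\<lambda>(s, i, n). fps_nth (\<gamma> s i) n" and E = E])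
  fix x show "lin (case x of (s, i, n) \<Rightarrow> \<phi> s i n)" by (cases x) (simp add: act_lin)
next
  fix x y v
  show "(case x of (s, i, n) \<Rightarrow> \<phi> s i n) ((case y of (s, i, n) \<Rightarrow> \<phi> s i n) v) =
       (case y of (s, i, n) \<Rightarrow> \<phi> s i n) ((case x of (s, i, n) \<Rightarrow> \<phi> s i n) v)"
    by (cases x; cases y) (simp add: phi_phi)
next
  fix e assume "e \<in> E"
  then obtain s i n c where "c \<noteq> fps_nth (\<gamma> s i) n" "\<phi> s i n e = c \<star> e" using E by blast
  then show "\<exists>x c. c \<noteq> (case x of (s, i, n) \<Rightarrow> fps_nth (\<gamma> s i) n) \<and> (case x of (s, i, n) \<Rightarrow> \<phi> s i n) e = c \<star> e"
    by (intro exI[of _ "(s, i, n)"] exI[of _ c]) simp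
next
  fix x :: "pm \<times> 'i \<times> nat"
  obtain s i n where x: "x = (s, i, n)" by (cases x)
  obtain N where "((\<lambda>w. \<phi> s i n w - fps_nth (\<gamma> s i) n \<star> w) ^^ N) y = 0"
    using y(1) unfolding gen_eigenspace_def by blast
  then show "\<exists>N. ((\<lambda>w. (case x of (s, i, n) \<Rightarrow> \<phi> s i n) w - (case x of (s, i, n) \<Rightarrow> fps_nth (\<gamma> s i) n) \<star> w) ^^ N) y = 0"
    by (intro exI[of _ N]) (simp add: x)
qed (rule y(2))

text \<open>Joint eigenvectors for distinct l-weights are linearly independent.\<close>

lemma finite_l_weights: "finite (l_weights q scl act)"
proof -
  let ?L = "l_weights q scl act"
  have "\<exists>w. w \<in> gen_eigenspace q scl act \<gamma> \<and> w \<noteq> 0 \<and> (\<forall>s i n. \<phi> s i n w = fps_nth (\<gamma> s i) n \<star> w)"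
    if g: "\<gamma> \<in> ?L" for \<gamma>
  proof -
    have "gen_eigenspace q scl act \<gamma> \<noteq> {0}" using g by (simp add: l_weights_def)
    then obtain w \<eta> \<kappa> where w: "w \<in> gen_eigenspace q scl act \<gamma>" "w \<noteq> 0"
      "\<And>i n. H i n w = \<eta> i n \<star> w" "\<And>s i. K s i w = \<kappa> s i \<star> w"
      using joint_HK_eigenvector[OF HK_stable_gen_eigenspace] by metis
    have "\<phi> s i n w = fps_nth (\<gamma> s i) n \<star> w" for s i n
      using phi_eigenvalue[of w \<eta> \<kappa> s i n, OF w(3,4)] gen_eigenspace_eigenvector[OF w(1,2)] by simp
    then show ?thesis using w(1,2) by blast
  qed
  then have "\<forall>\<gamma>\<in>?L. \<exists>w. w \<in> gen_eigenspace q scl act \<gamma> \<and> w \<noteq> 0 \<and> (\<forall>s i n. \<phi> s i n w = fps_nth (\<gamma> s i) n \<star> w)"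
    by blast
  from bchoice[OF this] obtain w where
    w': "\<forall>\<gamma>\<in>?L. w \<gamma> \<in> gen_eigenspace q scl act \<gamma> \<and> w \<gamma> \<noteq> 0 \<and> (\<forall>s i n. \<phi> s i n (w \<gamma>) = fps_nth (\<gamma> s i) n \<star> w \<gamma>)" ..
  have w: "w \<gamma> \<in> gen_eigenspace q scl act \<gamma>" "w \<gamma> \<noteq> 0" "\<phi> s i n (w \<gamma>) = fps_nth (\<gamma> s i) n \<star> w \<gamma>"
    if "\<gamma> \<in> ?L" for \<gamma> s i n using w' that by auto
  have not_span: "w \<gamma> \<notin> span (w ` (?L - {\<gamma>}))" if g: "\<gamma> \<in> ?L" for \<gamma>
  proof
    assume "w \<gamma> \<in> span (w ` (?L - {\<gamma>}))"
    moreover have "\<exists>s i n c. c \<noteq> fps_nth (\<gamma> s i) n \<and> \<phi> s i n e = c \<star> e" if e: "e \<in> w ` (?L - {\<gamma>})" for e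
    proof -
      obtain \<gamma>' where g': "\<gamma>' \<in> ?L" "\<gamma>' \<noteq> \<gamma>" "e = w \<gamma>'" using e by blast
      then obtain s i n where "fps_nth (\<gamma>' s i) n \<noteq> fps_nth (\<gamma> s i) n" by (meson ext fps_ext)
      then show ?thesis using w(3)[OF g'(1)] g'(3) by blast
    qed
    ultimately have "w \<gamma> = 0" by (intro gen_eigenspace_not_in_span[OF _ w(1)[OF g]])
    then show False using w(2)[OF g] by simp
  qed
  have inj: "inj_on w ?L"
  proof (rule inj_onI, rule ccontr)
    fix \<gamma> \<gamma>' assume g: "\<gamma> \<in> ?L" "\<gamma>' \<in> ?L" "w \<gamma> = w \<gamma>'" "\<gamma> \<noteq> \<gamma>'"
    then have "w \<gamma> \<in> span (w ` (?L - {\<gamma>}))" by (auto intro!: span_base)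
    then show False using not_span[OF g(1)] by blast
  qed
  have "independent (w ` ?L)"
  proof (rule ccontr)
    assume "\<not> independent (w ` ?L)"
    then obtain a where a: "a \<in> w ` ?L" "a \<in> span (w ` ?L - {a})" unfolding dependent_def by blast
    then obtain \<gamma> where g: "\<gamma> \<in> ?L" "a = w \<gamma>" by blast
    have "w ` ?L - {a} \<subseteq> w ` (?L - {\<gamma>})" using g by blast
    then have "w \<gamma> \<in> span (w ` (?L - {\<gamma>}))" using a(2) g(2) span_mono by blast
    then show False using not_span[OF g(1)] by blast
  qed
  then have "finite (w ` ?L)" by (rule finiteI_independent)
  then show ?thesis using inj by (rule finite_imageD)
qed

definition word :: "('i \<times> int) list \<Rightarrow> 'v \<Rightarrow> 'v" where
  "word L w = foldr (\<lambda>(i, m). X pPlus i m) L w"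

lemma word_simps [simp]: "word [] w = w" "word ((i, m) # L) w = X pPlus i m (word L w)"
  by (simp_all add: word_def)

lemma word_append: "word (L @ L') w = word L (word L' w)"
  by (simp add: word_def)

lemma word_lin: "lin (word L)"
proof (induction L)
  case Nil
  have "word [] = (\<lambda>w. w)" by (rule ext) simp
  then show ?case by (simp add: lin_def)
next
  case (Cons a L)
  obtain i m where "a = (i, m)" by (cases a)
  then have "word (a # L) = (\<lambda>w. X pPlus i m (word L w))" by (intro ext) simp
  then show ?case using lin_comp[OF act_lin Cons] by simp
qed

text \<open>The commutator of a Cartan generator with a letter is a multiple of the letter with a shifted mode.\<close>

lemma H_word:
  "H j e (word L w) = word L (H j e w) +
     (\<Sum>t<length L. h_coeff j e (fst (L ! t)) \<star> word (L[t := (fst (L ! t), snd (L ! t) + e)]) w)"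
proof (induction L)
  case (Cons a L)
  obtain i m where a: "a = (i, m)" by (cases a)
  have "H j e (word (a # L) w) = X pPlus i m (H j e (word L w)) + h_coeff j e i \<star> X pPlus i (m + e) (word L w)"
    by (simp add: a H_X add.commute)
  then show ?case
    unfolding Cons by (simp add: a sum.lessThan_Suc_shift act_vec_simps del: sum.lessThan_Suc)
qed simp

lemma K_word: "K p j (word L w) = q powi (sgn_pm p * (\<Sum>t<length L. B j (fst (L ! t)))) \<star> word L (K p j w)"
proof (induction L)
  case (Cons a L)
  obtain i m where a: "a = (i, m)" by (cases a)
  have "K p j (word (a # L) w) = q powi (sgn_pm p * B j i) \<star> X pPlus i m (K p j (word L w))"
    by (simp add: a K_X)
  then show ?case
    unfolding Cons using q_nonzero
    by (simp add: a sum.lessThan_Suc_shift act_vec_simps power_int_add distrib_left del: sum.lessThan_Suc)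
qed simp

text \<open>The modes of \<open>X pPlus i\<close> lie in the finite-dimensional space of endomorphisms, so finitely many of them are
  linearly dependent. The commutator with \<open>H i m\<close> multiplies the relation by a nonzero number
  and translates it by \<open>m\<close>, so that one relation holds with all translates.\<close>

lemma X_relation:
  "\<exists>N c. (\<exists>l\<le>N. c l \<noteq> 0) \<and> (\<forall>m x. (\<Sum>l\<le>N. c l \<star> X pPlus i (m + int l) x) = 0)"
proof -
  interpret ops: complex_vector_space "\<lambda>c (F :: 'v \<Rightarrow> 'v) x. c \<star> F x"
    by unfold_locales (auto simp: fun_eq_iff scale_right_distrib scale_left_distrib)
  \<comment> \<open>The maps \<open>El (b, b')\<close> are the matrix units; they span the endomorphisms.\<close>
  define El where "El = (\<lambda>(b, b') x. representation Basis x b \<star> (b' :: 'v))"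
  define T where "T = El ` (Basis \<times> Basis)"
  have fT: "finite T" unfolding T_def using finite_Basis by auto
  have fsum: "(\<Sum>a\<in>A. F a) x = (\<Sum>a\<in>A. F a x)" for A and F :: "'v \<Rightarrow> 'v \<Rightarrow> 'v" and x
    by (rule fun_sum_apply)
  have in_span: "F \<in> ops.span T" if F: "lin F" for F
  proof -
    have "F = (\<Sum>b\<in>Basis. \<Sum>b'\<in>Basis. (\<lambda>x. representation Basis (F b) b' \<star> El (b, b') x))"
    proof
      fix x
      have "x = (\<Sum>b\<in>Basis. representation Basis x b \<star> b)"
        using sum_representation_eq[OF independent_Basis _ finite_Basis subset_refl, of x] by (simp add: span_Basis)
      then have "F x = F (\<Sum>b\<in>Basis. representation Basis x b \<star> b)" by simp
      also have "\<dots> = (\<Sum>b\<in>Basis. representation Basis x b \<star> F b)" by (simp add: lin_sum[OF F] lin_scale[OF F])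
      also have "\<dots> = (\<Sum>b\<in>Basis. representation Basis x b \<star> (\<Sum>b'\<in>Basis. representation Basis (F b) b' \<star> b'))"
        using sum_representation_eq[OF independent_Basis _ finite_Basis subset_refl, of "F _"] by (simp add: span_Basis)
      also have "\<dots> = (\<Sum>b\<in>Basis. \<Sum>b'\<in>Basis. (\<lambda>x. representation Basis (F b) b' \<star> El (b, b') x)) x"
        by (simp add: fsum El_def scale_sum_right mult.commute)
      finally show "F x = (\<Sum>b\<in>Basis. \<Sum>b'\<in>Basis. (\<lambda>x. representation Basis (F b) b' \<star> El (b, b') x)) x" .
    qed
    also have "\<dots> \<in> ops.span T"
      by (intro ops.span_sum ops.span_scale ops.span_base) (auto simp: T_def)
    finally show ?thesis .
  qed
  obtain c where c: "\<exists>l\<le>card T. c l \<noteq> 0" "(\<Sum>l\<le>card T. (\<lambda>x. c l \<star> X pPlus i (int l) x)) = 0"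
    by (rule ops.dependent_family[OF fT, of "card T" "\<lambda>l. X pPlus i (int l)"]) (auto intro: in_span act_lin)
  have c0: "(\<Sum>l\<le>card T. c l \<star> X pPlus i (int l) x) = 0" for x
    using fun_cong[OF c(2), of x] by (simp add: fun_sum_apply)
  have "(\<Sum>l\<le>card T. c l \<star> X pPlus i (m + int l) x) = 0" for m x
  proof (cases "m = 0")
    case True then show ?thesis using c0 by simp
  next
    case False
    have nz: "h_coeff i m i \<noteq> 0"
    proof -
      have "m * B i i \<noteq> 0" using False half_norm_ge_1[of i] by (simp add: sym_cartan_eq_half_norm_cartan cartan_diag)
      moreover have "q - inverse q \<noteq> 0" using q_powi_eq_iff[of 1 "-1"] by (simp add: power_int_minus)
      ultimately show ?thesis using False by (simp add: h_coeff_def qnum_def q_powi_eq_iff)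
    qed
    have "0 = H i m (\<Sum>l\<le>card T. c l \<star> X pPlus i (int l) x)" by (simp only: c0 lin_zero[OF act_lin])
    also have "\<dots> = (\<Sum>l\<le>card T. c l \<star> X pPlus i (int l) (H i m x)) + (\<Sum>l\<le>card T. c l \<star> (h_coeff i m i \<star> X pPlus i (m + int l) x))"
      by (simp add: act_vec_simps H_X scale_right_distrib sum.distrib)
    also have "\<dots> = h_coeff i m i \<star> (\<Sum>l\<le>card T. c l \<star> X pPlus i (m + int l) x)"
      by (simp only: c0 add_0 scale_sum_right scale_left_commute)
    finally show ?thesis using nz by simp
  qed
  then show ?thesis using c(1) by blast
qed

end

section \<open>The highest weight vector and the Cartan eigenvalues\<close>

locale highest_weight_module = quantum_module \<Phi> \<alpha> q scl Basis act
  for \<Phi> :: "'e::euclidean_space set" and \<alpha> :: "'i::finite \<Rightarrow> 'e" and q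
    and scl :: "complex \<Rightarrow> 'v::ab_group_add \<Rightarrow> 'v" (infixr "\<star>" 75) and Basis
    and act :: "'i uq_free \<Rightarrow> 'v \<Rightarrow> 'v" +
  fixes v :: 'v and \<eta>\<^sub>0 :: "'i \<Rightarrow> int \<Rightarrow> complex" and \<kappa>\<^sub>0 :: "pm \<Rightarrow> 'i \<Rightarrow> complex"
  assumes irreducible: "irreducible_module scl act"
    and v_nonzero: "v \<noteq> 0" and X_v: "\<And>i n. X pPlus i n v = 0"
    and H_v: "\<And>i n. H i n v = \<eta>\<^sub>0 i n \<star> v" and K_v: "\<And>s i. K s i v = \<kappa>\<^sub>0 s i \<star> v"
begin

lemma stable_eq_UNIV:
  assumes "HK_stable S" "\<And>s i n x. x \<in> S \<Longrightarrow> X s i n x \<in> S" "x \<in> S" "x \<noteq> 0"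
  shows "S = UNIV"
proof -
  have "subspace S" using assms(1) by (simp add: HK_stable_def)
  moreover have "\<forall>a. \<forall>x\<in>S. act a x \<in> S" using act_stable[OF assms(1,2)] by blast
  ultimately have "S = {0} \<or> S = UNIV" using irreducible unfolding irreducible_module_def by blast
  then show ?thesis using assms(3,4) by blast
qed

definition modes :: "pm \<Rightarrow> ('v \<Rightarrow> 'v) set" where
  "modes s = {X s i n | i n. True}"

lemma generated_mode: "x \<in> generated (modes s) S \<Longrightarrow> X s i n x \<in> generated (modes s) S"
  by (rule gen_app) (auto simp: modes_def)

lemma generated_HK_stable:
  assumes H: "\<And>b j e. b \<in> S \<Longrightarrow> H j e b \<in> generated (modes s) S"
    and K: "\<And>b p j. b \<in> S \<Longrightarrow> K p j b \<in> generated (modes s) S"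
  shows "HK_stable (generated (modes s) S)"
proof -
  let ?W = "generated (modes s) S"
  have "H j e x \<in> ?W" if "x \<in> ?W" for j e x
  proof (rule generated_stable[OF act_lin H _ that])
    fix f x assume "f \<in> modes s" "x \<in> ?W" "H j e x \<in> ?W"
    moreover from this obtain i n where "f = X s i n" by (auto simp: modes_def)
    ultimately show "H j e (f x) \<in> ?W"
      by (simp only: H_X) (intro gen_add gen_scale generated_mode)
  qed
  moreover have "K p j x \<in> ?W" if "x \<in> ?W" for p j x
  proof (rule generated_stable[OF act_lin K _ that])
    fix f x assume "f \<in> modes s" "x \<in> ?W" "K p j x \<in> ?W"
    moreover from this obtain i n where "f = X s i n" by (auto simp: modes_def)
    ultimately show "K p j (f x) \<in> ?W"
      by (simp only: K_X) (intro gen_scale generated_mode)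
  qed
  ultimately show ?thesis by (simp add: HK_stable_def subspace_generated)
qed

text \<open>Triangular decomposition: commuting a raising operator past a lowering one produces only elements
  \<open>phi\<close>, so the generated subspace is stable under all generators as soon as the Cartan generators and the
  raising operators map \<open>S\<close> into it.\<close>

lemma generated_lowering_eq_UNIV:
  assumes H: "\<And>b j e. b \<in> S \<Longrightarrow> H j e b \<in> generated (modes pMinus) S"
    and K: "\<And>b p j. b \<in> S \<Longrightarrow> K p j b \<in> generated (modes pMinus) S"
    and Xp: "\<And>b i n. b \<in> S \<Longrightarrow> X pPlus i n b \<in> generated (modes pMinus) S"
    and S: "b \<in> S" "b \<noteq> 0"
  shows "generated (modes pMinus) S = UNIV"
proof (rule stable_eq_UNIV)
  let ?W = "generated (modes pMinus) S"
  show HK: "HK_stable ?W" by (rule generated_HK_stable[OF H K])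
  have "X pPlus i n x \<in> ?W" if "x \<in> ?W" for i n x
  proof (rule generated_stable[OF act_lin Xp _ that])
    fix f x assume f: "f \<in> modes pMinus" and x: "x \<in> ?W" "X pPlus i n x \<in> ?W"
    obtain j m where fj: "f = X pMinus j m" using f by (auto simp: modes_def)
    have "X pPlus i n (X pMinus j m x) - X pMinus j m (X pPlus i n x) \<in> ?W" by (rule Xp_Xm[OF HK x(1)])
    then have "(X pPlus i n (X pMinus j m x) - X pMinus j m (X pPlus i n x)) + X pMinus j m (X pPlus i n x) \<in> ?W"
      by (intro gen_add generated_mode x(2))
    then show "X pPlus i n (f x) \<in> ?W" by (simp add: fj)
  qed
  then show "X s i n x \<in> ?W" if "x \<in> ?W" for s i n x
    using that generated_mode by (cases s) auto
  show "b \<in> ?W" by (rule gen_base[OF S(1)])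
qed (rule S(2))

lemma \<kappa>\<^sub>0_nonzero: "\<kappa>\<^sub>0 s i \<noteq> 0"
proof
  assume "\<kappa>\<^sub>0 s i = 0"
  then have "K s i v = 0" by (simp add: K_v)
  then have "v = 0" using K_inverse[of i v] by (cases s) (simp_all add: act_vec_simps)
  then show False using v_nonzero by simp
qed

text \<open>The highest weight minus the weight of \<open>x\<close> is \<open>\<Sum>i. \<beta> i \<alpha> i\<close>, a nonzero sum of simple roots.\<close>

definition lower :: "'v set" where
  "lower = {x. \<exists>\<beta> :: 'i \<Rightarrow> nat. (\<exists>i. \<beta> i \<noteq> 0) \<and>
     (\<forall>p j. K p j x = (\<kappa>\<^sub>0 p j * q powi (- (sgn_pm p * (\<Sum>i\<in>UNIV. int (\<beta> i) * B j i)))) \<star> x)}"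

lemma lower_X:
  assumes x: "\<And>p j. K p j x = (\<kappa>\<^sub>0 p j * q powi (- (sgn_pm p * (\<Sum>i\<in>UNIV. int (\<beta> i) * B j i)))) \<star> x"
  shows "X pMinus i n x \<in> lower"
proof -
  define \<beta>' where "\<beta>' = \<beta>(i := Suc (\<beta> i))"
  have sum: "(\<Sum>k\<in>UNIV. int (\<beta>' k) * B j k) = (\<Sum>k\<in>UNIV. int (\<beta> k) * B j k) + B j i" for j
  proof -
    have "(\<Sum>k\<in>UNIV. int (\<beta>' k) * B j k) = (\<Sum>k\<in>UNIV. int (\<beta> k) * B j k + (if k = i then B j i else 0))"
      by (rule sum.cong) (auto simp: \<beta>'_def algebra_simps)
    then show ?thesis by (simp add: sum.distrib)
  qed
  have "K p j (X pMinus i n x) = (\<kappa>\<^sub>0 p j * q powi (- (sgn_pm p * (\<Sum>k\<in>UNIV. int (\<beta>' k) * B j k)))) \<star> X pMinus i n x" for p j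
  proof -
    have "q powi (- (sgn_pm p * (\<Sum>k\<in>UNIV. int (\<beta>' k) * B j k)))
      = q powi (sgn_pm p * (sgn_pm pMinus * B j i)) * q powi (- (sgn_pm p * (\<Sum>k\<in>UNIV. int (\<beta> k) * B j k)))"
      unfolding sum using q_nonzero by (simp add: power_int_add[symmetric] algebra_simps)
    then show ?thesis unfolding K_X x act_vec_simps scale_scale by (simp only: mult.left_commute)
  qed
  then show ?thesis unfolding lower_def by (intro CollectI exI[of _ \<beta>']) (auto simp: \<beta>'_def)
qed

lemma lower_X_v: "X pMinus i n v \<in> lower"
  by (rule lower_X[of v "\<lambda>_. 0"]) (simp add: K_v)

lemma lower_X_lower: "x \<in> lower \<Longrightarrow> X pMinus i n x \<in> lower"
  using lower_X[of x _ i n] unfolding lower_def by blast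

lemma lower_K: "x \<in> lower \<Longrightarrow> \<exists>c. K p j x = c \<star> x"
  unfolding lower_def by blast

lemma lower_H: "x \<in> lower \<Longrightarrow> H j e x \<in> lower"
  unfolding lower_def by (auto simp: H_K[symmetric] act_vec_simps)

lemma span_lower_stable:
  assumes "lin T" "\<And>x. x \<in> lower \<Longrightarrow> T x \<in> span lower" "x \<in> span lower" shows "T x \<in> span lower"
  using assms(3)
  by (induction rule: span_induct_alt)
    (auto simp: lin_zero[OF assms(1)] lin_add[OF assms(1)] lin_scale[OF assms(1)] intro: span_zero span_add span_scale assms(2))

lemma span_lower_X: "x \<in> span lower \<Longrightarrow> X pMinus i n x \<in> span lower"
  by (rule span_lower_stable[OF act_lin]) (auto intro: span_base lower_X_lower)

lemma span_lower_H: "x \<in> span lower \<Longrightarrow> H j e x \<in> span lower"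
  by (rule span_lower_stable[OF act_lin]) (auto intro: span_base lower_H)

lemma span_lower_K: "x \<in> span lower \<Longrightarrow> K p j x \<in> span lower"
  by (rule span_lower_stable[OF act_lin]) (metis lower_K span_base span_scale)

text \<open>The lowering operators applied to \<open>v\<close> generate the module, and they map \<open>v\<close> and the lower weight vectors
  to lower weight vectors.\<close>

lemma exists_highest_coefficient: "\<exists>c. x - c \<star> v \<in> span lower"
proof -
  have "generated (modes pMinus) {v} = UNIV"
    by (rule generated_lowering_eq_UNIV[of _ v])
      (auto simp: H_v K_v X_v v_nonzero intro: gen_scale[OF gen_base] gen_zero)
  then have "x \<in> generated (modes pMinus) {v}" by simp
  then show ?thesis
  proof (induction rule: generated.induct)
    case gen_zero
    show ?case by (rule exI[of _ 0]) (simp add: span_zero)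
  next
    case (gen_base b)
    then show ?case by (intro exI[of _ 1]) (simp add: span_zero)
  next
    case (gen_add x y)
    then obtain c d where "x - c \<star> v \<in> span lower" "y - d \<star> v \<in> span lower" by blast
    then have "(x - c \<star> v) + (y - d \<star> v) \<in> span lower" by (rule span_add)
    then show ?case by (intro exI[of _ "c + d"]) (simp add: scale_left_distrib algebra_simps)
  next
    case (gen_scale x a)
    then obtain c where "x - c \<star> v \<in> span lower" by blast
    then have "a \<star> (x - c \<star> v) \<in> span lower" by (rule span_scale)
    then show ?case by (intro exI[of _ "a * c"]) (simp add: scale_right_diff_distrib)
  next
    case (gen_app f x)
    then obtain i n where f: "f = X pMinus i n" by (auto simp: modes_def)
    obtain c where "x - c \<star> v \<in> span lower" using gen_app by blast
    then have "f (x - c \<star> v) \<in> span lower" unfolding f by (rule span_lower_X)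
    moreover have "c \<star> f v \<in> span lower" unfolding f by (intro span_scale span_base lower_X_v)
    ultimately have "f (x - c \<star> v) + c \<star> f v \<in> span lower" by (rule span_add)
    then show ?case by (intro exI[of _ 0]) (simp add: f act_vec_simps)
  qed
qed

abbreviation \<gamma>\<^sub>0 :: "pm \<Rightarrow> 'i \<Rightarrow> complex fps" where "\<gamma>\<^sub>0 \<equiv> exp_series \<kappa>\<^sub>0 \<eta>\<^sub>0"

lemma phi_v: "\<phi> s i n v = fps_nth (\<gamma>\<^sub>0 s i) n \<star> v"
  by (rule phi_eigenvalue[OF H_v K_v])

lemma v_in_gen_eigenspace: "v \<in> gen_eigenspace q scl act \<gamma>\<^sub>0"
  unfolding gen_eigenspace_def
proof (intro CollectI allI)
  fix s i n
  show "\<exists>N. ((\<lambda>w. \<phi> s i n w - fps_nth (\<gamma>\<^sub>0 s i) n \<star> w) ^^ N) v = 0"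
    by (rule exI[of _ 1]) (simp add: phi_v)
qed

text \<open>The constant term of \<open>phi\<close> is \<open>k\<close>, and a lower weight vector has a different eigenvalue for some
  \<open>k\<close>.\<close>

lemma gen_eigenspace_inter_lower:
  assumes "y \<in> gen_eigenspace q scl act \<gamma>\<^sub>0" "y \<in> span lower" shows "y = 0"
proof (rule gen_eigenspace_not_in_span[OF _ assms])
  fix e assume "e \<in> lower"
  then obtain \<beta> :: "'i \<Rightarrow> nat" where b: "\<exists>i. \<beta> i \<noteq> 0"
    "\<And>p j. K p j e = (\<kappa>\<^sub>0 p j * q powi (- (sgn_pm p * (\<Sum>i\<in>UNIV. int (\<beta> i) * B j i)))) \<star> e"
    unfolding lower_def by blast
  obtain j where j: "(\<Sum>i\<in>UNIV. int (\<beta> i) * B j i) \<noteq> 0"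
    using positive_combination_detected[of \<beta>] b(1) by (metis (full_types))
  have "\<kappa>\<^sub>0 pPlus j * q powi (- (sgn_pm pPlus * (\<Sum>i\<in>UNIV. int (\<beta> i) * B j i))) \<noteq> fps_nth (\<gamma>\<^sub>0 pPlus j) 0"
    using j \<kappa>\<^sub>0_nonzero[of pPlus j] q_powi_eq_iff[of "- (\<Sum>i\<in>UNIV. int (\<beta> i) * B j i)" 0]
    by (simp add: exp_series_log_derivative(2)[OF \<kappa>\<^sub>0_nonzero])
  moreover have "\<phi> pPlus j 0 e = (\<kappa>\<^sub>0 pPlus j * q powi (- (sgn_pm pPlus * (\<Sum>i\<in>UNIV. int (\<beta> i) * B j i)))) \<star> e"
    unfolding phi_0 by (rule b(2))
  ultimately show "\<exists>s i n c. c \<noteq> fps_nth (\<gamma>\<^sub>0 s i) n \<and> \<phi> s i n e = c \<star> e" by blast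
qed

lemma gen_eigenspace_highest: "gen_eigenspace q scl act \<gamma>\<^sub>0 = span {v}"
proof
  let ?G = "gen_eigenspace q scl act \<gamma>\<^sub>0"
  show "span {v} \<subseteq> ?G"
    by (rule span_minimal) (simp_all add: v_in_gen_eigenspace subspace_gen_eigenspace)
  show "?G \<subseteq> span {v}"
  proof
    fix x assume x: "x \<in> ?G"
    obtain c where c: "x - c \<star> v \<in> span lower" using exists_highest_coefficient by blast
    have "x - c \<star> v \<in> ?G"
      by (intro subspace_diff subspace_scale subspace_gen_eigenspace x v_in_gen_eigenspace)
    then have "x - c \<star> v = 0" using c by (rule gen_eigenspace_inter_lower)
    then show "x \<in> span {v}" by (simp add: span_scale span_base)
  qed
qed

lemma dim_gen_eigenspace_highest: "dim (gen_eigenspace q scl act \<gamma>\<^sub>0) = 1"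
  unfolding gen_eigenspace_highest dim_span
  using v_nonzero by (simp add: dim_eq_card_independent[of "{v}"])

text \<open>The coordinate along the highest weight vector. It is a linear form and an eigenvector
  for the transposes of the Cartan generators, with the eigenvalues of \<open>v\<close>.\<close>

definition \<xi> :: "'v \<Rightarrow> complex" where
  "\<xi> x = (SOME c. x - c \<star> v \<in> span lower)"

lemma \<xi>_mem: "x - \<xi> x \<star> v \<in> span lower"
  unfolding \<xi>_def using exists_highest_coefficient by (rule someI_ex)

lemma \<xi>_eqI:
  assumes "x - c \<star> v \<in> span lower" shows "\<xi> x = c"
proof (rule ccontr)
  assume "\<xi> x \<noteq> c"
  have "(x - c \<star> v) - (x - \<xi> x \<star> v) \<in> span lower" by (rule span_diff[OF assms \<xi>_mem])
  then have "(\<xi> x - c) \<star> v \<in> span lower" by (simp add: scale_left_diff_distrib)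
  moreover have "(\<xi> x - c) \<star> v \<in> gen_eigenspace q scl act \<gamma>\<^sub>0"
    by (intro subspace_scale subspace_gen_eigenspace v_in_gen_eigenspace)
  ultimately have "(\<xi> x - c) \<star> v = 0" by (intro gen_eigenspace_inter_lower)
  then show False using \<open>\<xi> x \<noteq> c\<close> v_nonzero by simp
qed

lemma \<xi>_add: "\<xi> (x + y) = \<xi> x + \<xi> y"
proof (rule \<xi>_eqI)
  have "(x - \<xi> x \<star> v) + (y - \<xi> y \<star> v) \<in> span lower" by (intro span_add \<xi>_mem)
  then show "x + y - (\<xi> x + \<xi> y) \<star> v \<in> span lower" by (simp add: scale_left_distrib algebra_simps)
qed

lemma \<xi>_scale: "\<xi> (c \<star> x) = c * \<xi> x"
proof (rule \<xi>_eqI)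
  have "c \<star> (x - \<xi> x \<star> v) \<in> span lower" by (intro span_scale \<xi>_mem)
  then show "c \<star> x - (c * \<xi> x) \<star> v \<in> span lower" by (simp add: scale_right_diff_distrib)
qed

lemma \<xi>_zero: "\<xi> 0 = 0"
  using \<xi>_scale[of 0 0] by simp

lemma \<xi>_sum: "\<xi> (\<Sum>a\<in>A. f a) = (\<Sum>a\<in>A. \<xi> (f a))"
  by (induction A rule: infinite_finite_induct) (simp_all add: \<xi>_zero \<xi>_add)

lemma \<xi>_H: "\<xi> (H j e x) = \<eta>\<^sub>0 j e * \<xi> x"
proof (rule \<xi>_eqI)
  have "H j e (x - \<xi> x \<star> v) \<in> span lower" by (intro span_lower_H \<xi>_mem)
  then show "H j e x - (\<eta>\<^sub>0 j e * \<xi> x) \<star> v \<in> span lower" by (simp add: act_vec_simps H_v mult.commute)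
qed

lemma \<xi>_K: "\<xi> (K p j x) = \<kappa>\<^sub>0 p j * \<xi> x"
proof (rule \<xi>_eqI)
  have "K p j (x - \<xi> x \<star> v) \<in> span lower" by (intro span_lower_K \<xi>_mem)
  then show "K p j x - (\<kappa>\<^sub>0 p j * \<xi> x) \<star> v \<in> span lower" by (simp add: act_vec_simps K_v mult.commute)
qed

text \<open>Irreducibility: from a Cartan eigenvector the raising operators lead back to the highest weight vector,
  since otherwise the eigenvector would generate a submodule inside the lower weights.\<close>

lemma exists_word_to_highest:
  assumes w: "w \<noteq> 0" "\<And>i n. H i n w = \<eta> i n \<star> w" "\<And>s i. K s i w = \<kappa> s i \<star> w"
  shows "\<exists>L. \<xi> (word L w) \<noteq> 0"
proof (rule ccontr)
  assume "\<not> ?thesis"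
  then have words: "\<xi> (word L w) = 0" for L by blast
  let ?W = "generated (modes pPlus) {w}"
  have HK: "HK_stable ?W"
    by (rule generated_HK_stable) (auto simp: w(2,3) intro: gen_scale[OF gen_base])
  have W_words: "x \<in> span (range (\<lambda>L. word L w))" if "x \<in> ?W" for x
    using that
  proof (induction rule: generated.induct)
    case (gen_base b)
    then have "b = word [] w" by simp
    then show ?case by (intro span_base) blast
  next
    case (gen_app f x)
    then obtain i n where f: "f = X pPlus i n" by (auto simp: modes_def)
    from gen_app(3) show ?case
    proof (induction rule: span_induct_alt)
      case (step c b y)
      then obtain L where "b = word L w" by blast
      then have "f b = word ((i, n) # L) w" by (simp add: f)
      then have "f b \<in> span (range (\<lambda>L. word L w))" by (intro span_base) blast
      then show ?case using step(2) by (simp add: f act_vec_simps span_add span_scale)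
    qed (simp add: f act_vec_simps span_zero)
  qed (auto intro: span_zero span_add span_scale)
  have \<xi>_W: "\<xi> x = 0" if "x \<in> ?W" for x
    using W_words[OF that] by (induction rule: span_induct_alt) (auto simp: \<xi>_zero \<xi>_add \<xi>_scale words)
  have W_lower: "x \<in> span lower" if "x \<in> ?W" for x
    using \<xi>_mem[of x] \<xi>_W[OF that] by simp
  have "generated (modes pMinus) ?W = UNIV"
  proof (rule generated_lowering_eq_UNIV)
    show "w \<in> ?W" by (simp add: gen_base)
    show "H j e b \<in> generated (modes pMinus) ?W" if "b \<in> ?W" for b j e
      by (rule gen_base) (use HK that in \<open>simp add: HK_stable_def\<close>)
    show "K p j b \<in> generated (modes pMinus) ?W" if "b \<in> ?W" for b p j
      by (rule gen_base) (use HK that in \<open>simp add: HK_stable_def\<close>)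
    show "X pPlus i n b \<in> generated (modes pMinus) ?W" if "b \<in> ?W" for b i n
      by (rule gen_base) (rule generated_mode[OF that])
  qed (rule w(1))
  then have "v \<in> generated (modes pMinus) ?W" by simp
  then have "v \<in> span lower"
    by (induction rule: generated.induct)
      (auto simp: modes_def intro: span_zero span_add span_scale span_lower_X W_lower)
  then have "v = 0" by (rule gen_eigenspace_inter_lower[OF v_in_gen_eigenspace])
  then show False using v_nonzero by simp
qed

text \<open>Fix a word that leads from \<open>w\<close> to \<open>v\<close> and vary the modes \<open>n\<close> of its letters. The coordinate
  \<open>f n\<close> along \<open>v\<close> satisfies shift relations: \<open>rel\<close> from moving \<open>H j e\<close> through the word, and
  \<open>dep\<close> from the linear dependence of the modes of each letter. The numbers \<open>a t\<close> are the
  eigenvalues of a joint eigenfunction of the shifts.\<close>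

theorem cartan_eigenvalues:
  assumes w: "w \<noteq> 0" "\<And>i n. H i n w = \<eta> i n \<star> w" "\<And>s i. K s i w = \<kappa> s i \<star> w"
  shows "\<exists>I a k. (\<forall>t<k. a t \<noteq> 0) \<and>
     (\<forall>j e. \<eta>\<^sub>0 j e = \<eta> j e + (\<Sum>t<(k::nat). h_coeff j e (I t) * a t powi e)) \<and>
     (\<forall>p j. \<kappa>\<^sub>0 p j = \<kappa> p j * q powi (sgn_pm p * (\<Sum>t<k. B j (I t))))"
proof -
  obtain L where L: "\<xi> (word L w) \<noteq> 0" using exists_word_to_highest[OF w] by blast
  define k where "k = length L"
  define I where "I = (\<lambda>t. fst (L ! t))"
  define letters where "letters = (\<lambda>n :: nat \<Rightarrow> int. map (\<lambda>t. (I t, n t)) [0..<k])"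
  define f where "f = (\<lambda>n. \<xi> (word (letters n) w))"
  have len: "length (letters n) = k" for n by (simp add: letters_def)
  have nth: "letters n ! t = (I t, n t)" if "t < k" for n t using that by (simp add: letters_def)
  have upd: "(letters n)[t := (I t, m)] = letters (n(t := m))" if "t < k" for n t m
    by (rule nth_equalityI) (auto simp: len nth nth_list_update that)
  have L_eq: "L = letters (\<lambda>t. snd (L ! t))"
    by (rule nth_equalityI) (auto simp: len nth k_def I_def)
  have f0: "f (\<lambda>t. snd (L ! t)) \<noteq> 0" using L L_eq by (simp add: f_def)
  have rel: "(\<Sum>t<k. h_coeff (fst r) (snd r) (I t) * f (n(t := n t + snd r))) = (\<eta>\<^sub>0 (fst r) (snd r) - \<eta> (fst r) (snd r)) * f n"
    for r n
  proof -
    obtain j e where r: "r = (j, e)" by (cases r)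
    have "\<eta>\<^sub>0 j e * f n = \<xi> (H j e (word (letters n) w))" by (simp add: \<xi>_H f_def)
    also have "\<dots> = \<xi> (word (letters n) (\<eta> j e \<star> w)) +
        (\<Sum>t<k. h_coeff j e (I t) * \<xi> (word ((letters n)[t := (I t, n t + e)]) w))"
      unfolding H_word len w(2) \<xi>_add \<xi>_sum \<xi>_scale by (simp add: nth)
    also have "\<dots> = \<eta> j e * f n + (\<Sum>t<k. h_coeff j e (I t) * f (n(t := n t + e)))"
      by (simp add: lin_scale[OF word_lin] \<xi>_scale f_def upd)
    finally show ?thesis by (simp add: r algebra_simps)
  qed
  have dep: "\<exists>N c. (\<exists>l\<le>N. c l \<noteq> 0) \<and> (\<forall>n. (\<Sum>l\<le>N. c l * f (n(t := n t + int l))) = 0)" if t: "t < k" for t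
  proof -
    obtain N c where c: "\<exists>l\<le>N. c l \<noteq> 0" "\<And>m x. (\<Sum>l\<le>N. c l \<star> X pPlus (I t) (m + int l) x) = 0"
      using X_relation[of "I t"] by blast
    have "(\<Sum>l\<le>N. c l * f (n(t := n t + int l))) = 0" for n
    proof -
      define L1 where "L1 = take t (letters n)"
      define L2 where "L2 = drop (Suc t) (letters n)"
      have "word (letters (n(t := m))) w = word L1 (X pPlus (I t) m (word L2 w))" for m
        unfolding upd[OF t, symmetric] using t
        by (simp add: upd_conv_take_nth_drop len word_append L1_def L2_def)
      then have "(\<Sum>l\<le>N. c l * f (n(t := n t + int l))) = \<xi> (word L1 (\<Sum>l\<le>N. c l \<star> X pPlus (I t) (n t + int l) (word L2 w)))"
        by (simp add: f_def lin_sum[OF word_lin] lin_scale[OF word_lin] \<xi>_sum \<xi>_scale)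
      also have "\<dots> = 0" by (simp only: c(2) lin_zero[OF word_lin] \<xi>_zero)
      finally show ?thesis .
    qed
    then show ?thesis using c(1) by blast
  qed
  have "\<exists>a. (\<forall>t<k. a t \<noteq> 0) \<and>
      (\<forall>r. (\<Sum>t<k. h_coeff (fst r) (snd r) (I t) * a t powi snd r) = \<eta>\<^sub>0 (fst r) (snd r) - \<eta> (fst r) (snd r))"
    by (rule shift_relation_eigenvalues[where f = f]) (rule f0, rule rel, rule dep)
  then obtain a where a: "\<forall>t<k. a t \<noteq> 0"
    "\<forall>r. (\<Sum>t<k. h_coeff (fst r) (snd r) (I t) * a t powi snd r) = \<eta>\<^sub>0 (fst r) (snd r) - \<eta> (fst r) (snd r)"
    by blast
  have "\<eta>\<^sub>0 j e = \<eta> j e + (\<Sum>t<k. h_coeff j e (I t) * a t powi e)" for j e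
    using a(2)[rule_format, of "(j, e)"] by simp
  moreover have "\<kappa>\<^sub>0 p j = \<kappa> p j * q powi (sgn_pm p * (\<Sum>t<k. B j (I t)))" for p j
  proof -
    have "\<kappa>\<^sub>0 p j * \<xi> (word L w) = \<xi> (K p j (word L w))" by (simp add: \<xi>_K)
    also have "\<dots> = q powi (sgn_pm p * (\<Sum>t<k. B j (I t))) * \<kappa> p j * \<xi> (word L w)"
      unfolding K_word w(3) k_def I_def by (simp add: \<xi>_scale lin_scale[OF word_lin] mult.assoc)
    finally show ?thesis using L by (simp add: mult.commute)
  qed
  ultimately show ?thesis using a(1) by blast
qed

end

section \<open>The \<open>q\<close>-character\<close>

context highest_weight_module
begin

text \<open>Constant terms and logarithmic derivatives are additive in the monomial, so by \<open>y_degree_A_mon\<close> and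
  \<open>power_sum_A_mon\<close> the hypotheses say that the series differ by those of the \<open>A_mon\<close>.\<close>

lemma monomial_series_below:
  assumes m: "monomial_series \<gamma>\<^sub>0 m"
    and a: "\<And>t. t < k \<Longrightarrow> a t \<noteq> 0" and \<kappa>: "\<And>p j. \<kappa> p j \<noteq> 0"
    and \<eta>_eq: "\<And>j e. \<eta>\<^sub>0 j e = \<eta> j e + (\<Sum>t<(k::nat). h_coeff j e (I t) * a t powi e)"
    and \<kappa>_eq: "\<And>p j. \<kappa>\<^sub>0 p j = \<kappa> p j * q powi (sgn_pm p * (\<Sum>t<k. B j (I t)))"
  shows "monomial_series (exp_series \<kappa> \<eta>) (m - (\<Sum>t<k. A_mon \<alpha> q (I t) (a t)))"
  unfolding monomial_series_def
proof (intro allI conjI)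
  fix s j
  let ?A = "\<Sum>t<k. A_mon \<alpha> q (I t) (a t)"
  let ?e = "\<lambda>n. sgn_pm s * int (Suc n)"
  have deg: "d j * y_degree j ?A = (\<Sum>t<k. B j (I t))"
    using y_degree_A_mon unfolding y_degree_def weighted_sum_sum by (simp add: sum_distrib_left)
  have \<gamma>0: "fps_nth (\<gamma>\<^sub>0 s j) 0 = q powi (sgn_pm s * (d j * y_degree j m))"
    "log_derivative (\<gamma>\<^sub>0 s j) (Abs_fps (\<lambda>n. (q powi (d j * ?e n) - q powi (- (d j * ?e n))) * power_sum j (?e n) m))"
    using m unfolding monomial_series_def by blast+
  have "\<kappa> s j * q powi (sgn_pm s * (\<Sum>t<k. B j (I t))) = q powi (sgn_pm s * (d j * y_degree j m))"
    using \<gamma>0(1) \<kappa>_eq[of s j] by (simp add: exp_series_log_derivative(2)[OF \<kappa>\<^sub>0_nonzero])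
  then have "\<kappa> s j = q powi (sgn_pm s * (d j * y_degree j m) - sgn_pm s * (\<Sum>t<k. B j (I t)))"
    using q_nonzero by (simp add: power_int_diff field_simps)
  moreover have "sgn_pm s * (d j * y_degree j (m - ?A)) = sgn_pm s * (d j * y_degree j m) - sgn_pm s * (\<Sum>t<k. B j (I t))"
    unfolding deg[symmetric] y_degree_def weighted_sum_diff by (simp add: right_diff_distrib)
  ultimately show "fps_nth (exp_series \<kappa> \<eta> s j) 0 = q powi (sgn_pm s * (d j * y_degree j (m - ?A)))"
    by (simp only: exp_series_log_derivative(2)[where \<kappa> = \<kappa>, OF \<kappa>])
  have q1: "q - inverse q \<noteq> 0" using q_powi_eq_iff[of 1 "-1"] by (simp add: power_int_minus)
  have "Abs_fps (\<lambda>n. of_int (?e n) * (q - inverse q) * \<eta> j (?e n)) =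
      Abs_fps (\<lambda>n. (q powi (d j * ?e n) - q powi (- (d j * ?e n))) * power_sum j (?e n) (m - ?A))"
  proof (rule fps_ext, unfold fps_nth_Abs_fps)
    fix n
    let ?r = "?e n"
    have r: "?r \<noteq> 0" by (cases s) auto
    have "Abs_fps (\<lambda>n. of_int (?e n) * (q - inverse q) * \<eta>\<^sub>0 j (?e n)) =
      Abs_fps (\<lambda>n. (q powi (d j * ?e n) - q powi (- (d j * ?e n))) * power_sum j (?e n) m)"
      by (rule log_derivative_unique[OF exp_series_log_derivative(1)[OF \<kappa>\<^sub>0_nonzero] \<gamma>0(2)])
    then have top: "of_int ?r * (q - inverse q) * \<eta>\<^sub>0 j ?r = (q powi (d j * ?r) - q powi (- (d j * ?r))) * power_sum j ?r m"
      unfolding fps_eq_iff fps_nth_Abs_fps by blast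
    have h: "of_int ?r * (q - inverse q) * (h_coeff j ?r i * c powi ?r)
        = (q powi (d j * ?r) - q powi (- (d j * ?r))) * power_sum j ?r (A_mon \<alpha> q i c)" if "c \<noteq> 0" for i c
    proof -
      have "of_int ?r * (q - inverse q) * (h_coeff j ?r i * c powi ?r)
        = c powi ?r * (q powi (?r * B j i) - q powi (- (?r * B j i)))"
        using q1 r unfolding h_coeff_def qnum_def by (simp del: of_int_mult)
      then show ?thesis by (simp only: power_sum_A_mon[OF that])
    qed
    have "of_int ?r * (q - inverse q) * \<eta> j ?r = of_int ?r * (q - inverse q) * \<eta>\<^sub>0 j ?r
        - (\<Sum>t<k. of_int ?r * (q - inverse q) * (h_coeff j ?r (I t) * a t powi ?r))"
      unfolding \<eta>_eq sum_distrib_left[symmetric] by (simp only: distrib_left add_diff_cancel_right')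
    also have "\<dots> = (q powi (d j * ?r) - q powi (- (d j * ?r))) * power_sum j ?r m
        - (\<Sum>t<k. (q powi (d j * ?r) - q powi (- (d j * ?r))) * power_sum j ?r (A_mon \<alpha> q (I t) (a t)))"
      unfolding top by (intro arg_cong2[where f = "(-)"] sum.cong refl h) (use a in auto)
    also have "\<dots> = (q powi (d j * ?r) - q powi (- (d j * ?r))) * power_sum j ?r (m - ?A)"
      unfolding sum_distrib_left[symmetric] power_sum_def weighted_sum_diff weighted_sum_sum
      by (simp only: right_diff_distrib)
    finally show "of_int ?r * (q - inverse q) * \<eta> j ?r = (q powi (d j * ?r) - q powi (- (d j * ?r))) * power_sum j ?r (m - ?A)" .
  qed
  with exp_series_log_derivative(1)[where \<kappa> = \<kappa> and \<eta> = \<eta> and s = s and i = j, OF \<kappa>]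
  show "log_derivative (exp_series \<kappa> \<eta> s j)
     (Abs_fps (\<lambda>n. (q powi (d j * ?e n) - q powi (- (d j * ?e n))) * power_sum j (?e n) (m - ?A)))" by simp
qed

lemma l_weight_below_highest:
  assumes m: "monomial_series \<gamma>\<^sub>0 m" "proper_monomial m" and \<gamma>: "\<gamma> \<in> l_weights q scl act"
  shows "\<exists>S. (\<forall>(i, c)\<in>#S. c \<noteq> 0) \<and> l_weight_monomial \<alpha> q \<gamma> (m + (\<Sum>(i, c)\<in>#S. - A_mon \<alpha> q i c))"
proof -
  have "gen_eigenspace q scl act \<gamma> \<noteq> {0}" using \<gamma> by (simp add: l_weights_def)
  then obtain w \<eta> \<kappa> where w: "w \<in> gen_eigenspace q scl act \<gamma>" "w \<noteq> 0"
    "\<And>i n. H i n w = \<eta> i n \<star> w" "\<And>s i. K s i w = \<kappa> s i \<star> w"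
    using joint_HK_eigenvector[OF HK_stable_gen_eigenspace] by metis
  have "fps_nth (exp_series \<kappa> \<eta> s i) n = fps_nth (\<gamma> s i) n" for s i n
    by (rule gen_eigenspace_eigenvector[OF w(1,2) phi_eigenvalue[of w \<eta> \<kappa> s i n, OF w(3,4)]])
  then have \<gamma>_eq: "\<gamma> = exp_series \<kappa> \<eta>" by (intro ext fps_ext) simp
  obtain I a and k :: nat where *: "\<forall>t<k. a t \<noteq> 0"
     "\<forall>j e. \<eta>\<^sub>0 j e = \<eta> j e + (\<Sum>t<k. h_coeff j e (I t) * a t powi e)"
     "\<forall>p j. \<kappa>\<^sub>0 p j = \<kappa> p j * q powi (sgn_pm p * (\<Sum>t<k. B j (I t)))"
    using cartan_eigenvalues[OF w(2-4)] by blast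
  have \<kappa>: "\<kappa> p j \<noteq> 0" for p j
  proof
    assume "\<kappa> p j = 0"
    then have "\<kappa>\<^sub>0 p j = 0" using *(3) by simp
    then show False using \<kappa>\<^sub>0_nonzero by simp
  qed
  define S where "S = image_mset (\<lambda>t. (I t, a t)) (mset_set {..<k})"
  have sum: "m + (\<Sum>(i, c)\<in>#S. - A_mon \<alpha> q i c) = m - (\<Sum>t<k. A_mon \<alpha> q (I t) (a t))"
  proof -
    have "(\<Sum>(i, c)\<in>#S. - A_mon \<alpha> q i c) = (\<Sum>t<k. - A_mon \<alpha> q (I t) (a t))"
      by (simp add: S_def image_mset.compositionality o_def sum_unfold_sum_mset)
    then show ?thesis by (simp add: sum_negf)
  qed
  have "monomial_series \<gamma> (m - (\<Sum>t<k. A_mon \<alpha> q (I t) (a t)))"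
    unfolding \<gamma>_eq using * by (intro monomial_series_below m \<kappa>) auto
  moreover have "proper_monomial (m - (\<Sum>t<k. A_mon \<alpha> q (I t) (a t)))"
    using *(1) by (intro proper_monomial_diff proper_monomial_sum m proper_A_mon) auto
  ultimately have "l_weight_monomial \<alpha> q \<gamma> (m + (\<Sum>(i, c)\<in>#S. - A_mon \<alpha> q i c))"
    unfolding sum l_weight_monomial_iff by blast
  moreover have "\<forall>(i, c)\<in>#S. c \<noteq> 0" using *(1) by (auto simp: S_def)
  ultimately show ?thesis by blast
qed

lemma THE_l_weight_monomial: "l_weight_monomial \<alpha> q \<gamma> m \<Longrightarrow> (THE m. l_weight_monomial \<alpha> q \<gamma> m) = m"
  by (rule the_equality) (auto simp: l_weight_monomial_iff intro: monomial_series_determines_monomial)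

lemma y_elem_add: "y_elem (a + b) = y_elem a * y_elem b"
  by (simp add: y_elem_def mult_single)

text \<open>The l-weight \<open>\<gamma>\<^sub>0\<close> contributes \<open>m\<close> with coefficient 1; any other one contributes \<open>m\<close> times a product
  of inverses of \<open>A_mon\<close>, which is not empty because the monomial determines the l-weight.\<close>

lemma q_character_form:
  assumes m: "monomial_series \<gamma>\<^sub>0 m" "proper_monomial m"
  shows "\<exists>M :: 'i y_monomial multiset. (\<forall>p \<in># M. A_inverse_monomial \<alpha> q p) \<and>
     q_character \<alpha> q scl act = y_elem m * (1 + (\<Sum>p\<in>#M. y_elem p))"
proof -
  let ?L = "l_weights q scl act"
  let ?dim = "\<lambda>\<gamma>. dim (gen_eigenspace q scl act \<gamma>)"
  have g0: "\<gamma>\<^sub>0 \<in> ?L" using v_in_gen_eigenspace v_nonzero by (auto simp: l_weights_def)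
  have "\<exists>S. (\<forall>(i, c)\<in>#S. c \<noteq> 0) \<and> l_weight_monomial \<alpha> q \<gamma> (m + (\<Sum>(i, c)\<in>#S. - A_mon \<alpha> q i c))"
    if "\<gamma> \<in> ?L" for \<gamma> using l_weight_below_highest[OF m that] .
  then obtain S where S: "\<And>\<gamma>. \<gamma> \<in> ?L \<Longrightarrow> \<forall>(i, c)\<in>#S \<gamma>. c \<noteq> 0"
    "\<And>\<gamma>. \<gamma> \<in> ?L \<Longrightarrow> l_weight_monomial \<alpha> q \<gamma> (m + (\<Sum>(i, c)\<in>#S \<gamma>. - A_mon \<alpha> q i c))" by metis
  define p where "p = (\<lambda>\<gamma>. \<Sum>(i, c)\<in>#S \<gamma>. - A_mon \<alpha> q i c)"
  have m0: "l_weight_monomial \<alpha> q \<gamma>\<^sub>0 m" using m by (simp add: l_weight_monomial_iff)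
  have A: "A_inverse_monomial \<alpha> q (p \<gamma>)" if g: "\<gamma> \<in> ?L" "\<gamma> \<noteq> \<gamma>\<^sub>0" for \<gamma>
  proof -
    have "S \<gamma> \<noteq> {#}"
    proof
      assume "S \<gamma> = {#}"
      then have "l_weight_monomial \<alpha> q \<gamma> m" using S(2)[OF g(1)] by simp
      then have "\<gamma> = \<gamma>\<^sub>0" using m(1) monomial_series_determines_series by (auto simp: l_weight_monomial_iff)
      then show False using g(2) by simp
    qed
    then show ?thesis using S(1)[OF g(1)] unfolding A_inverse_monomial_def p_def by blast
  qed
  have THE: "y_elem (THE m'. l_weight_monomial \<alpha> q \<gamma> m') = y_elem m * y_elem (p \<gamma>)" if "\<gamma> \<in> ?L" for \<gamma>
    unfolding THE_l_weight_monomial[OF S(2)[OF that]] p_def by (rule y_elem_add)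
  define M where "M = (\<Sum>\<gamma>\<in>?L - {\<gamma>\<^sub>0}. replicate_mset (?dim \<gamma>) (p \<gamma>))"
  have sumM: "(\<Sum>p\<in>#M. y_elem p) = (\<Sum>\<gamma>\<in>?L - {\<gamma>\<^sub>0}. of_nat (?dim \<gamma>) * y_elem (p \<gamma>))"
  proof -
    have "(\<Sum>p\<in>#(\<Sum>\<gamma>\<in>D. replicate_mset (?dim \<gamma>) (p \<gamma>)). y_elem p) = (\<Sum>\<gamma>\<in>D. of_nat (?dim \<gamma>) * y_elem (p \<gamma>))" for D
    proof (induction D rule: infinite_finite_induct)
      case (insert \<gamma> D)
      have "(\<Sum>p\<in>#replicate_mset n x. y_elem p) = of_nat n * y_elem x" for n and x :: "'i y_monomial"
        by (induction n) (simp_all add: algebra_simps)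
      then show ?case using insert by simp
    qed simp_all
    then show ?thesis by (simp add: M_def)
  qed
  have "q_character \<alpha> q scl act = of_nat (?dim \<gamma>\<^sub>0) * y_elem (THE m'. l_weight_monomial \<alpha> q \<gamma>\<^sub>0 m')
      + (\<Sum>\<gamma>\<in>?L - {\<gamma>\<^sub>0}. of_nat (?dim \<gamma>) * y_elem (THE m'. l_weight_monomial \<alpha> q \<gamma> m'))"
    unfolding q_character_def by (rule sum.remove[OF finite_l_weights g0])
  also have "\<dots> = y_elem m + (\<Sum>\<gamma>\<in>?L - {\<gamma>\<^sub>0}. of_nat (?dim \<gamma>) * (y_elem m * y_elem (p \<gamma>)))"
    unfolding dim_gen_eigenspace_highest THE_l_weight_monomial[OF m0] using THE by simp
  also have "\<dots> = y_elem m * (1 + (\<Sum>p\<in>#M. y_elem p))"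
    unfolding sumM by (simp add: distrib_left sum_distrib_left mult.left_commute)
  finally have "q_character \<alpha> q scl act = y_elem m * (1 + (\<Sum>p\<in>#M. y_elem p))" .
  moreover have "\<forall>p\<in>#M. A_inverse_monomial \<alpha> q p"
  proof
    fix x assume "x \<in># M"
    then have "\<exists>\<gamma>\<in>?L - {\<gamma>\<^sub>0}. x \<in># replicate_mset (?dim \<gamma>) (p \<gamma>)"
      using finite_l_weights unfolding M_def by (subst (asm) set_mset_sum) auto
    then show "A_inverse_monomial \<alpha> q x" using A by (auto split: if_splits)
  qed
  ultimately show ?thesis by blast
qed

end

text \<open>The vectors that are killed by the raising operators and on which \<open>phi\<close> acts by \<open>\<gamma>\<close> form a
  subspace stable under the \<open>h\<close> and \<open>k\<close>, so it contains a joint eigenvector of all of these, while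
  \<open>v\<close> itself is given as an eigenvector of \<open>phi\<close> only.\<close>

lemma (in quantum_module) highest_weight_vector:
  assumes v: "v \<noteq> 0" "\<And>i n. X pPlus i n v = 0" "\<And>s i n. \<phi> s i n v = fps_nth (\<gamma> s i) n \<star> v"
  shows "\<exists>v \<eta> \<kappa>. v \<noteq> 0 \<and> (\<forall>i n. X pPlus i n v = 0) \<and> (\<forall>i n. H i n v = \<eta> i n \<star> v) \<and>
    (\<forall>s i. K s i v = \<kappa> s i \<star> v) \<and> \<gamma> = exp_series \<kappa> \<eta>"
proof -
  define U where "U = {x. (\<forall>i n. X pPlus i n x = 0) \<and> (\<forall>s i n. \<phi> s i n x = fps_nth (\<gamma> s i) n \<star> x)}"
  have "subspace U" unfolding U_def
    by (intro subspaceI) (auto simp: act_vec_simps scale_right_distrib mult.commute)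
  moreover have "H j e x \<in> U" if x: "x \<in> U" for j e x
  proof -
    have "X pPlus i n (H j e x) = 0" for i n
      using H_X[of j e pPlus i n x] x by (simp add: U_def act_vec_simps)
    then show ?thesis using x by (simp add: U_def H_phi[symmetric] act_vec_simps)
  qed
  moreover have "K p j x \<in> U" if x: "x \<in> U" for p j x
  proof -
    have "X pPlus i n (K p j x) = 0" for i n
      using K_X[of p j pPlus i n x] x q_nonzero by (simp add: U_def act_vec_simps)
    then show ?thesis using x by (simp add: U_def K_phi[symmetric] act_vec_simps)
  qed
  ultimately have HK: "HK_stable U" by (simp add: HK_stable_def)
  have "v \<in> U" using v by (simp add: U_def)
  then have "U \<noteq> {0}" using v(1) by blast
  then obtain w \<eta> \<kappa> where w: "w \<in> U" "w \<noteq> 0"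
    "\<And>i n. H i n w = \<eta> i n \<star> w" "\<And>s i. K s i w = \<kappa> s i \<star> w"
    using joint_HK_eigenvector[OF HK] by metis
  have "fps_nth (\<gamma> s i) n \<star> w = fps_nth (exp_series \<kappa> \<eta> s i) n \<star> w" for s i n
    using phi_eigenvalue[of w \<eta> \<kappa> s i n, OF w(3,4)] w(1) by (simp add: U_def)
  then have "fps_nth (\<gamma> s i) n = fps_nth (exp_series \<kappa> \<eta> s i) n" for s i n using w(2) by simp
  then have "\<gamma> = exp_series \<kappa> \<eta>" by (intro ext fps_ext)
  then show ?thesis using w by (auto simp: U_def)
qed

theorem theorem4p1:
  fixes \<Phi> :: "'e::euclidean_space set"
    and \<alpha> :: "'i::finite \<Rightarrow> 'e"
    and q :: complex
    and scl :: "complex \<Rightarrow> 'v::ab_group_add \<Rightarrow> 'v"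
    and act :: "'i uq_free \<Rightarrow> 'v \<Rightarrow> 'v"
    and m_plus :: "'i y_monomial"
  assumes "simple_root_data \<Phi> \<alpha>"
    and "q \<noteq> 0" and "norm q < 1"
    and "uq_module \<alpha> q scl act"
    and "finite_dim scl"
    and "type_1 \<alpha> q scl act"
    and "irreducible_module scl act"
    and "is_highest_monomial \<alpha> q scl act m_plus"
  shows "\<exists>M :: 'i y_monomial multiset.
           (\<forall>p \<in># M. A_inverse_monomial \<alpha> q p) \<and>
           q_character \<alpha> q scl act = y_elem m_plus * (1 + (\<Sum>p\<in>#M. y_elem p))"
proof -
  obtain Basis where "finite_dimensional_vector_space scl Basis"
    using assms(5) unfolding finite_dim_def by blast
  then interpret fdv: finite_dimensional_vector_space scl Basis .
  interpret quantum_module \<Phi> \<alpha> q scl Basis act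
  proof unfold_locales
    show "simple_root_data \<Phi> \<alpha>" "q \<noteq> 0" "norm q < 1" "uq_module \<alpha> q scl act" by fact+
    show "act (gen (C_half pPlus)) v = v" for v using assms(6) by (simp add: type_1_def)
  qed
  obtain a where a: "\<forall>i. 0 \<notin># a i" "has_drinfeld_polynomials \<alpha> q scl act (\<lambda>i. poly_of_roots (a i))"
    "m_plus = Y_product a"
    using assms(8) unfolding is_highest_monomial_def by blast
  let ?\<gamma> = "Gamma_series \<alpha> q (\<lambda>i. poly_of_roots (a i)) (\<lambda>_. 1)"
  obtain v where v: "v \<noteq> 0" "\<And>i n. X pPlus i n v = 0" "\<And>s i n. \<phi> s i n v = scl (fps_nth (?\<gamma> s i) n) v"
    using a(2) unfolding has_drinfeld_polynomials_def by blast
  have \<gamma>: "monomial_series ?\<gamma> m_plus"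
    using Gamma_monomial_series[of a "\<lambda>_. {#}"] a(1,3) by (simp add: poly_of_roots_empty Y_product_def)
  obtain u \<eta> \<kappa> where u: "u \<noteq> 0" "\<And>i n. X pPlus i n u = 0" "\<And>i n. H i n u = scl (\<eta> i n) u"
    "\<And>s i. K s i u = scl (\<kappa> s i) u" "?\<gamma> = exp_series \<kappa> \<eta>"
    using highest_weight_vector[of v ?\<gamma>, OF v] by blast
  interpret highest_weight_module \<Phi> \<alpha> q scl Basis act u \<eta> \<kappa>
    by unfold_locales (use assms(7) u in auto)
  show ?thesis
  proof (rule q_character_form)
    show "monomial_series (exp_series \<kappa> \<eta>) m_plus" using \<gamma> u(5) by simp
    show "proper_monomial m_plus" unfolding a(3) using a(1) by (intro proper_monomial_Y_product) simp
  qed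
qed

end
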